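(* Let $A$ be a semisimple complex Banach algebra with identity. The following two assertions are equivalent. (I) For every linear functional $f$ on $\mathrm{Soc}\,A$, the following three conditions on $f$ are equivalent: (a) $f=\alpha\,\mathrm{Tr}$ for some $\alpha\in\mathbb{C}$; (b) $f(ab)=f(ba)$ for all $a,b\in \mathrm{Soc}\,A$; (c) there exists a real number $c>0$ such that $|f(a)|\le c\cdot\rho(a)$ for all $a\in\mathrm{Soc}\,A$. (II) $\mathrm{Soc}\,A\cong M_n(\mathbb{C})$ for some integer $n\geq 0$, where $M_0(\mathbb{C})=\{0\}$.
   Context: $A$ is a semisimple complex Banach algebra with identity $\mathbf 1$. For $x\in A$, $\sigma(x)$ is the spectrum, $\sigma'(x)=\sigma(x)\setminus\{0\}$, and $\rho(x)$ is the spectral radius; $\#K$ denotes the number of elements of a set $K$. The rank of $a\in A$ is $\mathrm{rank}(a)=\sup_{x\in A}\#\sigma'(xa)\in\{0,1,2,\dots\}\cup\{\infty\}$. The socle $\mathrm{Soc}\,A$ is the two-sided ideal of all finite-rank elements of $A$ (it coincides with the usual socle, the sum of all minimal left ideals, and is $\{0\}$ if there are none). For $a\in \mathrm{Soc}\,A$ let $E(a)=\{x\in A:\#\sigma'(xa)=\mathrm{rank}(a)\}$, which is a dense open subset of $A$. For $a\in\mathrm{Soc}\,A$ and $\lambda\in\sigma(a)$, let $B(\lambda,r)$ be an open disk whose closure contains no point of $\sigma(a)$ other than $\lambda$; there is an open ball $U\subseteq A$ centered at $\mathbf 1$ such that $\#[\sigma(xa)\cap B(\lambda,r)]$ is constant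 for $x\in E(a)\cap U$, and this constant is the multiplicity $m(\lambda,a)$. The trace is $\mathrm{Tr}(a)=\sum_{\lambda\in\sigma(a)}\lambda\, m(\lambda,a)$ for $a\in\mathrm{Soc}\,A$; it is a linear functional on $\mathrm{Soc}\,A$. Linear functionals are complex-linear and not assumed continuous. The symbol $\cong$ denotes isomorphism as (complex) algebras. *)

theory Defs
  imports "HOL-Analysis.Analysis" "HOL-Library.Extended_Nat" "Jordan_Normal_Form.Matrix"
begin

class scaleC =
  fixes scaleC :: "complex \<Rightarrow> 'a \<Rightarrow> 'a" (infixr "*\<^sub>C" 75)

text \<open>
  Complex Banach algebras with identity. The axiom \<open>0 \<noteq> 1\<close> is inherited from
  \<^class>\<open>real_algebra_1\<close>; the normalisation \<open>norm 1 = 1\<close> is not imposed.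
\<close>

class complex_banach_algebra_1 = scaleC + real_normed_algebra + real_algebra_1 + banach +
  assumes scaleC_add_right: "c *\<^sub>C (x + y) = c *\<^sub>C x + c *\<^sub>C y"
    and scaleC_add_left: "(c + d) *\<^sub>C x = c *\<^sub>C x + d *\<^sub>C x"
    and scaleC_scaleC: "c *\<^sub>C d *\<^sub>C x = (c * d) *\<^sub>C x"
    and scaleC_of_real: "complex_of_real r *\<^sub>C x = r *\<^sub>R x"
    and mult_scaleC_left: "(c *\<^sub>C x) * y = c *\<^sub>C (x * y)"
    and mult_scaleC_right: "x * (c *\<^sub>C y) = c *\<^sub>C (x * y)"
    and norm_scaleC: "norm (c *\<^sub>C x) = cmod c * norm x"

text \<open>
  Semisimplicity means that the Jacobson radical, the intersection of all maximal left
  ideals, is zero. Since there is an identity, closure of a left ideal under negation and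
  under scalar multiplication follows from closure under left multiplication.
\<close>

definition left_ideal :: "'a::ring_1 set \<Rightarrow> bool" where
  "left_ideal L \<longleftrightarrow> 0 \<in> L \<and> (\<forall>x\<in>L. \<forall>y\<in>L. x + y \<in> L) \<and> (\<forall>a. \<forall>x\<in>L. a * x \<in> L)"

definition maximal_left_ideal :: "'a::ring_1 set \<Rightarrow> bool" where
  "maximal_left_ideal L \<longleftrightarrow> left_ideal L \<and> L \<noteq> UNIV \<and>
     (\<forall>J. left_ideal J \<longrightarrow> L \<subseteq> J \<longrightarrow> J = L \<or> J = UNIV)"

definition jacobson_radical :: "'a::ring_1 set" where
  "jacobson_radical = \<Inter> {L. maximal_left_ideal L}"

definition semisimple_algebra :: "'a::ring_1 itself \<Rightarrow> bool" where
  "semisimple_algebra TYPE('a) \<longleftrightarrow> (jacobson_radical :: 'a set) = {0}"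

definition alg_invertible :: "'a::ring_1 \<Rightarrow> bool" where
  "alg_invertible x \<longleftrightarrow> (\<exists>y. x * y = 1 \<and> y * x = 1)"

definition alg_spectrum :: "'a::complex_banach_algebra_1 \<Rightarrow> complex set" where
  "alg_spectrum x = {\<mu>. \<not> alg_invertible (\<mu> *\<^sub>C 1 - x)}"

definition nonzero_spectrum :: "'a::complex_banach_algebra_1 \<Rightarrow> complex set" where
  "nonzero_spectrum x = alg_spectrum x - {0}"

definition alg_spectral_radius :: "'a::complex_banach_algebra_1 \<Rightarrow> real" where
  "alg_spectral_radius x = (SUP \<mu>\<in>alg_spectrum x. cmod \<mu>)"

text \<open>Unlike \<^const>\<open>card\<close>, the following assigns \<open>\<infinity>\<close> to infinite sets.\<close>

definition ecard :: "'b set \<Rightarrow> enat" where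
  "ecard K = (if finite K then enat (card K) else \<infinity>)"

definition alg_rank :: "'a::complex_banach_algebra_1 \<Rightarrow> enat" where
  "alg_rank a = (SUP x. ecard (nonzero_spectrum (x * a)))"

definition soc :: "'a::complex_banach_algebra_1 set" where
  "soc = {a. alg_rank a \<noteq> \<infinity>}"

definition rank_attaining :: "'a::complex_banach_algebra_1 \<Rightarrow> 'a set" where
  "rank_attaining a = {x. ecard (nonzero_spectrum (x * a)) = alg_rank a}"

text \<open>
  For \<open>a \<in> soc\<close> and \<open>\<mu> \<in> alg_spectrum a\<close> the multiplicity is the number \<open>m\<close> such that
  every disk isolating \<open>\<mu>\<close> in the spectrum of \<open>a\<close> contains exactly \<open>m\<close> points of the spectrum
  of \<open>x * a\<close>, for all rank-attaining \<open>x\<close> close enough to \<open>1\<close>.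
\<close>

definition multiplicity_at :: "complex \<Rightarrow> 'a::complex_banach_algebra_1 \<Rightarrow> nat" where
  "multiplicity_at \<mu> a = (THE m. \<forall>r>0. cball \<mu> r \<inter> alg_spectrum a = {\<mu>} \<longrightarrow>
     (\<exists>\<epsilon>>0. \<forall>x \<in> rank_attaining a \<inter> ball 1 \<epsilon>.
        ecard (alg_spectrum (x * a) \<inter> ball \<mu> r) = enat m))"

definition soc_trace :: "'a::complex_banach_algebra_1 \<Rightarrow> complex" where
  "soc_trace a = (\<Sum>\<mu>\<in>alg_spectrum a. \<mu> * of_nat (multiplicity_at \<mu> a))"

text \<open>
  A linear functional on a subspace \<open>S\<close> is represented by a function on the whole type,
  only the values on \<open>S\<close> being relevant.
\<close>

definition linear_functional_on :: "'a::complex_banach_algebra_1 set \<Rightarrow> ('a \<Rightarrow> complex) \<Rightarrow> bool" where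
  "linear_functional_on S f \<longleftrightarrow>
     (\<forall>a\<in>S. \<forall>b\<in>S. f (a + b) = f a + f b) \<and> (\<forall>c. \<forall>a\<in>S. f (c *\<^sub>C a) = c * f a)"

text \<open>
  Isomorphism of a subalgebra \<open>S\<close> with the algebra of complex \<open>n \<times> n\<close> matrices; for \<open>n = 0\<close>
  the carrier consists of the empty matrix only, so it is the zero algebra.
\<close>

definition isomorphic_to_matrix_algebra :: "'a::complex_banach_algebra_1 set \<Rightarrow> nat \<Rightarrow> bool" where
  "isomorphic_to_matrix_algebra S n \<longleftrightarrow>
     (\<exists>\<phi> :: 'a \<Rightarrow> complex mat. bij_betw \<phi> S (carrier_mat n n) \<and>
        (\<forall>a\<in>S. \<forall>b\<in>S. \<phi> (a + b) = \<phi> a + \<phi> b) \<and>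
        (\<forall>a\<in>S. \<forall>b\<in>S. \<phi> (a * b) = \<phi> a * \<phi> b) \<and>
        (\<forall>c. \<forall>a\<in>S. \<phi> (c *\<^sub>C a) = c \<cdot>\<^sub>m \<phi> a))"

end

theory Submission
  imports Defs "Jordan_Normal_Form.Schur_Decomposition"
begin

text \<open>
  For a minimal idempotent \<open>p\<close> the elements of the socle act on \<open>A p\<close> by finite-rank operators, and the
  trace of this action is a linear functional on the socle satisfying (b). If (I) holds, then all functionals
  satisfying (b) are proportional, which leaves room for only one isomorphism class of modules \<open>A p\<close>,
  and (c) bounds the dimension of \<open>A p\<close>, because idempotents have spectral radius at most one. A basis
  of \<open>A p\<close> together with a dual system then yields a central idempotent \<open>e\<close> such that the socle is \<open>e A\<close>,
  a full matrix algebra. Minimal idempotents come from Riesz idempotents of elements with finite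
  spectrum.

  Conversely, if the socle is a matrix algebra, then spectra are sets of eigenvalues (up to zero) and, by
  continuity of the roots of the characteristic polynomial, multiplicities are algebraic
  multiplicities. So \<open>Tr\<close> is the matrix trace, and (b) and (c) are evaluated on matrix units.
\<close>

text \<open>The direction from (I) therefore takes its functionals from the modules
  \<open>A p\<close>; \<open>soc_trace\<close> occurs there only as a common factor through which
  two such functionals are compared. In the converse direction \<open>multiplicity_at\<close> has to
  be evaluated, and uniqueness of its value requires rank-attaining elements arbitrarily close to 1.

  Holomorphic functional calculus is replaced by algebra and elementary estimates. Averages over
  roots of unity stand for Cauchy integrals, and a Riesz idempotent is a Lagrange polynomial in the
  element, idempotent up to a quasinilpotent error and then corrected by a binomial series. Since
  the idempotents at hand are rarely 1, invertibility is mostly examined in a corner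
  \<open>p A p\<close>. As \<open>norm 1\<close> may differ from 1, estimates of powers start at the
  first power or carry \<open>norm 1\<close> as a factor.\<close>

interpretation cvs: vector_space "scaleC :: complex \<Rightarrow> 'a \<Rightarrow> 'a::complex_banach_algebra_1"
proof
  fix x :: 'a
  show "1 *\<^sub>C x = x" using scaleC_of_real[of 1 x] by simp
qed (simp_all add: scaleC_add_right scaleC_add_left scaleC_scaleC)

lemmas scaleC_simps [simp] = mult_scaleC_left mult_scaleC_right cvs.scale_one cvs.scale_scale

section \<open>Invertibility, nonzero spectrum and semisimplicity\<close>

lemma alg_invertibleI: "x * y = 1 \<Longrightarrow> z * x = 1 \<Longrightarrow> alg_invertible (x::'a::ring_1)"
  unfolding alg_invertible_def by (metis mult.assoc mult.left_neutral mult.right_neutral)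

lemma alg_invertible_mult: "alg_invertible x \<Longrightarrow> alg_invertible y \<Longrightarrow> alg_invertible (x * y :: 'a::ring_1)"
proof -
  assume "alg_invertible x" "alg_invertible y"
  then obtain x' y' where "x * x' = 1" "x' * x = 1" "y * y' = 1" "y' * y = 1"
    unfolding alg_invertible_def by blast
  then have "(x * y) * (y' * x') = 1" "(y' * x') * (x * y) = 1"
    by (metis mult.assoc mult.right_neutral)+
  then show ?thesis unfolding alg_invertible_def by blast
qed

lemma alg_invertible_factor_comm:
  fixes x y :: "'a::ring_1"
  assumes "alg_invertible (x * y)" "x * y = y * x"
  shows "alg_invertible x"
proof -
  obtain z where "x * y * z = 1" "z * (x * y) = 1"
    using assms unfolding alg_invertible_def by blast
  then show ?thesis
    using alg_invertibleI[of x "y * z" "z * y"] assms(2) by (metis mult.assoc)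
qed

lemma alg_invertible_1 [simp]: "alg_invertible (1::'a::ring_1)"
  unfolding alg_invertible_def by (intro exI[of _ 1]) simp

lemma alg_invertible_uminus: "alg_invertible (- x) = alg_invertible (x::'a::ring_1)"
  unfolding alg_invertible_def by (metis minus_mult_minus minus_minus)

lemma alg_invertible_scaleC:
  fixes x :: "'a::complex_banach_algebra_1"
  assumes "c \<noteq> 0"
  shows "alg_invertible (c *\<^sub>C x) = alg_invertible x"
proof -
  have *: "alg_invertible (d *\<^sub>C z)" if z: "alg_invertible z" and d: "d \<noteq> 0" for d :: complex and z :: 'a
  proof -
    obtain y where "z * y = 1" "y * z = 1" using z unfolding alg_invertible_def by blast
    then show ?thesis using d by (intro alg_invertibleI[of _ "inverse d *\<^sub>C y" "inverse d *\<^sub>C y"]) auto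
  qed
  show ?thesis
    using *[of x c] *[of "c *\<^sub>C x" "inverse c"] assms by auto
qed

text \<open>Jacobson's lemma: if \<open>w\<close> inverts \<open>1 - a * b\<close>, then
  \<open>1 + b * w * a\<close> inverts \<open>1 - b * a\<close>, as the formal geometric series
  suggests.\<close>

lemma alg_invertible_one_minus_commute:
  fixes a b :: "'a::ring_1"
  assumes "alg_invertible (1 - a * b)"
  shows "alg_invertible (1 - b * a)"
proof -
  obtain w where w: "(1 - a * b) * w = 1" "w * (1 - a * b) = 1"
    using assms unfolding alg_invertible_def by blast
  have "(1 - b * a) * (1 + b * w * a) = 1 - b * a + b * ((1 - a * b) * w) * a"
    by (simp add: algebra_simps)
  moreover have "(1 + b * w * a) * (1 - b * a) = 1 - b * a + b * (w * (1 - a * b)) * a"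
    by (simp add: algebra_simps)
  ultimately show ?thesis using w by (intro alg_invertibleI) auto
qed

lemma nonzero_spectrum_iff:
  fixes x :: "'a::complex_banach_algebra_1"
  shows "\<mu> \<in> nonzero_spectrum x \<longleftrightarrow> \<mu> \<noteq> 0 \<and> \<not> alg_invertible (1 - inverse \<mu> *\<^sub>C x)"
proof -
  have "\<mu> *\<^sub>C 1 - x = \<mu> *\<^sub>C (1 - inverse \<mu> *\<^sub>C x)" if "\<mu> \<noteq> 0"
    using that by (simp add: cvs.scale_right_diff_distrib)
  then show ?thesis
    unfolding nonzero_spectrum_def alg_spectrum_def
    using alg_invertible_scaleC[of \<mu> "1 - inverse \<mu> *\<^sub>C x"] by fastforce
qed

lemma zero_in_alg_spectrum: "0 \<in> alg_spectrum a \<longleftrightarrow> \<not> alg_invertible a"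
  using alg_invertible_uminus[of a] by (simp add: alg_spectrum_def)

lemma nonzero_spectrum_commute:
  "nonzero_spectrum (x * y) = nonzero_spectrum (y * x :: 'a::complex_banach_algebra_1)"
proof -
  have "nonzero_spectrum (x * y) \<subseteq> nonzero_spectrum (y * x)" for x y :: 'a
  proof
    fix \<mu> assume "\<mu> \<in> nonzero_spectrum (x * y)"
    then show "\<mu> \<in> nonzero_spectrum (y * x)"
      using alg_invertible_one_minus_commute[of y "inverse \<mu> *\<^sub>C x"]
      by (auto simp: nonzero_spectrum_iff)
  qed
  then show ?thesis by blast
qed

lemma nonzero_spectrum_scaleC:
  fixes x :: "'a::complex_banach_algebra_1"
  assumes "c \<noteq> 0"
  shows "nonzero_spectrum (c *\<^sub>C x) = (\<lambda>\<mu>. c * \<mu>) ` nonzero_spectrum x"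
proof -
  have *: "(\<lambda>\<mu>. d * \<mu>) ` nonzero_spectrum y \<subseteq> nonzero_spectrum (d *\<^sub>C y)" if "d \<noteq> 0" for d and y :: 'a
    using that by (auto simp: nonzero_spectrum_iff field_simps)
  from *[of "inverse c" "c *\<^sub>C x"] assms
  have "(\<lambda>\<mu>. inverse c * \<mu>) ` nonzero_spectrum (c *\<^sub>C x) \<subseteq> nonzero_spectrum x" by simp
  then have "(\<lambda>\<mu>. c * \<mu>) ` (\<lambda>\<mu>. inverse c * \<mu>) ` nonzero_spectrum (c *\<^sub>C x) \<subseteq> (\<lambda>\<mu>. c * \<mu>) ` nonzero_spectrum x"
    by blast
  then show ?thesis using *[OF assms, of x] assms by (simp add: image_image flip: mult.assoc)
qed

text \<open>A maximal left ideal not containing \<open>n\<close> would contain some \<open>1 - x * n\<close>.\<close>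

lemma semisimple_eq_0I:
  fixes n :: "'a::ring_1"
  assumes "semisimple_algebra TYPE('a)" and inv: "\<And>x. alg_invertible (1 - x * n)"
  shows "n = 0"
proof -
  have "n \<in> L" if L: "maximal_left_ideal L" for L
  proof (rule ccontr)
    assume n: "n \<notin> L"
    have L0: "0 \<in> L" and Ladd: "\<And>x y. x \<in> L \<Longrightarrow> y \<in> L \<Longrightarrow> x + y \<in> L"
      and Lmul: "\<And>a x. x \<in> L \<Longrightarrow> a * x \<in> L"
      using L by (simp_all add: maximal_left_ideal_def left_ideal_def)
    define J where "J = {l + x * n | l x. l \<in> L}"
    have "left_ideal J"
      unfolding left_ideal_def
    proof (intro conjI ballI allI)
      show "0 \<in> J" unfolding J_def using L0 by (auto intro!: exI[of _ 0])
      fix u v assume "u \<in> J" "v \<in> J"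
      then obtain l x m y where "u = l + x * n" "v = m + y * n" "l \<in> L" "m \<in> L"
        unfolding J_def by blast
      then have "u + v = (l + m) + (x + y) * n" "l + m \<in> L" using Ladd by (auto simp: algebra_simps)
      then show "u + v \<in> J" unfolding J_def by blast
    next
      fix a u assume "u \<in> J"
      then obtain l x where "u = l + x * n" "l \<in> L" unfolding J_def by blast
      then have "a * u = a * l + (a * x) * n" "a * l \<in> L" using Lmul by (auto simp: algebra_simps)
      then show "a * u \<in> J" unfolding J_def by blast
    qed
    moreover have "L \<subseteq> J" unfolding J_def by clarsimp (metis add.right_neutral mult_zero_left)
    moreover have "n \<in> J" unfolding J_def using L0 by clarsimp (metis add.left_neutral mult_1_left)
    ultimately have "J = UNIV" using L n unfolding maximal_left_ideal_def by blast
    then obtain l x where "1 = l + x * n" "l \<in> L" unfolding J_def by blast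
    then have "1 - x * n \<in> L" by (metis add_diff_cancel_right')
    then have "1 \<in> L" using inv[of x] Lmul unfolding alg_invertible_def by metis
    then have "L = UNIV" using Lmul by (metis UNIV_eq_I mult.right_neutral)
    then show False using L unfolding maximal_left_ideal_def by blast
  qed
  then have "n \<in> jacobson_radical" unfolding jacobson_radical_def by blast
  then show ?thesis using assms(1) unfolding semisimple_algebra_def by blast
qed

text \<open>Each \<open>x * z\<close> squares to zero, so \<open>1 + x * z\<close> inverts
  \<open>1 - x * z\<close> and \<open>z\<close> passes the radical test. In this form semisimplicity
  later yields nonzero compressions and the centrality of an idempotent.\<close>

lemma semisimple_semiprime:
  fixes z :: "'a::ring_1"
  assumes "semisimple_algebra TYPE('a)" and z: "\<And>x. z * x * z = 0"
  shows "z = 0"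
proof (rule semisimple_eq_0I[OF assms(1)])
  fix x
  have "(x * z) * (x * z) = 0" using z[of x] by (metis mult.assoc mult_zero_right)
  then have "(1 - x * z) * (1 + x * z) = 1" "(1 + x * z) * (1 - x * z) = 1"
    by (auto simp: algebra_simps)
  then show "alg_invertible (1 - x * z)" by (rule alg_invertibleI)
qed

section \<open>Polynomials in an element of the algebra\<close>

definition peval :: "complex poly \<Rightarrow> 'a::complex_banach_algebra_1 \<Rightarrow> 'a" where
  "peval p b = fold_coeffs (\<lambda>c y. c *\<^sub>C 1 + b * y) p 0"

lemma peval_0 [simp]: "peval 0 b = 0"
  by (simp add: peval_def)

lemma peval_pCons [simp]: "peval (pCons c p) b = c *\<^sub>C 1 + b * peval p b"
  by (cases "c = 0 \<and> p = 0") (auto simp: peval_def)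

lemma peval_add [simp]: "peval (p + q) b = peval p b + peval q b"
proof (induction p q rule: poly_induct2)
  case (pCons c p d q)
  then show ?case by (simp add: algebra_simps cvs.scale_left_distrib)
qed simp

lemma peval_smult [simp]: "peval (Polynomial.smult c p) b = c *\<^sub>C peval p b"
  by (induction p) (simp_all add: cvs.scale_right_distrib)

lemma peval_mult [simp]: "peval (p * q) b = peval p b * peval q b"
  by (induction p) (simp_all add: algebra_simps)

lemma peval_diff [simp]: "peval (p - q) b = peval p b - peval q b"
  using peval_add[of "p - q" q b] by simp

lemma peval_1 [simp]: "peval 1 b = 1"
  by (simp add: one_pCons)

lemma peval_comm:
  assumes "b * x = x * b"
  shows "peval p b * x = x * peval p b"
proof (induction p)
  case (pCons c p)
  have "b * peval p b * x = x * (b * peval p b)"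
    using pCons assms by (metis mult.assoc)
  then show ?case by (simp add: distrib_left distrib_right)
qed simp

text \<open>The part of the spectral mapping theorem that Riesz idempotents require:
  \<open>P\<close> splits over the complex numbers, and each linear factor is invertible at
  \<open>b\<close> because its root avoids the spectrum.\<close>

lemma alg_invertible_peval:
  fixes b :: "'a::complex_banach_algebra_1"
  assumes "P \<noteq> 0" and "\<And>\<mu>. poly P \<mu> = 0 \<Longrightarrow> \<mu> \<notin> alg_spectrum b"
  shows "alg_invertible (peval P b)"
  using assms
proof (induction "degree P" arbitrary: P)
  case 0
  then obtain c where "P = [:c:]" by (metis degree_eq_zeroE)
  then show ?case using 0 by (simp add: alg_invertible_scaleC)
next
  case (Suc n)
  obtain \<mu> where \<mu>: "poly P \<mu> = 0" using alg_closed_imp_poly_has_root[of P] Suc(2) by auto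
  then obtain Q where Q: "P = [:-\<mu>, 1:] * Q" using poly_eq_0_iff_dvd by (metis dvdE)
  have "Q \<noteq> 0" using Q Suc(3) by auto
  then have "degree Q = n" using Q Suc(2) by (simp add: degree_mult_eq del: mult_pCons_left)
  then have "alg_invertible (peval Q b)"
    using Suc(1)[of Q] \<open>Q \<noteq> 0\<close> Suc(4) Q by (metis mult_eq_0_iff poly_mult)
  moreover have "alg_invertible (peval [:-\<mu>, 1:] b)"
  proof -
    have "peval [:-\<mu>, 1:] b = - (\<mu> *\<^sub>C 1 - b)" by simp
    then show ?thesis using Suc(4)[OF \<mu>] unfolding alg_spectrum_def
      by (metis (mono_tags) alg_invertible_uminus mem_Collect_eq)
  qed
  ultimately show ?case unfolding Q by (simp only: peval_mult alg_invertible_mult)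
qed

section \<open>Quasinilpotent elements and Riesz idempotents\<close>

lemma scaleC_power: "(c *\<^sub>C x) ^ n = c ^ n *\<^sub>C x ^ n" for x :: "'a::complex_banach_algebra_1"
  by (induction n) auto

lemma sum_powers_mult_one_minus:
  "(\<Sum>j<n. u ^ j) * (1 - u) = 1 - u ^ n" for u :: "'a::ring_1"
proof (induction n)
  case (Suc n)
  have "(\<Sum>j<Suc n. u ^ j) * (1 - u) = (\<Sum>j<n. u ^ j) * (1 - u) + u ^ n - u ^ Suc n"
    by (simp add: distrib_right right_diff_distrib power_Suc2 del: power_Suc)
  then show ?case using Suc by simp
qed simp

text \<open>For \<open>0 < j < n\<close> the j-th power of the primitive root is an n-th root of
  unity other than 1, so its geometric sum over a full period vanishes. In the averages of the
  resolvent this removes all powers of \<open>q\<close> from 1 to \<open>n - 1\<close>.\<close>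

lemma sum_powers_of_root_unity:
  assumes "0 < j" "j < n"
  shows "(\<Sum>k<n. (cis (2 * pi / n) ^ k) ^ j) = 0"
proof -
  define w where "w = cis (2 * pi / n)"
  have "real n * (2 * pi / n) = 2 * pi" using assms by simp
  then have "w ^ n = 1" by (simp only: w_def Complex.DeMoivre cis_2pi)
  have "inj_on (\<lambda>k. cis (2 * pi * real k / real n)) {..<n}"
    using Complex.bij_betw_roots_unity[of n] assms by (auto simp: bij_betw_def)
  from inj_onD[OF this, of j 0] have "cis (2 * pi * real j / real n) \<noteq> 1"
    using assms by auto
  then have "w ^ j \<noteq> 1" by (simp add: w_def Complex.DeMoivre mult_ac)
  have "(\<Sum>k<n. (w ^ k) ^ j) = (\<Sum>k<n. (w ^ j) ^ k)"
    by (simp add: mult.commute flip: power_mult)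
  also have "\<dots> = 0"
    using geometric_sum[OF \<open>w ^ j \<noteq> 1\<close>, of n] \<open>w ^ n = 1\<close>
    by (simp add: power_mult [symmetric] mult.commute[of j n]) (simp add: power_mult)
  finally show ?thesis unfolding w_def .
qed

text \<open>The resolvent identity \<open>F z - F w = (z - w) *\<^sub>C (F z * (q * F w))\<close>
  gives continuity once \<open>F\<close> is bounded near \<open>w\<close>, and that bound comes from
  the identity itself.\<close>

lemma resolvent_continuous:
  fixes q :: "'a::complex_banach_algebra_1"
  assumes F: "\<And>z. (1 - z *\<^sub>C q) * F z = 1" "\<And>z. F z * (1 - z *\<^sub>C q) = 1"
  shows "continuous_on UNIV F"
proof -
  have "(F \<longlongrightarrow> F w) (at w)" for w
  proof -
    define K where "K = norm q * norm (F w)"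
    have bd: "norm (F z - F w) \<le> cmod (z - w) * (2 * norm (F w) * K)" if "cmod (z - w) * K \<le> 1 / 2" for z
    proof -
      have "F z - F w = F z * ((1 - w *\<^sub>C q) * F w) - (F z * (1 - z *\<^sub>C q)) * F w"
        using F by simp
      also have "\<dots> = (z - w) *\<^sub>C (F z * (q * F w))"
        by (simp add: algebra_simps cvs.scale_left_diff_distrib)
      finally have "norm (F z - F w) = cmod (z - w) * norm (F z * (q * F w))" by (simp add: norm_scaleC)
      also have "norm (F z * (q * F w)) \<le> norm (F z) * K"
        unfolding K_def by (meson norm_ge_zero norm_mult_ineq mult_left_mono order_trans)
      finally have 1: "norm (F z - F w) \<le> cmod (z - w) * (norm (F z) * K)"
        by (simp add: mult_left_mono)
      \<comment> \<open>For \<open>z\<close> near \<open>w\<close> the difference is at most half of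
        \<open>norm (F z)\<close>, which is absorbed on the left.\<close>
      have "norm (F z) \<le> norm (F w) + norm (F z - F w)"
        by (metis add.commute diff_add_cancel norm_triangle_ineq)
      also have "\<dots> \<le> norm (F w) + (1 / 2) * norm (F z)"
        using 1 mult_right_mono[OF that, of "norm (F z)"] by (simp add: mult_ac)
      finally have "norm (F z) \<le> 2 * norm (F w)" by simp
      then have "norm (F z) * K \<le> 2 * norm (F w) * K" unfolding K_def by (intro mult_right_mono) auto
      then show ?thesis using 1 by (meson mult_left_mono norm_ge_zero order_trans)
    qed
    have lim: "((\<lambda>z. cmod (z - w) * c) \<longlongrightarrow> 0) (at w)" for c
      by (auto intro!: tendsto_eq_intros)
    have "\<forall>\<^sub>F z in at w. cmod (z - w) * K < 1 / 2"
      by (rule order_tendstoD(2)[OF lim]) simp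
    then have "\<forall>\<^sub>F z in at w. norm (F z - F w) \<le> cmod (z - w) * (2 * norm (F w) * K)"
      by eventually_elim (use bd in auto)
    then have "((\<lambda>z. F z - F w) \<longlongrightarrow> 0) (at w)"
      by (rule Lim_null_comparison[OF _ lim])
    then show ?thesis by (simp add: LIM_zero_iff)
  qed
  then show ?thesis by (simp add: continuous_on_def)
qed

text \<open>The average of the resolvent \<open>F\<close> over the \<open>n\<close>-th roots of unity is the inverse of
  \<open>1 - (z q)\<^sup>n\<close>; this replaces Cauchy's formula in the proof of the spectral radius formula.\<close>

lemma resolvent_average:
  fixes q :: "'a::complex_banach_algebra_1"
  assumes F: "\<And>z. (1 - z *\<^sub>C q) * F z = 1" and "n > 0"
  shows "(1 - z ^ n *\<^sub>C q ^ n) * ((1 / of_nat n) *\<^sub>C (\<Sum>k<n. F (cis (2 * pi / n) ^ k * z))) = 1"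
proof -
  let ?w = "\<lambda>k. cis (2 * pi / n) ^ k"
  have "real n * (2 * pi / n) = 2 * pi" using \<open>n > 0\<close> by simp
  then have "cis (2 * pi / n) ^ n = 1" by (simp only: Complex.DeMoivre cis_2pi)
  then have wn: "(?w k) ^ n = 1" for k
    by (metis mult.commute power_mult power_one)
  have "(1 - z ^ n *\<^sub>C q ^ n) * F (?w k * z) = (\<Sum>j<n. (?w k * z) ^ j *\<^sub>C q ^ j)" for k
  proof -
    let ?u = "(?w k * z) *\<^sub>C q"
    have "z ^ n *\<^sub>C q ^ n = ?u ^ n" by (simp add: scaleC_power power_mult_distrib wn)
    then have "(1 - z ^ n *\<^sub>C q ^ n) * F (?w k * z) = (\<Sum>j<n. ?u ^ j) * ((1 - ?u) * F (?w k * z))"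
      by (simp add: sum_powers_mult_one_minus flip: mult.assoc)
    then show ?thesis using F by (simp add: scaleC_power)
  qed
  then have "(1 - z ^ n *\<^sub>C q ^ n) * (\<Sum>k<n. F (?w k * z)) = (\<Sum>k<n. \<Sum>j<n. (?w k * z) ^ j *\<^sub>C q ^ j)"
    by (simp add: sum_distrib_left)
  also have "\<dots> = (\<Sum>j<n. (\<Sum>k<n. ?w k ^ j) *\<^sub>C (z ^ j *\<^sub>C q ^ j))"
    by (subst sum.swap) (simp add: cvs.scale_sum_left sum_distrib_right power_mult_distrib)
  also have "\<dots> = (\<Sum>j\<in>{0}. (\<Sum>k<n. ?w k ^ j) *\<^sub>C (z ^ j *\<^sub>C q ^ j))"
    using \<open>n > 0\<close> sum_powers_of_root_unity[of _ n] by (intro sum.mono_neutral_right) auto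
  also have "\<dots> = of_nat n *\<^sub>C 1" by simp
  finally show ?thesis using \<open>n > 0\<close> by (simp add: divide_simps)
qed

text \<open>The spectral radius formula for an element whose only spectral value is 0. Write
  \<open>S t\<close> for decay at radius \<open>t\<close>. Decay at \<open>t\<close> makes the
  averaged resolvent at \<open>t\<close> tend to 1; uniform continuity on a disk keeps the average
  at a slightly larger \<open>s\<close> near 1, so its inverse
  \<open>1 - s ^ n *\<^sub>C q ^ n\<close> stays bounded, and decay follows at any radius below
  \<open>s\<close>. The gain in radius is uniform, so finitely many steps lead from 0 to
  \<open>T\<close>.\<close>

lemma quasinilpotent_tendsto:
  fixes q :: "'a::complex_banach_algebra_1"
  assumes inv: "\<And>z. alg_invertible (1 - z *\<^sub>C q)" and "T \<ge> 0"
  shows "(\<lambda>n. T ^ n * norm (q ^ n)) \<longlonglongrightarrow> 0"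
proof -
  define S where "S t \<longleftrightarrow> (\<lambda>n. t ^ n * norm (q ^ n)) \<longlonglongrightarrow> 0" for t :: real
  have S_mono: "S s" if "S t" "0 \<le> s" "s \<le> t" for s t
    unfolding S_def
    by (rule tendsto_sandwich[OF _ _ tendsto_const that(1)[unfolded S_def]])
      (use that in \<open>auto intro!: always_eventually mult_right_mono power_mono\<close>)
  have "S 0" unfolding S_def
    by (rule tendsto_eventually) (auto simp: eventually_sequentially intro!: exI[of _ 1])
  obtain F where F: "\<And>z. (1 - z *\<^sub>C q) * F z = 1" "\<And>z. F z * (1 - z *\<^sub>C q) = 1"
    using inv unfolding alg_invertible_def by metis
  define G where "G n z = (1 / of_nat n) *\<^sub>C (\<Sum>k<n. F (cis (2 * pi / n) ^ k * z))" for n z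
  have G: "(1 - z ^ n *\<^sub>C q ^ n) * G n z = 1" if "n > 0" for n z
    unfolding G_def using resolvent_average[of q F n z, OF F(1) that] by simp
  \<comment> \<open>The disk must contain the radius \<open>s\<close> of each step, which exceeds
    \<open>t \<le> T\<close> by less than 1.\<close>
  define R where "R = T + 1"
  have cont: "continuous_on (cball 0 R) F"
    using resolvent_continuous[OF F] continuous_on_subset by blast
  then have "uniformly_continuous_on (cball 0 R) F"
    by (rule compact_uniformly_continuous) simp
  then obtain \<delta>' where \<delta>': "\<delta>' > 0"
    "\<And>z w. z \<in> cball 0 R \<Longrightarrow> w \<in> cball 0 R \<Longrightarrow> dist z w < \<delta>' \<Longrightarrow> dist (F z) (F w) < 1 / 8"
    unfolding uniformly_continuous_on_def by (metis zero_less_divide_1_iff zero_less_numeral)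
  obtain B where B: "\<And>z. z \<in> cball 0 R \<Longrightarrow> norm (F z) \<le> B"
    using compact_imp_bounded[OF compact_continuous_image[OF cont compact_cball]]
    unfolding bounded_iff by blast
  have avg: "norm ((1 / of_nat n) *\<^sub>C (\<Sum>k<n. H k)) \<le> C"
    if "n > 0" "\<And>k. k < n \<Longrightarrow> norm (H k) \<le> C" for n C and H :: "nat \<Rightarrow> 'a"
  proof -
    have "norm (\<Sum>k<n. H k) \<le> (\<Sum>k<n. C)" by (rule sum_norm_le) (use that in auto)
    then show ?thesis using that(1) by (simp add: norm_scaleC norm_divide divide_simps mult.commute)
  qed
  have rot: "cmod (cis (2 * pi / n) ^ k * z) = cmod z" for n k :: nat and z
    by (simp add: norm_mult norm_power)
  define \<delta> where "\<delta> = min \<delta>' 1"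
  have \<delta>: "\<delta> > 0" "\<delta> \<le> 1" using \<delta>'(1) by (auto simp: \<delta>_def)
  have step: "S (t + \<delta> / 2)" if t: "S t" "0 \<le> t" "t \<le> T" for t
  proof -
    \<comment> \<open>A radius strictly between the target \<open>t + \<delta> / 2\<close>, where
      boundedness at \<open>s\<close> becomes geometric decay, and \<open>t + \<delta>\<close>, up
      to which uniform continuity applies.\<close>
    define s where "s = t + 3 * \<delta> / 4"
    have s: "0 \<le> s" "s \<le> R" "t \<le> R" "s - t < \<delta>'" "t \<le> s" using t \<delta> by (auto simp: s_def R_def \<delta>_def)
    have near: "norm (G n (of_real s) - G n (of_real t)) \<le> 1 / 8" if "n > 0" for n
    proof -
      have "G n (of_real s) - G n (of_real t)
        = (1 / of_nat n) *\<^sub>C (\<Sum>k<n. F (cis (2 * pi / n) ^ k * of_real s) - F (cis (2 * pi / n) ^ k * of_real t))"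
        by (simp add: G_def sum_subtractf cvs.scale_right_diff_distrib)
      also have "norm \<dots> \<le> 1 / 8"
      proof (rule avg[OF that])
        fix k
        have "dist (cis (2 * pi / n) ^ k * of_real s) (cis (2 * pi / n) ^ k * of_real t) = \<bar>s - t\<bar>"
          by (simp add: dist_norm norm_mult norm_power flip: right_diff_distrib of_real_diff)
        then have "dist (F (cis (2 * pi / n) ^ k * of_real s)) (F (cis (2 * pi / n) ^ k * of_real t)) < 1 / 8"
          using s t by (intro \<delta>'(2)) (auto simp: norm_mult norm_power)
        then show "norm (F (cis (2 * pi / n) ^ k * of_real s) - F (cis (2 * pi / n) ^ k * of_real t)) \<le> 1 / 8"
          by (simp add: dist_norm)
      qed
      finally show ?thesis .
    qed
    have Gt: "norm (G n (of_real t) - 1) \<le> t ^ n * norm (q ^ n) * B" if "n > 0" for n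
    proof -
      have "G n (of_real t) - 1 = (of_real t ^ n *\<^sub>C q ^ n) * G n (of_real t)"
        using G[OF that, of "of_real t"] by (simp add: algebra_simps)
      also have "norm \<dots> \<le> norm (of_real t ^ n *\<^sub>C q ^ n) * norm (G n (of_real t))"
        by (rule norm_mult_ineq)
      also have "\<dots> \<le> norm (of_real t ^ n *\<^sub>C q ^ n) * B"
        unfolding G_def using s t by (intro mult_left_mono avg that B) (auto simp: norm_mult norm_power)
      finally show ?thesis using t by (simp add: norm_scaleC norm_power)
    qed
    have "(\<lambda>n. t ^ n * norm (q ^ n) * B) \<longlonglongrightarrow> 0"
      using t(1) unfolding S_def by (auto intro: tendsto_mult_left_zero)
    then have "\<forall>\<^sub>F n in sequentially. t ^ n * norm (q ^ n) * B < 1 / 8"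
      by (rule order_tendstoD(2)) simp
    then have bd: "\<forall>\<^sub>F n in sequentially. s ^ n * norm (q ^ n) \<le> 3 * norm (1::'a)"
      using eventually_gt_at_top[of 0]
    proof eventually_elim
      case (elim n)
      define h where "h = 1 - of_real s ^ n *\<^sub>C q ^ n"
      define g where "g = G n (of_real s)"
      have "norm (1 - g) \<le> norm (1 - G n (of_real t)) + norm (G n (of_real t) - g)"
        by (metis add_diff_eq diff_add_cancel norm_triangle_ineq)
      then have g: "norm (1 - g) \<le> 1 / 4"
        using near[OF elim(2)] Gt[OF elim(2)] elim(1) unfolding g_def by (simp add: norm_minus_commute)
      \<comment> \<open>\<open>g\<close> is a right inverse of \<open>h\<close> at distance at most
        1/4 from 1; hence \<open>norm h\<close> is bounded by a multiple of \<open>norm 1\<close>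
        that does not depend on \<open>n\<close>.\<close>
      have "h = 1 + h * (1 - g)"
        using G[OF elim(2), of "of_real s"] unfolding h_def g_def by (simp add: algebra_simps)
      then have "norm h \<le> norm (1::'a) + norm (h * (1 - g))"
        by (metis norm_triangle_ineq)
      also have "norm (h * (1 - g)) \<le> norm h * (1 / 4)"
        by (meson g mult_left_mono norm_ge_zero norm_mult_ineq order_trans)
      finally have "norm h \<le> 2 * norm (1::'a)" using norm_ge_zero[of "1::'a"] by linarith
      moreover have "s ^ n * norm (q ^ n) = norm (1 - h)"
        unfolding h_def using s by (simp add: norm_scaleC norm_power)
      ultimately show ?case using norm_triangle_ineq4[of 1 h] by linarith
    qed
    define r where "r = (t + \<delta> / 2) / s"
    have "s > 0" using t \<delta> by (simp add: s_def)
    have r: "0 \<le> r" "r < 1" using t \<delta> \<open>s > 0\<close> by (auto simp: r_def s_def divide_simps)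
    have "(\<lambda>n. r ^ n * (3 * norm (1::'a))) \<longlonglongrightarrow> 0"
      using LIMSEQ_power_zero[of r] r by (auto intro: tendsto_mult_left_zero)
    moreover have "\<forall>\<^sub>F n in sequentially. norm ((t + \<delta> / 2) ^ n * norm (q ^ n)) \<le> r ^ n * (3 * norm (1::'a))"
      using bd
    proof eventually_elim
      case (elim n)
      have "(t + \<delta> / 2) ^ n = r ^ n * s ^ n" using \<open>s > 0\<close> by (simp add: r_def flip: power_mult_distrib)
      then show ?case using elim r s(1) by (simp add: abs_mult mult.assoc mult_left_mono)
    qed
    ultimately show ?thesis unfolding S_def by (rule Lim_null_comparison[rotated])
  qed
  \<comment> \<open>Climbing in steps of \<open>\<delta> / 2\<close>; the minimum keeps the radius
    at most \<open>T\<close>, as a further step demands.\<close>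
  have "S (min T (real m * (\<delta> / 2)))" for m
  proof (induction m)
    case 0 then show ?case using \<open>S 0\<close> \<open>T \<ge> 0\<close> by simp
  next
    case (Suc m)
    let ?t = "min T (real m * (\<delta> / 2))"
    have "S (?t + \<delta> / 2)" using Suc \<open>T \<ge> 0\<close> \<delta> by (intro step) auto
    then show ?case
      by (rule S_mono) (use \<open>T \<ge> 0\<close> \<delta> in \<open>auto simp: algebra_simps min_def\<close>)
  qed
  moreover obtain m where "T < real m * (\<delta> / 2)"
    using reals_Archimedean3[of "\<delta> / 2"] \<delta> by auto
  ultimately have "S T" by (metis min.absorb1 less_imp_le)
  then show ?thesis unfolding S_def .
qed

lemma commute_geometric:
  fixes x :: "'a::complex_banach_algebra_1"
  assumes "summable (\<lambda>n. norm (x ^ n))"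
  shows "(\<Sum>n. x ^ n) * (1 - x) = 1"
proof -
  have s: "summable (\<lambda>n. x ^ n)" using assms by (rule summable_norm_cancel)
  have "(\<Sum>n. x ^ n) = 1 + (\<Sum>n. x ^ n) * x"
    using suminf_split_head[OF s] suminf_mult2[OF s, of x] by (simp add: power_commutes)
  then show ?thesis by (simp add: algebra_simps)
qed

text \<open>Consecutive coefficients have a quotient of modulus \<open>(n + 1/2) / (n + 1)\<close>,
  which is below 1. The bound lets powers of a quasinilpotent element dominate the binomial series
  of the inverse square root.\<close>

lemma abs_gbinomial_neg_half_le_1: "\<bar>(- (1 / 2) :: real) gchoose n\<bar> \<le> 1"
proof (induction n)
  case (Suc n)
  have "real (Suc n) * ((- (1 / 2)) gchoose Suc n) = (- (1 / 2) - real n) * ((- (1 / 2)) gchoose n)"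
    using gbinomial_mult_1[of "- (1 / 2) :: real" n] by (simp add: algebra_simps)
  then have "\<bar>real (Suc n)\<bar> * \<bar>(- (1 / 2)) gchoose Suc n\<bar> = \<bar>- (1 / 2) - real n\<bar> * \<bar>(- (1 / 2)) gchoose n\<bar>"
    by (simp only: flip: abs_mult)
  moreover have "\<bar>- (1 / 2) - real n\<bar> = 1 / 2 + real n" by linarith
  ultimately have "real (Suc n) * \<bar>(- (1 / 2)) gchoose Suc n\<bar> = (1 / 2 + real n) * \<bar>(- (1 / 2)) gchoose n\<bar>"
    by (simp only: abs_of_nat)
  also have "\<dots> \<le> real (Suc n) * 1" using Suc by (intro mult_mono) auto
  finally show ?case by simp
qed simp

lemma quasinilpotent_summable:
  fixes d :: "'a::complex_banach_algebra_1" and a :: "nat \<Rightarrow> real"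
  assumes inv: "\<And>z. alg_invertible (1 - z *\<^sub>C d)" and a: "\<And>n. \<bar>a n\<bar> \<le> 1"
  shows "summable (\<lambda>n. norm (a n *\<^sub>R d ^ n))"
proof -
  have "\<forall>\<^sub>F n in sequentially. 2 ^ n * norm (d ^ n) < 1"
    using quasinilpotent_tendsto[OF inv, of 2] by (intro order_tendstoD(2)) auto
  then have "\<forall>\<^sub>F n in sequentially. norm (norm (a n *\<^sub>R d ^ n)) \<le> (1 / 2) ^ n"
  proof eventually_elim
    case (elim n)
    have "\<bar>a n\<bar> * norm (d ^ n) \<le> 1 * norm (d ^ n)" using a by (intro mult_right_mono) auto
    also have "\<dots> \<le> (1 / 2) ^ n" using elim by (simp add: field_simps)
    finally show ?case by simp
  qed
  then show ?thesis by (rule summable_comparison_test_ev) (simp add: summable_geometric)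
qed

text \<open>The idempotent is \<open>q = (1 + s (1 + D)\<^sup>-\<^sup>1\<^sup>/\<^sup>2) / 2\<close> with \<open>s = 2 c - 1\<close>, for which
  \<open>s\<^sup>2 = 1 + D\<close>; the inverse square root is given by its binomial series.\<close>

lemma idempotent_near_quasi_idempotent:
  fixes c :: "'a::complex_banach_algebra_1"
  defines "e \<equiv> c * c - c"
  assumes inv: "\<And>z. alg_invertible (1 - z *\<^sub>C (e + e + e + e))"
  obtains w w' where "(c * w) * (c * w) = c * w" "1 - c * w = (1 - c) * w'"
    "\<And>x. x * c = c * x \<Longrightarrow> x * w = w * x"
    "\<And>x. x * c = c * x \<Longrightarrow> x * w' = w' * x"
proof -
  define D where "D = e + e + e + e"
  define a where "a n = (- (1 / 2) :: real) gchoose n" for n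
  define S where "S = (\<Sum>n. a n *\<^sub>R D ^ n)"
  \<comment> \<open>\<open>T\<close> is the series of \<open>S\<close> without its constant term and
    divided by \<open>D\<close>. The resulting \<open>S = 1 + D * T\<close> is what allows
    \<open>c\<close> and \<open>1 - c\<close> to be split off below.\<close>
  define T where "T = (\<Sum>n. a (Suc n) *\<^sub>R D ^ n)"
  note inv = inv[folded D_def]
  have sumS: "summable (\<lambda>n. norm (a n *\<^sub>R D ^ n))" and sumT: "summable (\<lambda>n. norm (a (Suc n) *\<^sub>R D ^ n))"
    unfolding a_def by (rule quasinilpotent_summable[OF inv abs_gbinomial_neg_half_le_1])+
  note sumS' = summable_norm_cancel[OF sumS] and sumT' = summable_norm_cancel[OF sumT]
  have ST: "S = 1 + D * T"
    using suminf_split_head[OF sumS'] suminf_mult[OF sumT', of D]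
    by (simp add: S_def T_def a_def diff_eq_eq add.commute)
  have comm_pow: "x * D ^ n = D ^ n * x" if "x * D = D * x" for x n
    using that by (induction n) (auto simp: mult.assoc, metis mult.assoc)
  have comm_T: "x * T = T * x" if "x * D = D * x" for x
    unfolding T_def by (simp add: suminf_mult[OF sumT', symmetric] suminf_mult2[OF sumT'] comm_pow[OF that])
  \<comment> \<open>By Vandermonde's identity the coefficients of the square are the binomials of
    exponent -1, that is \<open>(-1) ^ n\<close>, so \<open>S * S\<close> is the Neumann series of
    \<open>1 + D\<close>.\<close>
  have "S * S = (\<Sum>n. \<Sum>i\<le>n. (a i *\<^sub>R D ^ i) * (a (n - i) *\<^sub>R D ^ (n - i)))"
    unfolding S_def by (rule Cauchy_product[OF sumS sumS])
  also have "(\<lambda>n. \<Sum>i\<le>n. (a i *\<^sub>R D ^ i) * (a (n - i) *\<^sub>R D ^ (n - i))) = (\<lambda>n. (- D) ^ n)"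
  proof
    fix n
    have "(\<Sum>i\<le>n. (a i *\<^sub>R D ^ i) * (a (n - i) *\<^sub>R D ^ (n - i))) = (\<Sum>i\<le>n. (a i * a (n - i)) *\<^sub>R D ^ n)"
      by (intro sum.cong) (auto simp flip: power_add)
    also have "\<dots> = (\<Sum>i\<le>n. a i * a (n - i)) *\<^sub>R D ^ n" by (simp add: scaleR_sum_left)
    also have "(\<Sum>i\<le>n. a i * a (n - i)) = (-1) gchoose n"
      unfolding a_def using gbinomial_Vandermonde[of "- (1 / 2) :: real" "- (1 / 2)" n] by (simp add: atMost_atLeast0)
    also have "\<dots> = (-1) ^ n"
      using gbinomial_minus[of "1::real" n] binomial_gbinomial[of n n, where ?'a = real] by simp
    also have "\<dots> *\<^sub>R D ^ n = (- D) ^ n" by (simp add: power_minus[of D] scaleR_conv_of_real)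
    finally show "(\<Sum>i\<le>n. (a i *\<^sub>R D ^ i) * (a (n - i) *\<^sub>R D ^ (n - i))) = (- D) ^ n" .
  qed
  also have "(\<Sum>n. (- D) ^ n) * (1 - (- D)) = 1"
  proof (rule commute_geometric)
    have "summable (\<lambda>n. norm (1 *\<^sub>R (- D) ^ n))"
    proof (rule quasinilpotent_summable)
      show "alg_invertible (1 - z *\<^sub>C (- D))" for z using inv[of "- z"] by simp
    qed simp
    then show "summable (\<lambda>n. norm ((- D) ^ n))" by simp
  qed
  finally have SS: "S * S * (1 + D) = 1" by simp
  have cD: "x * D = D * x" if "x * c = c * x" for x
  proof -
    have "x * e = e * x" unfolding e_def using that by (simp add: algebra_simps) (metis mult.assoc)
    then show ?thesis unfolding D_def by (simp add: algebra_simps)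
  qed
  have cT: "T * c = c * T" using comm_T[OF cD[of c]] by simp
  then have cT': "T * (c * x) = c * (T * x)" for x by (metis mult.assoc)
  have cS: "S * c = c * S" unfolding ST D_def e_def by (simp add: algebra_simps cT cT')
  then have cS': "S * (c * x) = c * (S * x)" for x by (metis mult.assoc)
  let ?s = "c + c - 1"
  \<comment> \<open>As \<open>D = 4 c (c - 1)\<close>, the element \<open>(1 + ?s * S) / 2\<close>
    equals \<open>c + 2 ?s c (c - 1) T\<close>. Taking out \<open>c\<close> leaves \<open>w\<close>,
    and taking \<open>1 - c\<close> out of the complement leaves \<open>w'\<close>.\<close>
  define w where "w = 1 + (?s * (c - 1) * T + ?s * (c - 1) * T)"
  define w' where "w' = 1 + (?s * c * T + ?s * c * T)"
  let ?q = "c * w"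
  have q2: "?q + ?q = 1 + ?s * S"
    unfolding ST w_def D_def e_def by (simp add: algebra_simps)
  have "?s * S * (?s * S) = S * S * (1 + D)"
    unfolding D_def e_def by (simp add: algebra_simps cS cS')
  then have "(?q + ?q) * (?q + ?q) = (?q + ?q) + (?q + ?q)"
    unfolding q2 SS by (simp add: distrib_left distrib_right)
  moreover have "4 *\<^sub>R x = (x + x) + (x + x)" for x :: 'a
    using scaleR_left_distrib[of 2 2 x] by (simp add: scaleR_2)
  ultimately have "4 *\<^sub>R (?q * ?q) = 4 *\<^sub>R ?q"
    by (simp only: distrib_left distrib_right)
  then have "?q * ?q = ?q" by simp
  moreover have "1 - ?q = (1 - c) * w'"
    unfolding w_def w'_def by (simp add: algebra_simps)
  moreover have "x * w = w * x" "x * w' = w' * x" if "x * c = c * x" for x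
  proof -
    note xT = comm_T[OF cD[OF that]]
    have xc': "x * (c * y) = c * (x * y)" and xT': "x * (T * y) = T * (x * y)" for y
      using that xT by (metis mult.assoc)+
    show "x * w = w * x" "x * w' = w' * x"
      unfolding w_def w'_def by (simp_all add: algebra_simps that xT xc' xT')
  qed
  ultimately show ?thesis using that by blast
qed

text \<open>The Lagrange polynomial \<open>C\<close> is 1 at \<open>l\<close> and 0 at 0 and at the
  remaining spectral values, so \<open>C * C - C\<close> vanishes on the spectrum and
  \<open>c * c - c\<close> is quasinilpotent. The corrected idempotent is a multiple of
  \<open>c\<close>, hence of \<open>b - \<mu>\<close> for every root \<mu> of \<open>C\<close>; the
  value 0 is included to place \<open>q\<close> in the ideal generated by \<open>b\<close>. It is
  nonzero since otherwise \<open>1 - c\<close>, which has the factor \<open>b - l\<close>, would be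
  invertible.\<close>

lemma riesz_idempotent:
  fixes b :: "'a::complex_banach_algebra_1"
  assumes fin: "finite (alg_spectrum b)" and l: "l \<in> nonzero_spectrum b"
  obtains q where "q * q = q" "q \<noteq> 0"
    "\<And>\<mu>. \<mu> \<in> insert 0 (alg_spectrum b) - {l} \<Longrightarrow> \<exists>v. q = (b - \<mu> *\<^sub>C 1) * v \<and> v * b = b * v"
proof -
  define R where "R = insert 0 (alg_spectrum b) - {l}"
  define C where "C = (\<Prod>\<mu>\<in>R. Polynomial.smult (1 / (l - \<mu>)) [:- \<mu>, 1:])"
  have "finite R" using fin by (simp add: R_def)
  have Cl: "poly C l = 1"
    unfolding C_def poly_prod using l
    by (intro prod.neutral) (auto simp: R_def nonzero_spectrum_def simp flip: diff_divide_distrib)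
  have CR: "poly C \<mu> = 0" if "\<mu> \<in> R" for \<mu>
    unfolding C_def poly_prod by (rule prod_zero) (use that \<open>finite R\<close> in auto)
  define c where "c = peval C b"
  define E where "E = C * C - C"
  have inv: "alg_invertible (1 - z *\<^sub>C ((c * c - c) + (c * c - c) + (c * c - c) + (c * c - c)))" for z
  proof -
    define P where "P = 1 - Polynomial.smult z (E + E + E + E)"
    have P1: "poly P \<mu> = 1" if "\<mu> \<in> insert l (alg_spectrum b)" for \<mu>
      using that Cl CR[of \<mu>] by (auto simp: P_def E_def R_def)
    have "P \<noteq> 0" using P1[of l] by auto
    moreover have "\<mu> \<notin> alg_spectrum b" if "poly P \<mu> = 0" for \<mu>
      using that P1[of \<mu>] by auto
    ultimately have "alg_invertible (peval P b)" by (rule alg_invertible_peval)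
    then show ?thesis by (simp only: P_def E_def c_def peval_diff peval_1 peval_smult peval_add peval_mult)
  qed
  obtain w w' where w: "(c * w) * (c * w) = c * w" "1 - c * w = (1 - c) * w'"
    "\<And>x. x * c = c * x \<Longrightarrow> x * w = w * x" "\<And>x. x * c = c * x \<Longrightarrow> x * w' = w' * x"
    using idempotent_near_quasi_idempotent[OF inv] by blast
  have bc: "b * c = c * b" unfolding c_def using peval_comm[of b b C] by simp
  have "c * w \<noteq> 0"
  proof
    assume "c * w = 0"
    then have 1: "(1 - c) * w' = 1" using w(2) by simp
    moreover have "(1 - c) * w' = w' * (1 - c)" using w(4)[of "1 - c"] by (simp add: algebra_simps)
    ultimately have "alg_invertible (1 - c)" by (intro alg_invertibleI) auto
    moreover have "poly (1 - C) l = 0" using Cl by simp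
    then obtain Q where Q: "1 - C = [:- l, 1:] * Q" using poly_eq_0_iff_dvd by (metis dvdE)
    have "1 - c = peval (1 - C) b" by (simp add: c_def)
    then have c1: "1 - c = (b - l *\<^sub>C 1) * peval Q b" by (simp add: Q del: mult_pCons_left)
    moreover have "(b - l *\<^sub>C 1) * peval Q b = peval Q b * (b - l *\<^sub>C 1)"
      using peval_comm[of b b Q] by (simp add: algebra_simps)
    ultimately have "alg_invertible (b - l *\<^sub>C 1)" using alg_invertible_factor_comm by metis
    then have "alg_invertible (l *\<^sub>C 1 - b)" using alg_invertible_uminus[of "b - l *\<^sub>C 1"] by simp
    then show False using l by (simp add: nonzero_spectrum_def alg_spectrum_def)
  qed
  moreover have "\<exists>v. c * w = (b - \<mu> *\<^sub>C 1) * v \<and> v * b = b * v"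
    if "\<mu> \<in> insert 0 (alg_spectrum b) - {l}" for \<mu>
  proof -
    have "[:- \<mu>, 1:] dvd C" using CR[of \<mu>] that by (simp add: R_def poly_eq_0_iff_dvd)
    then obtain Q where Q: "C = [:- \<mu>, 1:] * Q" by (rule dvdE)
    have "c * w = (b - \<mu> *\<^sub>C 1) * (peval Q b * w)"
      unfolding c_def Q by (simp add: mult.assoc del: mult_pCons_left)
    moreover have "(peval Q b * w) * b = b * (peval Q b * w)"
      using peval_comm[of b b Q] w(3)[OF bc] by (metis mult.assoc)
    ultimately show ?thesis by blast
  qed
  ultimately show ?thesis using that w(1) by blast
qed

section \<open>Rank and minimal idempotents\<close>

text \<open>In a semisimple Banach algebra this is equivalent to minimality of the left ideal
  \<open>A p\<close>, in the form given by the Gelfand-Mazur theorem: the corner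
  \<open>p A p\<close> is one-dimensional.\<close>

definition minimal_idempotent :: "'a::complex_banach_algebra_1 \<Rightarrow> bool" where
  "minimal_idempotent p \<longleftrightarrow> p \<noteq> 0 \<and> p * p = p \<and> (\<forall>x. \<exists>c. p * x * p = c *\<^sub>C p)"

lemma ecard_le_alg_rank: "ecard (nonzero_spectrum (x * a)) \<le> alg_rank a"
  unfolding alg_rank_def by (rule SUP_upper) simp

lemma alg_rank_mult_left: "alg_rank (x * a) \<le> alg_rank a"
proof -
  have "ecard (nonzero_spectrum (y * (x * a))) \<le> alg_rank a" for y
    using ecard_le_alg_rank[of "y * x" a] by (simp add: mult.assoc)
  then show ?thesis unfolding alg_rank_def[of "x * a"] by (intro SUP_least)
qed

text \<open>A factor on the right can be rotated to the left, because nonzero spectra are invariant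
  under cyclic permutation.\<close>

lemma alg_rank_mult_right: "alg_rank (a * x) \<le> alg_rank a"
proof -
  have "ecard (nonzero_spectrum (y * (a * x))) \<le> alg_rank a" for y
    using ecard_le_alg_rank[of "x * y" a] nonzero_spectrum_commute[of "y * a" x] by (simp add: mult.assoc)
  then show ?thesis unfolding alg_rank_def[of "a * x"] by (intro SUP_least)
qed

lemma soc_mult_left: "a \<in> soc \<Longrightarrow> x * a \<in> soc"
  and soc_mult_right: "a \<in> soc \<Longrightarrow> a * x \<in> soc"
  using alg_rank_mult_left[of x a] alg_rank_mult_right[of a x]
  by (auto simp: soc_def dest: enat_ile)

lemma ecard_mono: "A \<subseteq> B \<Longrightarrow> ecard A \<le> ecard B"
  by (auto simp: ecard_def card_mono finite_subset)

lemma finite_nonzero_spectrum_soc: "a \<in> soc \<Longrightarrow> finite (nonzero_spectrum a)"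
  using ecard_le_alg_rank[of 1 a] by (auto simp: soc_def ecard_def split: if_splits)

lemma finite_alg_spectrum_soc: "a \<in> soc \<Longrightarrow> finite (alg_spectrum a)"
  using finite_nonzero_spectrum_soc[of a] by (simp add: nonzero_spectrum_def)

text \<open>A finite supremum of extended naturals is attained.\<close>

lemma rank_attaining_nonempty:
  assumes "a \<in> soc"
  obtains x where "x \<in> rank_attaining a"
proof -
  let ?A = "range (\<lambda>x. ecard (nonzero_spectrum (x * a)))"
  have "Sup ?A \<noteq> \<infinity>" using assms by (simp add: soc_def alg_rank_def)
  then have "finite ?A" by (auto simp: Sup_enat_def split: if_splits)
  then have "Sup ?A \<in> ?A" using Max_in[of ?A] by (simp add: Sup_enat_def)
  then show ?thesis using that by (auto simp: alg_rank_def rank_attaining_def)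
qed

lemma ex_nonzero_spectrum:
  fixes a :: "'a::complex_banach_algebra_1"
  assumes "semisimple_algebra TYPE('a)" "a \<noteq> 0"
  obtains x \<mu> where "\<mu> \<in> nonzero_spectrum (x * a)"
proof -
  obtain x where "\<not> alg_invertible (1 - x * a)" using semisimple_eq_0I[OF assms(1)] assms(2) by blast
  then have "1 \<in> nonzero_spectrum (x * a)" by (simp add: nonzero_spectrum_iff)
  then show ?thesis using that by blast
qed

text \<open>By orthogonality \<open>1 - s *\<^sub>C (u + v)\<close> is a product of the commuting
  factors \<open>1 - s *\<^sub>C u\<close> and \<open>1 - s *\<^sub>C v\<close>, and commuting
  factors of an invertible element are invertible.\<close>

lemma nonzero_spectrum_add_orthogonal:
  fixes u v :: "'a::complex_banach_algebra_1"
  assumes "u * v = 0" "v * u = 0"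
  shows "nonzero_spectrum u \<subseteq> nonzero_spectrum (u + v)"
proof
  fix \<mu> assume \<mu>: "\<mu> \<in> nonzero_spectrum u"
  let ?s = "inverse \<mu>"
  have "(1 - ?s *\<^sub>C u) * (1 - ?s *\<^sub>C v) = 1 - ?s *\<^sub>C (u + v)"
    "(1 - ?s *\<^sub>C v) * (1 - ?s *\<^sub>C u) = 1 - ?s *\<^sub>C (u + v)"
    using assms by (simp_all add: algebra_simps cvs.scale_right_distrib)
  then show "\<mu> \<in> nonzero_spectrum (u + v)"
    using \<mu> alg_invertible_factor_comm unfolding nonzero_spectrum_iff by metis
qed

section \<open>Spectrum in a corner algebra\<close>

definition corner_inv :: "'a::ring_1 \<Rightarrow> 'a \<Rightarrow> bool" where
  "corner_inv p y \<longleftrightarrow> (\<exists>v. p * v = v \<and> v * p = v \<and> y * v = p \<and> v * y = p)"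

text \<open>An inverse \<open>w\<close> of \<open>1 - u\<close> compresses to
  \<open>p * w * p\<close>; an inverse \<open>v\<close> in the corner extends to
  \<open>v + (1 - p)\<close>.\<close>

lemma corner_inv_iff:
  fixes p u :: "'a::ring_1"
  assumes p: "p * p = p" and u: "p * u = u" "u * p = u"
  shows "alg_invertible (1 - u) \<longleftrightarrow> corner_inv p (p - u)"
proof
  assume "alg_invertible (1 - u)"
  then obtain w where w: "(1 - u) * w = 1" "w * (1 - u) = 1" unfolding alg_invertible_def by blast
  have "(p - u) * (p * w * p) = p * ((1 - u) * w) * p"
    using p u by (simp add: algebra_simps flip: mult.assoc)
  moreover have "(p * w * p) * (p - u) = p * (w * (1 - u)) * p"
    using p u by (simp add: algebra_simps)
  ultimately show "corner_inv p (p - u)" unfolding corner_inv_def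
    using w p by (intro exI[of _ "p * w * p"]) (simp add: mult.assoc, simp add: p flip: mult.assoc)
next
  assume "corner_inv p (p - u)"
  then obtain v where v: "p * v = v" "v * p = v" "(p - u) * v = p" "v * (p - u) = p"
    unfolding corner_inv_def by blast
  have "(1 - u) * (v + (1 - p)) = 1" "(v + (1 - p)) * (1 - u) = 1"
    using v p u by (simp_all add: algebra_simps)
  then show "alg_invertible (1 - u)" by (rule alg_invertibleI)
qed

lemma corner_inv_scaleC:
  fixes p y :: "'a::complex_banach_algebra_1"
  assumes "corner_inv p y" "c \<noteq> 0"
  shows "corner_inv p (c *\<^sub>C y)"
proof -
  obtain v where "p * v = v" "v * p = v" "y * v = p" "v * y = p"
    using assms unfolding corner_inv_def by blast
  then show ?thesis unfolding corner_inv_def using assms(2)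
    by (intro exI[of _ "inverse c *\<^sub>C v"]) simp
qed

lemma nonzero_spectrum_corner_iff:
  fixes p u :: "'a::complex_banach_algebra_1"
  assumes p: "p * p = p" and u: "p * u = u" "u * p = u" and "\<mu> \<noteq> 0"
  shows "\<mu> \<in> nonzero_spectrum u \<longleftrightarrow> \<not> corner_inv p (u - \<mu> *\<^sub>C p)"
proof -
  have "corner_inv p (p - inverse \<mu> *\<^sub>C u) \<longleftrightarrow> corner_inv p (u - \<mu> *\<^sub>C p)"
    using corner_inv_scaleC[of p "p - inverse \<mu> *\<^sub>C u" "- \<mu>"]
      corner_inv_scaleC[of p "u - \<mu> *\<^sub>C p" "- inverse \<mu>"] \<open>\<mu> \<noteq> 0\<close>
    by (auto simp: cvs.scale_right_diff_distrib)
  then show ?thesis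
    using corner_inv_iff[of p "inverse \<mu> *\<^sub>C u"] p u \<open>\<mu> \<noteq> 0\<close> by (simp add: nonzero_spectrum_iff)
qed

text \<open>Only positive exponents occur, since \<open>norm 1\<close> may exceed 1.\<close>

lemma norm_power_Suc_le: "norm (x ^ Suc n) \<le> norm x ^ Suc n" for x :: "'a::{real_normed_algebra,monoid_mult}"
proof (induction n)
  case (Suc n)
  then show ?case using norm_mult_ineq[of x "x ^ Suc n"] mult_left_mono[OF Suc norm_ge_zero[of x]]
    by simp
qed simp

text \<open>If every \<open>y - \<mu> *\<^sub>C p\<close> were invertible in the corner, the inverse
  \<open>z\<close> of \<open>y\<close> would be quasinilpotent, because
  \<open>p - l *\<^sub>C z = z * (y - l *\<^sub>C p)\<close>. But the n-th powers of
  \<open>y\<close> and \<open>z\<close> multiply to \<open>p\<close>, so \<open>norm p\<close> would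
  be at most \<open>norm y ^ n * norm (z ^ n)\<close>, which tends to 0.\<close>

lemma corner_spectrum_nonempty:
  fixes p y :: "'a::complex_banach_algebra_1"
  assumes p: "p * p = p" "p \<noteq> 0" and y: "p * y = y" "y * p = y"
  obtains \<mu> where "\<not> corner_inv p (y - \<mu> *\<^sub>C p)"
proof (rule ccontr)
  assume "\<not> thesis"
  then have inv: "corner_inv p (y - \<mu> *\<^sub>C p)" for \<mu> using that by blast
  obtain z where z: "p * z = z" "z * p = z" "y * z = p" "z * y = p"
    using inv[of 0] unfolding corner_inv_def by auto
  have "alg_invertible (1 - l *\<^sub>C z)" for l
  proof -
    obtain v where v: "p * v = v" "v * p = v" "(y - l *\<^sub>C p) * v = p" "v * (y - l *\<^sub>C p) = p"
      using inv[of l] unfolding corner_inv_def by auto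
    have 1: "p - l *\<^sub>C z = z * (y - l *\<^sub>C p)" "p - l *\<^sub>C z = (y - l *\<^sub>C p) * z"
      using z by (simp_all add: algebra_simps)
    have "(p - l *\<^sub>C z) * (v * y) = z * ((y - l *\<^sub>C p) * v) * y" unfolding 1(1) by (simp add: mult.assoc)
    moreover have "(y * v) * (p - l *\<^sub>C z) = y * (v * (y - l *\<^sub>C p)) * z" unfolding 1(2) by (simp add: mult.assoc)
    ultimately have a: "(p - l *\<^sub>C z) * (v * y) = p" "(y * v) * (p - l *\<^sub>C z) = p"
      using v z y by simp_all
    have "v * y = y * v" using v y by (simp add: algebra_simps)
    then have "corner_inv p (p - l *\<^sub>C z)" unfolding corner_inv_def
      using a v y by (intro exI[of _ "v * y"]) (metis mult.assoc)
    then show ?thesis using corner_inv_iff[of p "l *\<^sub>C z"] p z by simp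
  qed
  from LIMSEQ_Suc[OF quasinilpotent_tendsto[OF this norm_ge_zero[of y]]]
  have lim: "(\<lambda>n. norm y ^ Suc n * norm (z ^ Suc n)) \<longlonglongrightarrow> 0" .
  have yz: "y ^ Suc n * z ^ Suc n = p" for n
  proof (induction n)
    case (Suc n)
    have "y ^ Suc (Suc n) * z ^ Suc (Suc n) = y * (y ^ Suc n * z ^ Suc n) * z"
      by (metis mult.assoc power_Suc power_Suc2)
    then show ?case using Suc z y by simp
  qed (use z in simp)
  have "norm p \<le> norm y ^ Suc n * norm (z ^ Suc n)" for n
    using norm_mult_ineq[of "y ^ Suc n" "z ^ Suc n"] mult_right_mono[OF norm_power_Suc_le[of y n] norm_ge_zero[of "z ^ Suc n"]]
    unfolding yz by linarith
  then have "norm p \<le> 0" by (intro LIMSEQ_le_const[OF lim]) auto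
  then show False using p by simp
qed

text \<open>Every element of the corner has at most one spectral value there. Subtracting it from
  \<open>p * x * p\<close> leaves a singular \<open>n\<close>, and then \<open>1 - z * n\<close> is
  invertible for every \<open>z\<close> in the corner: otherwise \<open>z * n\<close> and
  \<open>n * z\<close> would both be invertible in the corner and so would \<open>n\<close>. Hence
  \<open>n\<close> lies in the radical.\<close>

lemma minimal_idempotentI:
  fixes p :: "'a::complex_banach_algebra_1"
  assumes ss: "semisimple_algebra TYPE('a)" and p: "p * p = p" "p \<noteq> 0"
    and one: "\<And>x \<mu> \<nu>. \<mu> \<in> nonzero_spectrum (x * p) \<Longrightarrow> \<nu> \<in> nonzero_spectrum (x * p) \<Longrightarrow> \<mu> = \<nu>"
  shows "minimal_idempotent p"
  unfolding minimal_idempotent_def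
proof (intro conjI allI p)
  fix x
  have pp: "p * (p * z) = p * z" for z using p by (metis mult.assoc)
  have dich: "corner_inv p (w - \<alpha> *\<^sub>C p) \<or> corner_inv p (w - \<beta> *\<^sub>C p)"
    if w: "p * w = w" "w * p = w" and "\<alpha> \<noteq> \<beta>" for w \<alpha> \<beta>
  proof -
    \<comment> \<open>The hypothesis concerns nonzero spectral values only; adding
      \<open>t *\<^sub>C p\<close> moves both candidates away from 0.\<close>
    obtain t :: complex where "t \<notin> {- \<alpha>, - \<beta>}"
      using ex_new_if_finite[OF infinite_UNIV_char_0, of "{- \<alpha>, - \<beta>}"] by blast
    then have t: "\<alpha> + t \<noteq> 0" "\<beta> + t \<noteq> 0" by (auto simp: eq_neg_iff_add_eq_0 add.commute)
    define W where "W = w + t *\<^sub>C p"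
    have W: "p * W = W" "W * p = W" using w p by (simp_all add: W_def algebra_simps)
    have "W - (\<gamma> + t) *\<^sub>C p = w - \<gamma> *\<^sub>C p" for \<gamma>
      by (simp add: W_def cvs.scale_left_distrib)
    moreover have "\<not> (\<alpha> + t \<in> nonzero_spectrum W \<and> \<beta> + t \<in> nonzero_spectrum W)"
      using one[of "\<alpha> + t" W "\<beta> + t"] \<open>\<alpha> \<noteq> \<beta>\<close> W by auto
    ultimately show ?thesis
      using nonzero_spectrum_corner_iff[OF p(1) W t(1)] nonzero_spectrum_corner_iff[OF p(1) W t(2)] by auto
  qed
  define y where "y = p * x * p"
  have y: "p * y = y" "y * p = y" using p pp by (simp_all add: y_def mult.assoc)
  obtain \<mu> where \<mu>: "\<not> corner_inv p (y - \<mu> *\<^sub>C p)" using corner_spectrum_nonempty[OF p y] by blast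
  define n where "n = y - \<mu> *\<^sub>C p"
  have n: "p * n = n" "n * p = n" using p y by (simp_all add: n_def algebra_simps)
  have swap: "alg_invertible (1 - z) \<or> corner_inv p z" if "p * z = z" "z * p = z" for z
  proof -
    have "corner_inv p (z - 1 *\<^sub>C p) \<or> corner_inv p (z - 0 *\<^sub>C p)" by (rule dich[OF that]) simp
    then show ?thesis
      using corner_inv_iff[OF p(1) that] corner_inv_scaleC[of p "z - p" "-1"] by auto
  qed
  have inv: "alg_invertible (1 - z * n)" if z: "p * z = z" "z * p = z" for z
  proof (rule ccontr)
    assume a: "\<not> alg_invertible (1 - z * n)"
    then have b: "\<not> alg_invertible (1 - n * z)" using alg_invertible_one_minus_commute by blast
    have "p * (z * n) = z * n" "(z * n) * p = z * n" "p * (n * z) = n * z" "(n * z) * p = n * z"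
      using z n by (metis mult.assoc)+
    then have "corner_inv p (z * n)" "corner_inv p (n * z)" using swap a b by blast+
    then obtain v w where v: "p * v = v" "v * p = v" "v * (z * n) = p"
      and w: "p * w = w" "w * p = w" "n * z * w = p"
      unfolding corner_inv_def by blast
    have "v * z = z * w"
    proof -
      have "v * z * (n * z * w) = v * (z * n) * z * w" by (simp add: mult.assoc)
      then have "v * z * p = p * z * w" using v w by simp
      then show ?thesis using z by (simp add: mult.assoc)
    qed
    then have "corner_inv p n" unfolding corner_inv_def
      using v w z by (intro exI[of _ "v * z"]) (metis mult.assoc)
    then show False using \<mu> unfolding n_def by blast
  qed
  have "n = 0"
  proof (rule semisimple_eq_0I[OF ss])
    fix x
    have "alg_invertible (1 - (p * x * p) * n)" by (rule inv) (simp_all add: pp p mult.assoc)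
    moreover have "(p * x * p) * n = p * (x * n)" using n by (simp add: mult.assoc)
    ultimately have "alg_invertible (1 - (x * n) * p)" using alg_invertible_one_minus_commute[of p "x * n"] by simp
    then show "alg_invertible (1 - x * n)" using n by (simp add: mult.assoc)
  qed
  then show "\<exists>c. p * x * p = c *\<^sub>C p" unfolding n_def y_def by auto
qed

lemma minimal_idempotent_soc:
  assumes "minimal_idempotent p"
  shows "p \<in> soc"
proof -
  have "ecard (nonzero_spectrum (x * p)) \<le> enat 1" for x
  proof -
    have pp: "p * p = p" using assms by (simp add: minimal_idempotent_def)
    obtain c where c: "p * x * p = c *\<^sub>C p" using assms by (auto simp: minimal_idempotent_def)
    have "nonzero_spectrum (x * p) = nonzero_spectrum (c *\<^sub>C p)"
      using nonzero_spectrum_commute[of "x * p" p] c pp by (simp add: mult.assoc)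
    also have "\<dots> \<subseteq> {c}"
    proof
      fix \<mu> assume \<mu>: "\<mu> \<in> nonzero_spectrum (c *\<^sub>C p)"
      show "\<mu> \<in> {c}"
      proof (rule ccontr)
        assume "\<mu> \<notin> {c}"
        define s where "s = inverse \<mu> * c"
        have "s \<noteq> 1" using \<mu> \<open>\<mu> \<notin> {c}\<close> by (auto simp: s_def nonzero_spectrum_iff field_simps)
        \<comment> \<open>The solution of \<open>k = s + s * k\<close>, for which
          \<open>1 + k *\<^sub>C p\<close> inverts \<open>1 - s *\<^sub>C p\<close>.\<close>
        define k where "k = s / (1 - s)"
        have k: "k = s + s * k" using \<open>s \<noteq> 1\<close> by (simp add: k_def field_simps)
        have "(1 - s *\<^sub>C p) * (1 + k *\<^sub>C p) = 1 + (k - (s + s * k)) *\<^sub>C p"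
          "(1 + k *\<^sub>C p) * (1 - s *\<^sub>C p) = 1 + (k - (s + s * k)) *\<^sub>C p"
          by (simp_all add: algebra_simps pp cvs.scale_left_distrib cvs.scale_left_diff_distrib)
        then have "alg_invertible (1 - s *\<^sub>C p)" using k by (intro alg_invertibleI) auto
        then show False using \<mu> by (simp add: nonzero_spectrum_iff s_def)
      qed
    qed
    finally have "ecard (nonzero_spectrum (x * p)) \<le> ecard {c}" by (rule ecard_mono)
    then show ?thesis by (simp add: ecard_def)
  qed
  then have "alg_rank p \<le> enat 1" unfolding alg_rank_def by (intro SUP_least)
  then show ?thesis by (auto simp: soc_def dest: enat_ile)
qed

text \<open>An idempotent \<open>p\<close> of minimal rank among the nonzero elements of the ideal generated by \<open>d\<close>
  has rank one: if some \<open>p * x * p\<close> had two nonzero spectral values, a Riesz idempotent would split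
  \<open>p\<close> into two orthogonal parts, one of them of the same rank as \<open>p\<close>.\<close>

lemma ex_minimal_idempotent:
  fixes d :: "'a::complex_banach_algebra_1"
  assumes ss: "semisimple_algebra TYPE('a)" and d: "d \<in> soc" "d \<noteq> 0"
  obtains x y where "minimal_idempotent (x * d * y)"
proof -
  define P where "P r \<longleftrightarrow> (\<exists>x y. x * d * y \<noteq> 0 \<and> alg_rank (x * d * y) = r)" for r
  have "P (alg_rank d)" unfolding P_def using d by (intro exI[of _ 1]) simp
  then obtain r where r: "P r" and rmin: "\<And>s. s < r \<Longrightarrow> \<not> P s"
    using exists_least_iff[of P] by blast
  obtain x y where xy: "x * d * y \<noteq> 0" "alg_rank (x * d * y) = r" using r unfolding P_def by blast
  define a where "a = x * d * y"
  have a: "a \<noteq> 0" "alg_rank a = r" "a \<in> soc"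
    using xy d by (simp_all add: a_def soc_mult_left soc_mult_right)
  have rank_ideal: "alg_rank z = r" if "z = s * a * t" "z \<noteq> 0" for z s t
  proof (rule antisym)
    show "alg_rank z \<le> r"
      using that alg_rank_mult_right[of "s * a" t] alg_rank_mult_left[of s a] a by simp
    have "P (alg_rank z)" unfolding P_def a_def
      by (rule exI[of _ "s * x"], rule exI[of _ "y * t"]) (use that in \<open>auto simp: a_def mult.assoc\<close>)
    then show "r \<le> alg_rank z" using rmin by (meson not_le)
  qed
  obtain x0 l where l: "l \<in> nonzero_spectrum (x0 * a)" using ex_nonzero_spectrum[OF ss a(1)] by blast
  have b: "finite (alg_spectrum (x0 * a))" by (intro finite_alg_spectrum_soc soc_mult_left a)
  obtain p where p: "p * p = p" "p \<noteq> 0"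
    "\<And>\<mu>. \<mu> \<in> insert 0 (alg_spectrum (x0 * a)) - {l} \<Longrightarrow>
      \<exists>v. p = (x0 * a - \<mu> *\<^sub>C 1) * v \<and> v * (x0 * a) = (x0 * a) * v"
    using riesz_idempotent[OF b l] by blast
  \<comment> \<open>The factor belonging to 0 exhibits \<open>p\<close> as an element of the ideal
    generated by \<open>a\<close>, so \<open>p\<close> has the minimal rank
    \<open>r\<close>.\<close>
  have "0 \<in> insert 0 (alg_spectrum (x0 * a)) - {l}" using l by (simp add: nonzero_spectrum_def)
  from p(3)[OF this] obtain v0 where pv: "p = x0 * a * v0" by auto
  have pr: "alg_rank p = r" using rank_ideal[OF pv p(2)] .
  have psoc: "p \<in> soc" using pv a by (simp add: soc_mult_left soc_mult_right)
  have pp: "p * (p * z) = p * z" for z using p by (metis mult.assoc)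
  have "minimal_idempotent p"
  proof (rule minimal_idempotentI[OF ss p(1,2)], rule ccontr)
    fix x \<mu> \<nu>
    assume \<mu>: "\<mu> \<in> nonzero_spectrum (x * p)" and \<nu>: "\<nu> \<in> nonzero_spectrum (x * p)" and ne: "\<mu> \<noteq> \<nu>"
    define b where "b = p * x * p"
    have bs: "nonzero_spectrum b = nonzero_spectrum (x * p)"
      using nonzero_spectrum_commute[of "x * p" p] p by (simp add: b_def mult.assoc)
    have pb: "p * b = b" "b * p = b" using pp p by (simp_all add: b_def mult.assoc)
    have "finite (alg_spectrum b)" unfolding b_def
      by (intro finite_alg_spectrum_soc soc_mult_left psoc)
    moreover have "\<mu> \<in> nonzero_spectrum b" using \<mu> bs by simp
    ultimately obtain q where q: "q * q = q" "q \<noteq> 0"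
      "\<And>\<mu>'. \<mu>' \<in> insert 0 (alg_spectrum b) - {\<mu>} \<Longrightarrow> \<exists>v. q = (b - \<mu>' *\<^sub>C 1) * v \<and> v * b = b * v"
      using riesz_idempotent by blast
    have \<mu>0: "\<mu> \<noteq> 0" and \<nu>0: "\<nu> \<noteq> 0" using \<mu> \<nu> by (simp_all add: nonzero_spectrum_def)
    obtain v where v: "q = b * v" "v * b = b * v" using q(3)[of 0] \<mu>0 by auto
    have pq: "p * q = q" "q * p = q" using v pb by (metis mult.assoc)+
    have qr: "alg_rank q = r"
    proof (rule rank_ideal[OF _ q(2)])
      have "q = p * x * (x0 * a * v0) * v" using v(1) pv by (simp add: b_def)
      then show "q = (p * x * x0) * a * (v0 * v)" by (simp add: mult.assoc)
    qed
    \<comment> \<open>If \<open>q\<close> were \<open>p\<close>, its factorization at the second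
      spectral value \<nu> would make \<open>b - \<nu> *\<^sub>C p\<close> invertible in the
      corner.\<close>
    have "q \<noteq> p"
    proof
      assume "q = p"
      have "\<nu> \<in> alg_spectrum b" using \<nu> bs unfolding nonzero_spectrum_def by blast
      then obtain w where w: "p = (b - \<nu> *\<^sub>C 1) * w" "w * b = b * w" using q(3)[of \<nu>] ne \<open>q = p\<close> by auto
      have w': "p = w * (b - \<nu> *\<^sub>C 1)" using w by (simp add: algebra_simps)
      have "(b - \<nu> *\<^sub>C p) * (p * w * p) = p * ((b - \<nu> *\<^sub>C 1) * w) * p"
        using pb p pp by (simp add: algebra_simps) (simp add: pb flip: mult.assoc)
      moreover have "(p * w * p) * (b - \<nu> *\<^sub>C p) = p * (w * (b - \<nu> *\<^sub>C 1)) * p"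
        using pb p pp by (simp add: algebra_simps)
      ultimately have "corner_inv p (b - \<nu> *\<^sub>C p)"
        unfolding w(1)[symmetric] w'[symmetric] p(1) corner_inv_def
        by (intro exI[of _ "p * w * p"]) (simp add: mult.assoc p(1) pp)
      then show False
        using nonzero_spectrum_corner_iff[OF p(1) pb \<nu>0] \<nu> bs by simp
    qed
    define q' where "q' = p - q"
    have q': "q' \<noteq> 0" "q' * q' = q'" "q * q' = 0" "q' * q = 0" "q' * p = q'"
      using \<open>q \<noteq> p\<close> q pq p by (simp_all add: q'_def algebra_simps)
    have "q \<in> soc" unfolding v(1) b_def by (intro soc_mult_left soc_mult_right psoc)
    then obtain x1 where x1: "x1 \<in> rank_attaining q" by (rule rank_attaining_nonempty)
    obtain y1 \<kappa> where \<kappa>: "\<kappa> \<in> nonzero_spectrum (y1 * q')" using ex_nonzero_spectrum[OF ss q'(1)] by blast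
    define u where "u = q * x1 * q"
    define w where "w = q' * y1 * q'"
    have u: "ecard (nonzero_spectrum u) = r"
      using x1 qr nonzero_spectrum_commute[of "x1 * q" q] q(1) by (simp add: u_def mult.assoc rank_attaining_def)
    have w: "\<kappa> \<in> nonzero_spectrum w"
      using \<kappa> nonzero_spectrum_commute[of "y1 * q'" q'] q'(2) by (simp add: w_def mult.assoc)
    have \<kappa>0: "\<kappa> \<noteq> 0" using \<kappa> by (simp add: nonzero_spectrum_def)
    have finu: "finite (nonzero_spectrum u)" unfolding u_def
      by (intro finite_nonzero_spectrum_soc soc_mult_left \<open>q \<in> soc\<close>)
    \<comment> \<open>Within \<open>q\<close> the element \<open>u\<close> already has
      \<open>r\<close> nonzero spectral values. The scalar \<open>t\<close> turns the value \<kappa>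
      of \<open>w\<close>, which lives in the complementary part, into a new one. The sum then has
      more than \<open>r\<close> of them, although it is a left multiple of
      \<open>p\<close>.\<close>
    obtain t where "t \<notin> insert 0 ((\<lambda>\<tau>. \<tau> / \<kappa>) ` nonzero_spectrum u)"
      using ex_new_if_finite[OF infinite_UNIV_char_0, of "insert 0 ((\<lambda>\<tau>. \<tau> / \<kappa>) ` nonzero_spectrum u)"] finu by blast
    then have t: "t \<noteq> 0" "t * \<kappa> \<notin> nonzero_spectrum u" using \<kappa>0 by (auto simp: image_iff)
    have tw: "t * \<kappa> \<in> nonzero_spectrum (t *\<^sub>C w)" using nonzero_spectrum_scaleC[OF t(1)] w by blast
    have "q * (q' * z) = 0" "q' * (q * z) = 0" for z using q' by (metis mult.assoc mult_zero_left)+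
    then have orth: "u * (t *\<^sub>C w) = 0" "(t *\<^sub>C w) * u = 0"
      by (simp_all add: u_def w_def mult.assoc)
    have "insert (t * \<kappa>) (nonzero_spectrum u) \<subseteq> nonzero_spectrum (u + t *\<^sub>C w)"
      using nonzero_spectrum_add_orthogonal[OF orth] nonzero_spectrum_add_orthogonal[OF orth(2,1)] tw
      by (auto simp: add.commute)
    then have "ecard (insert (t * \<kappa>) (nonzero_spectrum u)) \<le> ecard (nonzero_spectrum ((u + t *\<^sub>C w) * p))"
      using q'(5) pq by (simp add: u_def w_def distrib_right mult.assoc ecard_mono)
    also have "\<dots> \<le> r" using ecard_le_alg_rank pr by metis
    finally show False using u finu t(2) by (auto simp: ecard_def)
  qed
  moreover have "p = (x0 * x) * d * (y * v0)" using pv by (simp add: a_def mult.assoc)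
  ultimately show ?thesis using that by metis
qed

section \<open>The trace of the action on a minimal left ideal\<close>

definition corner_coeff :: "'a::complex_banach_algebra_1 \<Rightarrow> 'a \<Rightarrow> complex" where
  "corner_coeff p x = (SOME c. p * x * p = c *\<^sub>C p)"

definition left_mod :: "'a::complex_banach_algebra_1 \<Rightarrow> 'a set" where
  "left_mod p = {v. v * p = v}"

definition left_basis :: "'a::complex_banach_algebra_1 \<Rightarrow> 'a set" where
  "left_basis p = (SOME B. B \<subseteq> left_mod p \<and> cvs.independent B \<and> left_mod p \<subseteq> cvs.span B)"

abbreviation coord :: "'a::complex_banach_algebra_1 \<Rightarrow> 'a \<Rightarrow> 'a \<Rightarrow> complex" where
  "coord p \<equiv> cvs.representation (left_basis p)"

text \<open>The trace of left multiplication by \<open>a\<close> on \<open>A p\<close>; the sum is finite if that operator has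
  finite rank.\<close>

definition op_trace :: "'a::complex_banach_algebra_1 \<Rightarrow> 'a \<Rightarrow> complex" where
  "op_trace p a = (\<Sum>b | b \<in> left_basis p \<and> coord p (a * b) b \<noteq> 0. coord p (a * b) b)"

text \<open>\<open>F\<close> may be larger than necessary. Two operators can thus share one set,
  over which both traces are ordinary finite sums.\<close>

definition op_support :: "'a::complex_banach_algebra_1 \<Rightarrow> 'a \<Rightarrow> 'a set \<Rightarrow> bool" where
  "op_support p a F \<longleftrightarrow> finite F \<and> F \<subseteq> left_basis p \<and>
     (\<forall>u\<in>left_mod p. \<forall>b. b \<notin> F \<longrightarrow> coord p (a * u) b = 0)"

lemma left_basis:
  "left_basis p \<subseteq> left_mod p" "cvs.independent (left_basis p)" "left_mod p \<subseteq> cvs.span (left_basis p)"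
proof -
  obtain B where "B \<subseteq> left_mod p \<and> cvs.independent B \<and> left_mod p \<subseteq> cvs.span B"
    using cvs.maximal_independent_subset by metis
  then have "left_basis p \<subseteq> left_mod p \<and> cvs.independent (left_basis p) \<and> left_mod p \<subseteq> cvs.span (left_basis p)"
    unfolding left_basis_def by (rule someI)
  then show "left_basis p \<subseteq> left_mod p" "cvs.independent (left_basis p)" "left_mod p \<subseteq> cvs.span (left_basis p)"
    by blast+
qed

lemma left_mod_absorb: "u \<in> left_mod p \<Longrightarrow> u * x = u * (p * x)"
  by (simp add: left_mod_def flip: mult.assoc)

lemma left_mod_mult: "u \<in> left_mod p \<Longrightarrow> a * u \<in> left_mod p"
  by (simp add: left_mod_def mult.assoc)

lemma left_mod_subspace: "cvs.subspace (left_mod p)"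
  by (rule cvs.subspaceI) (auto simp: left_mod_def distrib_right)

lemma left_mod_span: "u \<in> left_mod p \<Longrightarrow> u \<in> cvs.span (left_basis p)"
  using left_basis(3) by blast

lemma coord_add:
  "u \<in> left_mod p \<Longrightarrow> v \<in> left_mod p \<Longrightarrow> coord p (u + v) b = coord p u b + coord p v b"
  by (simp add: cvs.representation_add[OF left_basis(2)] left_mod_span)

lemma coord_scale: "u \<in> left_mod p \<Longrightarrow> coord p (c *\<^sub>C u) b = c * coord p u b"
  by (simp add: cvs.representation_scale[OF left_basis(2)] left_mod_span)

lemma coord_sum:
  assumes "\<And>i. i \<in> I \<Longrightarrow> f i \<in> left_mod p"
  shows "coord p (sum f I) b = (\<Sum>i\<in>I. coord p (f i) b)"
proof -
  have "f i \<in> cvs.span (left_basis p)" if "i \<in> I" for i using that assms left_basis(3) by blast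
  then show ?thesis by (simp add: cvs.representation_sum[OF left_basis(2)])
qed

lemma coord_expand:
  assumes "u \<in> left_mod p" "finite F" "\<And>b. b \<notin> F \<Longrightarrow> coord p u b = 0"
  shows "u = (\<Sum>b\<in>F. coord p u b *\<^sub>C b)"
proof -
  have "u = (\<Sum>b | coord p u b \<noteq> 0. coord p u b *\<^sub>C b)"
    using cvs.sum_nonzero_representation_eq[OF left_basis(2), of u p] assms(1) left_basis(3)[of p] by auto
  also have "\<dots> = (\<Sum>b\<in>F. coord p u b *\<^sub>C b)"
    by (rule sum.mono_neutral_left) (use assms in auto)
  finally show ?thesis .
qed

lemma op_trace_eq:
  assumes "op_support p a F"
  shows "op_trace p a = (\<Sum>b\<in>F. coord p (a * b) b)"
  unfolding op_trace_def
  by (rule sum.mono_neutral_left) (use assms left_basis(1)[of p] in \<open>auto simp: op_support_def\<close>)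

lemma op_support_common:
  assumes "op_support p a F" "op_support p b G"
  shows "op_support p a (F \<union> G)" "op_support p b (F \<union> G)"
  using assms by (auto simp: op_support_def)

lemma op_support_add: "op_support p a F \<Longrightarrow> op_support p b F \<Longrightarrow> op_support p (a + b) F"
  by (auto simp: op_support_def distrib_right coord_add left_mod_mult)

lemma op_trace_add:
  assumes "op_support p a F" "op_support p b G"
  shows "op_trace p (a + b) = op_trace p a + op_trace p b"
proof -
  note s = op_support_common[OF assms]
  have "F \<union> G \<subseteq> left_mod p" using s(1) left_basis(1) by (auto simp: op_support_def)
  then have "v \<in> left_mod p" if "v \<in> F \<union> G" for v using that by blast
  then have "coord p ((a + b) * v) v = coord p (a * v) v + coord p (b * v) v" if "v \<in> F \<union> G" for v
    using that by (simp add: distrib_right coord_add left_mod_mult)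
  then show ?thesis
    unfolding op_trace_eq[OF s(1)] op_trace_eq[OF s(2)] op_trace_eq[OF op_support_add[OF s]]
    by (simp add: sum.distrib)
qed

lemma op_trace_scale:
  assumes "op_support p a F"
  shows "op_trace p (c *\<^sub>C a) = c * op_trace p a"
proof -
  have "op_support p (c *\<^sub>C a) F"
    using assms by (auto simp: op_support_def coord_scale left_mod_mult)
  moreover have "F \<subseteq> left_mod p" using assms left_basis(1) by (auto simp: op_support_def)
  ultimately show ?thesis
    using op_trace_eq[OF assms] op_trace_eq[of p "c *\<^sub>C a" F]
    by (auto simp: sum_distrib_left coord_scale left_mod_mult intro!: sum.cong)
qed

lemma op_support_mult_right: "op_support p a F \<Longrightarrow> op_support p (a * b) F"
  by (auto simp: op_support_def mult.assoc left_mod_mult)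

text \<open>Over a common support both traces are the same double sum of products of matrix entries,
  with the two indices exchanged.\<close>

lemma op_trace_mult_commute:
  assumes "op_support p a F" "op_support p b G"
  shows "op_trace p (a * b) = op_trace p (b * a)"
proof -
  let ?H = "F \<union> G"
  note s = op_support_common[OF assms]
  have H: "finite ?H" "?H \<subseteq> left_mod p" using s(1) left_basis(1) by (auto simp: op_support_def)
  have expand: "op_trace p (a * b) = (\<Sum>v\<in>?H. \<Sum>c\<in>?H. coord p (b * v) c * coord p (a * c) v)"
    if s: "op_support p a ?H" "op_support p b ?H" for a b
    unfolding op_trace_eq[OF op_support_mult_right[OF s(1)]]
  proof (rule sum.cong[OF refl])
    fix v assume v: "v \<in> ?H"
    have bv: "b * v = (\<Sum>c\<in>?H. coord p (b * v) c *\<^sub>C c)"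
      by (rule coord_expand) (use v H s in \<open>auto simp: left_mod_mult op_support_def\<close>)
    have "a * b * v = (\<Sum>c\<in>?H. coord p (b * v) c *\<^sub>C (a * c))"
      using arg_cong[OF bv, of "\<lambda>z. a * z"] by (simp add: sum_distrib_left mult.assoc)
    then have "coord p (a * b * v) v = (\<Sum>c\<in>?H. coord p (coord p (b * v) c *\<^sub>C (a * c)) v)"
      using H(2) by (simp, intro coord_sum) (auto intro!: cvs.subspace_scale[OF left_mod_subspace] left_mod_mult)
    also have "\<dots> = (\<Sum>c\<in>?H. coord p (b * v) c * coord p (a * c) v)"
      using H(2) by (intro sum.cong refl coord_scale left_mod_mult) auto
    finally show "coord p (a * b * v) v = (\<Sum>c\<in>?H. coord p (b * v) c * coord p (a * c) v)" .
  qed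
  show ?thesis unfolding expand[OF s] expand[OF s(2,1)]
    by (subst sum.swap) (simp add: mult.commute)
qed

context
  fixes p :: "'a::complex_banach_algebra_1"
  assumes min: "minimal_idempotent p"
begin

lemma p_idem: "p * p = p" and p_nonzero: "p \<noteq> 0"
  using min by (simp_all add: minimal_idempotent_def)

lemma corner_coeff: "p * x * p = corner_coeff p x *\<^sub>C p"
proof -
  have "\<exists>c. p * x * p = c *\<^sub>C p" using min by (simp add: minimal_idempotent_def)
  then show ?thesis unfolding corner_coeff_def by (rule someI_ex)
qed

lemma corner_coeffI: "p * x * p = c *\<^sub>C p \<Longrightarrow> corner_coeff p x = c"
  using corner_coeff[of x] p_nonzero by simp

lemma corner_coeff_mult: "v \<in> left_mod p \<Longrightarrow> p * (y * v) = corner_coeff p (y * v) *\<^sub>C p"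
  using corner_coeff[of "y * v"] by (simp add: left_mod_def mult.assoc)

lemma corner_coeff_p: "corner_coeff p p = 1"
  by (rule corner_coeffI) (simp add: p_idem)

lemma corner_coeff_add: "corner_coeff p (x + y) = corner_coeff p x + corner_coeff p y"
  by (rule corner_coeffI) (simp add: distrib_left distrib_right corner_coeff cvs.scale_left_distrib)

lemma corner_coeff_scale: "corner_coeff p (c *\<^sub>C x) = c * corner_coeff p x"
  by (rule corner_coeffI) (simp add: corner_coeff)

lemma corner_coeff_sum: "corner_coeff p (sum f I) = (\<Sum>i\<in>I. corner_coeff p (f i))"
  by (rule corner_coeffI) (simp add: sum_distrib_left sum_distrib_right corner_coeff cvs.scale_sum_left)

text \<open>Left multiplication by \<open>u * y\<close> sends \<open>v\<close> to
  \<open>corner_coeff p (y * v) *\<^sub>C u\<close>, an operator of rank at most one; its trace is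
  the functional evaluated at \<open>u\<close>.\<close>

lemma op_trace_rank_one:
  assumes "u \<in> left_mod p"
  shows "op_trace p (u * y) = corner_coeff p (y * u)" "\<exists>F. op_support p (u * y) F"
proof -
  define F where "F = {b. coord p u b \<noteq> 0}"
  have F: "finite F" "F \<subseteq> left_basis p"
    using cvs.finite_representation cvs.representation_ne_zero by (auto simp: F_def)
  then have FV: "b \<in> left_mod p" if "b \<in> F" for b using left_basis(1) that by blast
  have uy: "u * y * v = corner_coeff p (y * v) *\<^sub>C u" if "v \<in> left_mod p" for v
  proof -
    have "u * y * v = u * (p * (y * v))" using left_mod_absorb[OF assms, of "y * v"] by (simp add: mult.assoc)
    then show ?thesis using corner_coeff_mult[OF that, of y] assms by (simp add: left_mod_def)
  qed
  have s: "op_support p (u * y) F"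
    using F assms by (simp add: op_support_def uy coord_scale F_def)
  then show "\<exists>F. op_support p (u * y) F" by blast
  have "op_trace p (u * y) = (\<Sum>b\<in>F. corner_coeff p (y * b) * coord p u b)"
    unfolding op_trace_eq[OF s]
    by (rule sum.cong) (use FV assms in \<open>auto simp: uy coord_scale\<close>)
  also have "\<dots> = corner_coeff p (y * (\<Sum>b\<in>F. coord p u b *\<^sub>C b))"
    by (simp add: sum_distrib_left corner_coeff_sum corner_coeff_scale mult.commute)
  also have "(\<Sum>b\<in>F. coord p u b *\<^sub>C b) = u"
    using coord_expand[OF assms F(1)] by (simp add: F_def)
  finally show "op_trace p (u * y) = corner_coeff p (y * u)" .
qed

lemma p_left_mod: "p \<in> left_mod p"
  by (simp add: left_mod_def p_idem)

lemma op_trace_p: "op_trace p p = 1"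
  using op_trace_rank_one(1)[OF p_left_mod, of p] by (simp add: p_idem corner_coeff_p)

text \<open>Simplicity of the module \<open>A p\<close>: semiprimeness supplies \<open>x\<close>
  with \<open>v * x * v\<close> nonzero, and this element is \<open>corner_coeff p (x * v)\<close>
  times \<open>v\<close>, so the coefficient can be divided out.\<close>

lemma ex_corner_mult:
  assumes ss: "semisimple_algebra TYPE('a)" and v: "v \<in> left_mod p" "v \<noteq> 0"
  obtains y where "p * y * v = p"
proof -
  obtain x where x: "v * x * v \<noteq> 0" using semisimple_semiprime[OF ss] v by blast
  have "v * x * v = v * (p * (x * v))" using left_mod_absorb[OF v(1), of "x * v"] by (simp add: mult.assoc)
  then have "corner_coeff p (x * v) \<noteq> 0" using x corner_coeff_mult[OF v(1), of x] by auto
  then have "p * (inverse (corner_coeff p (x * v)) *\<^sub>C x) * v = p"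
    using corner_coeff_mult[OF v(1), of x] by (simp add: mult.assoc)
  then show ?thesis using that by blast
qed

text \<open>A form of Jacobson's density theorem, obtained by an elimination of Gram-Schmidt type:
  independence makes the remainder \<open>z\<close> of \<open>b\<close> nonzero, and simplicity of
  the module recovers \<open>p\<close> from it.\<close>

lemma ex_dual_system:
  assumes ss: "semisimple_algebra TYPE('a)"
    and "finite B" "cvs.independent B" "B \<subseteq> left_mod p"
  shows "\<exists>y. \<forall>b\<in>B. \<forall>c\<in>B. p * y b * c = (if b = c then p else 0)"
  using assms(2-)
proof (induction B)
  case (insert b B)
  have bB: "b \<notin> cvs.span B" "cvs.independent B" and V: "b \<in> left_mod p" "B \<subseteq> left_mod p"
    using insert by (auto simp: cvs.independent_insert)
  then obtain y where y: "\<And>c d. c \<in> B \<Longrightarrow> d \<in> B \<Longrightarrow> p * y c * d = (if c = d then p else 0)"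
    using insert by blast
  have cV: "c * p = c" if "c \<in> insert b B" for c using V that by (auto simp: left_mod_def)
  have cpx: "c * x = c * (p * x)" if "c \<in> B" for c x
    using left_mod_absorb[of c p x] V that by auto
  define z where "z = b - (\<Sum>c\<in>B. c * (y c * b))"
  have cyb: "c * (y c * b) = corner_coeff p (y c * b) *\<^sub>C c" if "c \<in> B" for c
    using cpx[OF that, of "y c * b"] corner_coeff_mult[OF V(1), of "y c"] cV[of c] that by simp
  then have "(\<Sum>c\<in>B. c * (y c * b)) \<in> cvs.span B"
    by (intro cvs.span_sum) (auto intro: cvs.span_scale cvs.span_base)
  then have "z \<noteq> 0" using bB(1) by (auto simp: z_def)
  have sB: "(\<Sum>c\<in>B. c * (y c * d)) = d" if "d \<in> B" for d
  proof -
    have "(\<Sum>c\<in>B. c * (y c * d)) = (\<Sum>c\<in>B. if c = d then c else 0)"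
    proof (rule sum.cong[OF refl])
      fix c assume "c \<in> B"
      have "c * (y c * d) = c * (p * y c * d)"
        by (simp only: cpx[OF \<open>c \<in> B\<close>, of "y c * d"] mult.assoc)
      then show "c * (y c * d) = (if c = d then c else 0)"
        using y[of c d] cV[of c] that \<open>c \<in> B\<close> by (cases "c = d") auto
    qed
    then show ?thesis using that insert by simp
  qed
  have "z \<in> left_mod p" using V cV by (simp add: left_mod_def z_def left_diff_distrib sum_distrib_right mult.assoc)
  then obtain y' where y': "p * y' * z = p" using ex_corner_mult[OF ss _ \<open>z \<noteq> 0\<close>] by blast
  \<comment> \<open>\<open>1 - (\<Sum>c\<in>B. c * y c)\<close> annihilates \<open>B\<close> and
    sends \<open>b\<close> to \<open>z\<close>; hence \<open>p * Y\<close> annihilates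
    \<open>B\<close> and sends \<open>b\<close> to \<open>p\<close>.\<close>
  define Y where "Y = y' * (1 - (\<Sum>c\<in>B. c * y c))"
  have Y: "p * Y * x = p * y' * (x - (\<Sum>c\<in>B. c * (y c * x)))" for x
    by (simp add: Y_def algebra_simps sum_distrib_right)
  have Yb: "p * Y * b = p" and YB: "\<And>d. d \<in> B \<Longrightarrow> p * Y * d = 0"
    unfolding Y using y' sB by (simp_all add: z_def)
  \<comment> \<open>Subtracting a multiple of \<open>Y\<close> makes the old functionals vanish at
    \<open>b\<close> and leaves their values on \<open>B\<close> unchanged.\<close>
  define y2 where "y2 c = (if c = b then Y else y c - corner_coeff p (y c * b) *\<^sub>C Y)" for c
  have "b \<notin> B" using insert by simp
  have "p * y2 c * d = (if c = d then p else 0)" if cd: "c \<in> insert b B" "d \<in> insert b B" for c d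
  proof (cases "c = b")
    case True
    then show ?thesis using cd Yb YB \<open>b \<notin> B\<close> by (auto simp: y2_def)
  next
    case False
    then have "p * y2 c * d = p * y c * d - corner_coeff p (y c * b) *\<^sub>C (p * Y * d)"
      by (simp add: y2_def algebra_simps)
    moreover have "c \<in> B" using cd False by simp
    ultimately show ?thesis
      using y[of c d] Yb YB[of d] cd corner_coeff_mult[OF V(1), of "y c"] False by (auto simp: mult.assoc)
  qed
  then show ?case by blast
qed simp

text \<open>If \<open>b = a * u\<^sub>b\<close> for the members \<open>b\<close> of an independent subset \<open>B\<close> of \<open>A p\<close>, a dual system yields \<open>x\<close>
  such that the \<open>u\<^sub>b\<close> are eigenvectors of \<open>x * a\<close> for distinct nonzero eigenvalues.\<close>

lemma card_independent_le_rank: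
  assumes ss: "semisimple_algebra TYPE('a)"
    and B: "finite B" "cvs.independent B" "B \<subseteq> (\<lambda>u. a * u) ` left_mod p"
  shows "enat (card B) \<le> alg_rank a"
proof -
  have V: "B \<subseteq> left_mod p" using B(3) left_mod_mult by blast
  obtain y where y: "\<And>c d. c \<in> B \<Longrightarrow> d \<in> B \<Longrightarrow> p * y c * d = (if c = d then p else 0)"
    using ex_dual_system[OF ss B(1,2) V] by blast
  obtain u where u: "\<And>b. b \<in> B \<Longrightarrow> u b \<in> left_mod p \<and> a * u b = b" 
  proof -
    have "\<forall>b\<in>B. \<exists>w. w \<in> left_mod p \<and> a * w = b" using B(3) by blast
    from bchoice[OF this] show ?thesis using that by blast
  qed
  obtain h :: "'a \<Rightarrow> nat" where h: "inj_on h B" using finite_imp_inj_to_nat_seg[OF B(1)] by blast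
  \<comment> \<open>The successor keeps these distinct eigenvalues away from 0.\<close>
  define l where "l b = complex_of_nat (Suc (h b))" for b
  define x where "x = (\<Sum>b\<in>B. l b *\<^sub>C (u b * y b))"
  have "l c \<in> nonzero_spectrum (x * a)" if c: "c \<in> B" for c
  proof -
    have "x * a * u c = (\<Sum>b\<in>B. l b *\<^sub>C (u b * (p * y b * c)))"
      unfolding mult.assoc x_def sum_distrib_right u[OF c, THEN conjunct2]
      by (intro sum.cong refl) (use u in \<open>simp add: mult.assoc flip: left_mod_absorb\<close>)
    also have "\<dots> = (\<Sum>b\<in>B. if b = c then l b *\<^sub>C u b else 0)"
      using u c by (intro sum.cong refl) (auto simp: y left_mod_def)
    also have "\<dots> = l c *\<^sub>C u c" using c B(1) by simp
    finally have e: "(l c *\<^sub>C 1 - x * a) * u c = 0" by (simp add: algebra_simps)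
    have "0 \<notin> B" using B(2) cvs.dependent_zero by blast
    then have "u c \<noteq> 0" using u[OF c] c by auto
    have "\<not> alg_invertible (l c *\<^sub>C 1 - x * a)"
    proof
      assume "alg_invertible (l c *\<^sub>C 1 - x * a)"
      then obtain w where "w * (l c *\<^sub>C 1 - x * a) = 1" unfolding alg_invertible_def by blast
      then have "u c = w * ((l c *\<^sub>C 1 - x * a) * u c)" by (simp flip: mult.assoc)
      then show False using e \<open>u c \<noteq> 0\<close> by simp
    qed
    moreover have "l c \<noteq> 0" unfolding l_def by (metis of_nat_eq_0_iff nat.distinct(1))
    ultimately show ?thesis by (simp add: nonzero_spectrum_def alg_spectrum_def)
  qed
  then have "ecard (l ` B) \<le> ecard (nonzero_spectrum (x * a))" by (intro ecard_mono) blast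
  moreover have "inj_on l B" using h unfolding inj_on_def l_def by (metis of_nat_eq_iff nat.inject)
  ultimately show ?thesis
    using ecard_le_alg_rank[of x a] B(1) by (simp add: ecard_def card_image)
qed

text \<open>Independent subsets of the image of \<open>a\<close> on \<open>A p\<close> have at most
  \<open>alg_rank a\<close> elements, so the image has a finite basis \<open>B\<close>;
  \<open>F\<close> collects the coordinates that occur in \<open>B\<close>.\<close>

lemma ex_op_support:
  assumes ss: "semisimple_algebra TYPE('a)" and a: "a \<in> soc"
  obtains F where "op_support p a F"
proof -
  let ?W = "(\<lambda>u. a * u) ` left_mod p"
  obtain B where B: "B \<subseteq> ?W" "cvs.independent B" "?W \<subseteq> cvs.span B"
    using cvs.maximal_independent_subset by blast
  obtain r where r: "alg_rank a = enat r" using a by (auto simp: soc_def)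
  have finB: "finite B"
  proof (rule ccontr)
    assume "infinite B"
    then obtain T where T: "T \<subseteq> B" "finite T" "card T = Suc r"
      using infinite_arbitrarily_large by blast
    then have "enat (card T) \<le> alg_rank a"
      using B(1) cvs.independent_mono[OF B(2) T(1)] by (intro card_independent_le_rank[OF ss]) auto
    then show False using T r by simp
  qed
  define F where "F = (\<Union>w\<in>B. {b. coord p w b \<noteq> 0})"
  have "finite F" unfolding F_def using finB cvs.finite_representation by blast
  moreover have "F \<subseteq> left_basis p" unfolding F_def using cvs.representation_ne_zero by blast
  moreover have "coord p (a * u) b = 0" if u: "u \<in> left_mod p" and b: "b \<notin> F" for u b
  proof -
    have "a * u \<in> cvs.span B" using u B(3) by blast
    then have "a * u \<in> left_mod p \<and> coord p (a * u) b = 0"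
    proof (induction rule: cvs.span_induct_alt)
      case base
      show ?case by (simp add: left_mod_def cvs.representation_zero)
    next
      case (step c x y)
      have "B \<subseteq> left_mod p" using B(1) left_mod_mult by blast
      then have "x \<in> left_mod p" "coord p x b = 0" using step(1) b by (auto simp: F_def)
      then show ?case using step(2)
        by (simp add: coord_add coord_scale cvs.subspace_add cvs.subspace_scale left_mod_subspace)
    qed
    then show ?thesis by simp
  qed
  ultimately have "op_support p a F" by (simp add: op_support_def)
  then show ?thesis by (rule that)
qed

end

lemma op_trace_eq_0: "(\<And>x. q * x * p = 0) \<Longrightarrow> op_trace p q = 0"
proof -
  assume q: "\<And>x. q * x * p = 0"
  have "q * b = 0" if "b \<in> left_basis p" for b
    using q[of b] that left_basis(1)[of p] by (auto simp: left_mod_def mult.assoc)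
  then show ?thesis unfolding op_trace_def
    by (intro sum.neutral) (simp add: cvs.representation_zero)
qed

section \<open>Matrix algebras inside the algebra\<close>

text \<open>An embedded copy of the matrix algebra whose unit is an idempotent possibly different
  from 1. It arises twice: from a dual system in \<open>A p\<close>, and as the inverse of a given
  isomorphism of the socle.\<close>

locale matrix_units_hom =
  fixes \<Phi> :: "complex mat \<Rightarrow> 'a::complex_banach_algebra_1" and n :: nat
  assumes Phi_add: "M \<in> carrier_mat n n \<Longrightarrow> N \<in> carrier_mat n n \<Longrightarrow> \<Phi> (M + N) = \<Phi> M + \<Phi> N"
    and Phi_mult: "M \<in> carrier_mat n n \<Longrightarrow> N \<in> carrier_mat n n \<Longrightarrow> \<Phi> (M * N) = \<Phi> M * \<Phi> N"
    and Phi_smult: "M \<in> carrier_mat n n \<Longrightarrow> \<Phi> (c \<cdot>\<^sub>m M) = c *\<^sub>C \<Phi> M"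
    and Phi_eq_0: "M \<in> carrier_mat n n \<Longrightarrow> \<Phi> M = 0 \<Longrightarrow> M = 0\<^sub>m n n"
begin

abbreviation unit :: 'a where "unit \<equiv> \<Phi> (1\<^sub>m n)"

lemma Phi_0: "\<Phi> (0\<^sub>m n n) = 0"
proof -
  have "0 \<cdot>\<^sub>m 1\<^sub>m n = (0\<^sub>m n n :: complex mat)" by (rule eq_matI) auto
  then show ?thesis using Phi_smult[of "1\<^sub>m n" 0] by simp
qed

lemma unit_mult: "M \<in> carrier_mat n n \<Longrightarrow> unit * \<Phi> M = \<Phi> M" "M \<in> carrier_mat n n \<Longrightarrow> \<Phi> M * unit = \<Phi> M"
  using Phi_mult[of "1\<^sub>m n" M] Phi_mult[of M "1\<^sub>m n"] by simp_all

lemma unit_idem: "unit * unit = unit"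
  by (rule unit_mult) simp

text \<open>A kernel vector of a singular \<open>C\<close>, repeated as every column, gives a
  nonzero matrix \<open>N\<close> with \<open>C * N = 0\<close>; a left inverse of
  \<open>\<Phi> C\<close> in the corner would force \<open>\<Phi> N = 0\<close>.\<close>

lemma corner_inv_Phi:
  assumes C: "C \<in> carrier_mat n n"
  shows "corner_inv unit (\<Phi> C) \<longleftrightarrow> Determinant.det C \<noteq> 0"
proof
  assume "Determinant.det C \<noteq> 0"
  from det_non_zero_imp_unit[OF C this] obtain N
    where N: "N \<in> carrier_mat n n" "N * C = 1\<^sub>m n" "C * N = 1\<^sub>m n"
    by (auto simp: Units_def ring_mat_simps)
  then show "corner_inv unit (\<Phi> C)" unfolding corner_inv_def
    by (intro exI[of _ "\<Phi> N"]) (simp add: unit_mult C flip: Phi_mult)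
next
  assume "corner_inv unit (\<Phi> C)"
  then obtain v where v: "v * \<Phi> C = unit" unfolding corner_inv_def by blast
  show "Determinant.det C \<noteq> 0"
  proof
    assume "Determinant.det C = 0"
    then obtain w where w: "w \<in> carrier_vec n" "w \<noteq> 0\<^sub>v n" "C *\<^sub>v w = 0\<^sub>v n"
      using det_0_iff_vec_prod_zero[OF C] by blast
    define N where "N = mat_of_cols n (replicate n w)"
    have N: "N \<in> carrier_mat n n" by (auto simp: N_def)
    have "C * N = 0\<^sub>m n n"
    proof (rule eq_matI)
      fix i j assume "i < dim_row (0\<^sub>m n n :: complex mat)" "j < dim_col (0\<^sub>m n n :: complex mat)"
      then have ij: "i < n" "j < n" by auto
      have "(C * N) $$ (i, j) = Matrix.vec_index (C *\<^sub>v w) i"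
        using ij C N w(1) by (simp add: N_def)
      then show "(C * N) $$ (i, j) = 0\<^sub>m n n $$ (i, j)" using w ij by simp
    qed (use C N in auto)
    then have "\<Phi> C * \<Phi> N = 0" using Phi_mult[OF C N] Phi_0 by simp
    then have "\<Phi> N = 0" using v unit_mult(1)[OF N] by (metis mult.assoc mult_zero_right)
    then have N0: "N = 0\<^sub>m n n" using Phi_eq_0[OF N] by simp
    have "Matrix.vec_index w i = 0" if "i < n" for i
      using arg_cong[OF N0, of "\<lambda>N. N $$ (i, i)"] that w(1) by (simp add: N_def mat_of_cols_index)
    then have "w = 0\<^sub>v n" using w(1) by (intro eq_vecI) auto
    then show False using w by simp
  qed
qed

lemma nonzero_spectrum_Phi:
  assumes M: "M \<in> carrier_mat n n"
  shows "nonzero_spectrum (\<Phi> M) = {\<mu>. \<mu> \<noteq> 0 \<and> poly (char_poly M) \<mu> = 0}"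
proof -
  have "\<mu> \<in> nonzero_spectrum (\<Phi> M) \<longleftrightarrow> poly (char_poly M) \<mu> = 0" if "\<mu> \<noteq> 0" for \<mu>
  proof -
    have cm: "char_matrix M \<mu> \<in> carrier_mat n n" using M by simp
    have "\<Phi> (char_matrix M \<mu>) = \<Phi> M - \<mu> *\<^sub>C unit"
      using M by (simp add: char_matrix_def Phi_add Phi_smult)
    then have "corner_inv unit (\<Phi> M - \<mu> *\<^sub>C unit) \<longleftrightarrow> \<not> eigenvalue M \<mu>"
      using corner_inv_Phi[OF cm] eigenvalue_det[OF M] by simp
    then show ?thesis
      using nonzero_spectrum_corner_iff[OF unit_idem unit_mult[OF M] that] eigenvalue_root_char_poly[OF M] by simp
  qed
  then show ?thesis unfolding nonzero_spectrum_def by auto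
qed

lemma char_poly_nonzero: "M \<in> carrier_mat n n \<Longrightarrow> char_poly M \<noteq> 0"
  using degree_monic_char_poly[of M n] by auto

text \<open>The nonzero spectrum of \<open>x * unit\<close> is that of
  \<open>unit * x * unit\<close>, hence consists of eigenvalues of an n by n matrix.\<close>

lemma unit_in_soc:
  assumes compress: "\<And>x. \<exists>M\<in>carrier_mat n n. unit * x * unit = \<Phi> M"
  shows "unit \<in> soc"
proof -
  have "ecard (nonzero_spectrum (x * unit)) \<le> enat n" for x
  proof -
    obtain M where M: "M \<in> carrier_mat n n" "unit * x * unit = \<Phi> M" using compress by blast
    have "nonzero_spectrum (x * unit) = nonzero_spectrum (\<Phi> M)"
      using nonzero_spectrum_commute[of "x * unit" unit] M unit_idem by (simp add: mult.assoc)
    also have "\<dots> \<subseteq> {\<mu>. poly (char_poly M) \<mu> = 0}" using nonzero_spectrum_Phi[OF M(1)] by auto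
    finally have "ecard (nonzero_spectrum (x * unit)) \<le> ecard {\<mu>. poly (char_poly M) \<mu> = 0}" by (rule ecard_mono)
    also have "\<dots> \<le> enat n"
      using poly_roots_finite[OF char_poly_nonzero[OF M(1)]] card_poly_roots_bound[OF char_poly_nonzero[OF M(1)]]
        degree_monic_char_poly[OF M(1)] by (simp add: ecard_def)
    finally show ?thesis .
  qed
  then have "alg_rank unit \<le> enat n" unfolding alg_rank_def by (intro SUP_least)
  then show ?thesis by (auto simp: soc_def dest: enat_ile)
qed

end

text \<open>The products \<open>v i * y j\<close> are matrix units: \<open>y j * v k\<close> in the
  middle collapses to \<open>p\<close> or 0, and \<open>v i\<close> absorbs
  \<open>p\<close>.\<close>

locale dual_system =
  fixes p :: "'a::complex_banach_algebra_1" and v y :: "nat \<Rightarrow> 'a" and n :: nat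
  assumes min: "minimal_idempotent p"
    and vp: "i < n \<Longrightarrow> v i * p = v i"
    and py: "i < n \<Longrightarrow> p * y i = y i"
    and dual: "i < n \<Longrightarrow> j < n \<Longrightarrow> y i * v j = (if i = j then p else 0)"
begin

definition Phi :: "complex mat \<Rightarrow> 'a" where
  "Phi M = (\<Sum>i<n. \<Sum>j<n. M $$ (i, j) *\<^sub>C (v i * y j))"

definition coeffs :: "'a \<Rightarrow> complex mat" where
  "coeffs x = mat n n (\<lambda>(i, j). corner_coeff p (y i * x * v j))"

lemma coeffs_carrier: "coeffs x \<in> carrier_mat n n"
  by (simp add: coeffs_def)

lemma y_x_v: "i < n \<Longrightarrow> j < n \<Longrightarrow> y i * x * v j = corner_coeff p (y i * x * v j) *\<^sub>C p"
  using corner_coeff[OF min, of "y i * x * v j"] vp[of j] py[of i] by (metis mult.assoc)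

lemma coeffs_Phi:
  assumes M: "M \<in> carrier_mat n n"
  shows "coeffs (Phi M) = M"
proof (rule eq_matI)
  fix i j assume "i < dim_row M" "j < dim_col M"
  then have ij: "i < n" "j < n" using M by auto
  have "y i * Phi M * v j = (\<Sum>k<n. \<Sum>l<n. M $$ (k, l) *\<^sub>C ((y i * v k) * (y l * v j)))"
    by (simp add: Phi_def sum_distrib_left sum_distrib_right mult.assoc)
  also have "\<dots> = (\<Sum>k<n. if k = i then \<Sum>l<n. if l = j then M $$ (k, l) *\<^sub>C p else 0 else 0)"
  proof -
    have "M $$ (k, l) *\<^sub>C ((y i * v k) * (y l * v j)) = (if k = i then if l = j then M $$ (k, l) *\<^sub>C p else 0 else 0)"
      if "k < n" "l < n" for k l
      using ij that by (auto simp: dual p_idem[OF min])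
    then show ?thesis by (intro sum.cong refl) (auto intro!: sum.cong)
  qed
  also have "\<dots> = M $$ (i, j) *\<^sub>C p" using ij by simp
  finally have "corner_coeff p (y i * Phi M * v j) = M $$ (i, j)"
    by (intro corner_coeffI[OF min]) (simp add: p_idem[OF min])
  then show "coeffs (Phi M) $$ (i, j) = M $$ (i, j)" using ij by (simp add: coeffs_def)
qed (use M in \<open>auto simp: coeffs_def\<close>)

lemma v_y_mult: "i < n \<Longrightarrow> j < n \<Longrightarrow> k < n \<Longrightarrow> l < n \<Longrightarrow>
    (v i * y j) * (v k * y l) = (if j = k then v i * y l else 0)"
proof -
  assume "i < n" "j < n" "k < n" "l < n"
  moreover have "(v i * y j) * (v k * y l) = v i * (y j * v k) * y l" by (simp add: mult.assoc)
  ultimately show ?thesis by (simp add: dual vp)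
qed

lemma Phi_times:
  assumes M: "M \<in> carrier_mat n n" and N: "N \<in> carrier_mat n n"
  shows "Phi (M * N) = Phi M * Phi N"
proof -
  have "Phi M * Phi N = (\<Sum>i<n. \<Sum>j<n. \<Sum>k<n. \<Sum>l<n. (M $$ (i, j) * N $$ (k, l)) *\<^sub>C ((v i * y j) * (v k * y l)))"
  proof -
    have 1: "Phi M * X = (\<Sum>i<n. \<Sum>j<n. M $$ (i, j) *\<^sub>C ((v i * y j) * X))" for X
      by (simp add: Phi_def sum_distrib_right)
    have 2: "X * Phi N = (\<Sum>k<n. \<Sum>l<n. N $$ (k, l) *\<^sub>C (X * (v k * y l)))" for X
      by (simp add: Phi_def sum_distrib_left)
    show ?thesis by (simp only: 1[of "Phi N"] 2[of "v _ * y _"] cvs.scale_sum_right cvs.scale_scale)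
  qed
  also have "\<dots> = (\<Sum>i<n. \<Sum>j<n. \<Sum>k<n. if k = j then \<Sum>l<n. (M $$ (i, j) * N $$ (k, l)) *\<^sub>C (v i * y l) else 0)"
    by (intro sum.cong refl) (auto simp: v_y_mult intro!: sum.cong)
  also have "\<dots> = (\<Sum>i<n. \<Sum>j<n. \<Sum>l<n. (M $$ (i, j) * N $$ (j, l)) *\<^sub>C (v i * y l))"
    by (rule sum.cong[OF refl], rule sum.cong[OF refl]) simp
  also have "\<dots> = (\<Sum>i<n. \<Sum>l<n. (\<Sum>j<n. M $$ (i, j) * N $$ (j, l)) *\<^sub>C (v i * y l))"
    by (rule sum.cong[OF refl], subst sum.swap) (simp add: cvs.scale_sum_left)
  also have "\<dots> = Phi (M * N)"
    unfolding Phi_def using M N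
    by (intro sum.cong refl) (simp add: scalar_prod_def atLeast0LessThan)
  finally show ?thesis ..
qed

sublocale matrix_units_hom Phi n
proof
  fix M N :: "complex mat" and c assume M: "M \<in> carrier_mat n n" and N: "N \<in> carrier_mat n n"
  show "Phi (M + N) = Phi M + Phi N"
    using M N by (simp add: Phi_def cvs.scale_left_distrib sum.distrib)
  show "Phi (M * N) = Phi M * Phi N" by (rule Phi_times[OF M N])
next
  fix M :: "complex mat" and c assume M: "M \<in> carrier_mat n n"
  show "Phi (c \<cdot>\<^sub>m M) = c *\<^sub>C Phi M"
    using M by (simp add: Phi_def cvs.scale_sum_right)
  show "M = 0\<^sub>m n n" if "Phi M = 0"
  proof -
    have "coeffs 0 = 0\<^sub>m n n"
      by (rule eq_matI) (auto simp: coeffs_def intro!: corner_coeffI[OF min])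
    then show ?thesis using coeffs_Phi[OF M] that by simp
  qed
qed

lemma unit_eq: "unit = (\<Sum>i<n. v i * y i)"
proof -
  have "unit = (\<Sum>i<n. \<Sum>j<n. if j = i then v i * y j else 0)"
    unfolding Phi_def by (intro sum.cong refl) auto
  then show ?thesis by simp
qed

lemma compress: "unit * x * unit = Phi (coeffs x)"
proof -
  have "unit * x * unit = (\<Sum>i<n. \<Sum>j<n. v i * (y i * x * v j) * y j)"
    by (simp add: unit_eq sum_distrib_left sum_distrib_right mult.assoc) (rule sum.swap)
  also have "\<dots> = (\<Sum>i<n. \<Sum>j<n. corner_coeff p (y i * x * v j) *\<^sub>C (v i * y j))"
    by (intro sum.cong refl) (subst y_x_v, auto simp: vp)
  also have "\<dots> = Phi (coeffs x)" by (simp add: Phi_def coeffs_def)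
  finally show ?thesis .
qed

lemma unit_soc: "unit \<in> soc"
  by (rule unit_in_soc) (use compress coeffs_carrier in blast)

text \<open>Each summand \<open>v i * y i\<close> is a rank-one operator of trace 1. The induction
  runs over partial sums so that a support is available for additivity.\<close>

lemma op_trace_unit: "op_trace p unit = of_nat n"
proof -
  have "(\<exists>F. op_support p (\<Sum>i<m. v i * y i) F) \<and> op_trace p (\<Sum>i<m. v i * y i) = of_nat m" if "m \<le> n" for m
    using that
  proof (induction m)
    case 0
    have "op_support p (0::'a) {}" by (auto simp: op_support_def cvs.representation_zero)
    then show ?case using op_trace_eq[of p 0 "{}"] by auto
  next
    case (Suc m)
    then obtain F where F: "op_support p (\<Sum>i<m. v i * y i) F" and t: "op_trace p (\<Sum>i<m. v i * y i) = of_nat m" by auto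
    have vm: "v m \<in> left_mod p" using Suc vp by (simp add: left_mod_def)
    obtain G where G: "op_support p (v m * y m) G" using op_trace_rank_one(2)[OF min vm] by blast
    have "op_trace p (v m * y m) = 1"
      using op_trace_rank_one(1)[OF min vm, of "y m"] Suc by (simp add: dual corner_coeff_p[OF min])
    then show ?case
      using op_trace_add[OF F G] op_support_add[OF op_support_common[OF F G]] t by auto
  qed
  then show ?thesis unfolding unit_eq by blast
qed

end

lemma ex_dual_system_list:
  fixes p :: "'a::complex_banach_algebra_1"
  assumes ss: "semisimple_algebra TYPE('a)" and min: "minimal_idempotent p"
    and B: "finite B" "cvs.independent B" "B \<subseteq> left_mod p"
  obtains v y where "dual_system p v y (card B)" "v ` {..<card B} = B"
proof -
  obtain y where y: "\<And>b c. b \<in> B \<Longrightarrow> c \<in> B \<Longrightarrow> p * y b * c = (if b = c then p else 0)"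
    using ex_dual_system[OF min ss B] by blast
  obtain v where v: "bij_betw v {..<card B} B"
    using ex_bij_betw_nat_finite[OF B(1)] by (auto simp: atLeast0LessThan)
  have vB: "v i \<in> B" if "i < card B" for i using v that by (auto simp: bij_betw_def)
  have "dual_system p v (\<lambda>i. p * y (v i)) (card B)"
  proof
    fix i j assume i: "i < card B"
    show "v i * p = v i" using vB[OF i] B(3) by (auto simp: left_mod_def)
    show "p * (p * y (v i)) = p * y (v i)" using p_idem[OF min] by (simp flip: mult.assoc)
    assume j: "j < card B"
    have "v i = v j \<longleftrightarrow> i = j" using v i j by (auto simp: bij_betw_def inj_on_def)
    then show "p * y (v i) * v j = (if i = j then p else 0)" using y[OF vB[OF i] vB[OF j]] by simp
  qed (rule min)
  moreover have "v ` {..<card B} = B" using v by (simp add: bij_betw_def)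
  ultimately show ?thesis using that by blast
qed

section \<open>From condition (I) to a matrix algebra\<close>

lemma idempotent_spectral_radius_le_1:
  fixes e :: "'a::complex_banach_algebra_1"
  assumes "e * e = e"
  shows "alg_spectral_radius e \<le> 1"
proof -
  have "\<mu> = 0 \<or> \<mu> = 1" if "\<mu> \<in> alg_spectrum e" for \<mu>
  proof (rule ccontr)
    assume \<mu>: "\<not> (\<mu> = 0 \<or> \<mu> = 1)"
    \<comment> \<open>From the inverse of \<open>\<mu> - e\<close> for an idempotent
      \<open>e\<close>: the coefficient is \<open>1 / (\<mu> - 1) - 1 / \<mu>\<close>.\<close>
    define k where "k = 1 / (\<mu> * (\<mu> - 1))"
    have k: "inverse \<mu> + k = \<mu> * k" using \<mu> by (simp add: k_def field_simps)
    have "(\<mu> *\<^sub>C 1 - e) * (inverse \<mu> *\<^sub>C 1 + k *\<^sub>C e) = 1 + (\<mu> * k - (inverse \<mu> + k)) *\<^sub>C e"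
      "(inverse \<mu> *\<^sub>C 1 + k *\<^sub>C e) * (\<mu> *\<^sub>C 1 - e) = 1 + (\<mu> * k - (inverse \<mu> + k)) *\<^sub>C e"
      using \<mu> assms by (simp_all add: algebra_simps cvs.scale_left_distrib cvs.scale_left_diff_distrib)
    then have "alg_invertible (\<mu> *\<^sub>C 1 - e)" using k by (intro alg_invertibleI) auto
    then show False using that by (simp add: alg_spectrum_def)
  qed
  \<comment> \<open>A supremum over the empty set of reals would not be controlled by the bound on
    the members.\<close>
  moreover have "alg_spectrum e \<noteq> {}"
  proof (cases "e = 1")
    case True
    then have "1 \<in> alg_spectrum e" by (simp add: alg_spectrum_def alg_invertible_def)
    then show ?thesis by blast
  next
    case False
    have "\<not> alg_invertible e"
    proof
      assume "alg_invertible e"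
      then obtain w where "w * e = 1" by (auto simp: alg_invertible_def)
      then have "e = w * (e * e)" by (simp flip: mult.assoc)
      then show False using assms \<open>w * e = 1\<close> False by simp
    qed
    then have "0 \<in> alg_spectrum e" by (simp add: zero_in_alg_spectrum)
    then show ?thesis by blast
  qed
  ultimately show ?thesis unfolding alg_spectral_radius_def by (intro cSUP_least) force+
qed

lemma zero_soc: "0 \<in> soc"
proof -
  have "nonzero_spectrum (x * (0::'a)) = {}" for x by (auto simp: nonzero_spectrum_iff)
  then have "alg_rank (0::'a) \<le> enat 0" unfolding alg_rank_def by (intro SUP_least) (simp add: ecard_def)
  then show ?thesis by (auto simp: soc_def dest: enat_ile)
qed

lemma isomorphic_zero_matrix_algebra: "isomorphic_to_matrix_algebra {0} 0"
proof -
  have "carrier_mat 0 0 = {0\<^sub>m 0 0 :: complex mat}" by (auto intro!: eq_matI)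
  then have "bij_betw (\<lambda>_. 0\<^sub>m 0 0 :: complex mat) {0::'a} (carrier_mat 0 0)"
    by (simp add: bij_betw_def)
  moreover have "0\<^sub>m 0 0 * 0\<^sub>m 0 0 = (0\<^sub>m 0 0 :: complex mat)" "c \<cdot>\<^sub>m 0\<^sub>m 0 0 = (0\<^sub>m 0 0 :: complex mat)" for c
    by (auto intro!: eq_matI)
  ultimately show ?thesis unfolding isomorphic_to_matrix_algebra_def
    by (intro exI[of _ "\<lambda>_. 0\<^sub>m 0 0"]) auto
qed

text \<open>The first hypothesis excludes two inequivalent minimal idempotents, since each would carry its own
  trace; the second bounds the dimension of \<open>A p\<close>, since idempotents have spectral radius at most one.\<close>

lemma isomorphic_to_matrix_algebraI:
  assumes ss: "semisimple_algebra TYPE('a::complex_banach_algebra_1)"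
    and unique: "\<And>f :: 'a \<Rightarrow> complex. linear_functional_on soc f \<Longrightarrow> \<forall>a\<in>soc. \<forall>b\<in>soc. f (a * b) = f (b * a) \<Longrightarrow>
      \<exists>\<alpha>. \<forall>a\<in>soc. f a = \<alpha> * soc_trace a"
    and bounded: "\<And>f :: 'a \<Rightarrow> complex. linear_functional_on soc f \<Longrightarrow> \<forall>a\<in>soc. \<forall>b\<in>soc. f (a * b) = f (b * a) \<Longrightarrow>
      \<exists>c>0. \<forall>a\<in>soc. cmod (f a) \<le> c * alg_spectral_radius a"
  shows "\<exists>n. isomorphic_to_matrix_algebra (soc :: 'a set) n"
proof (cases "(soc :: 'a set) = {0}")
  case True
  then show ?thesis using isomorphic_zero_matrix_algebra[where ?'a = 'a] by auto
next
  case False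
  have lin: "linear_functional_on soc (op_trace p)" if pm: "minimal_idempotent p" for p :: 'a
    unfolding linear_functional_on_def
  proof (intro conjI ballI allI)
    fix a b :: 'a and c assume a: "a \<in> soc" and "b \<in> soc"
    obtain F where F: "op_support p a F" by (rule ex_op_support[OF pm ss a])
    obtain G where G: "op_support p b G" by (rule ex_op_support[OF pm ss \<open>b \<in> soc\<close>])
    show "op_trace p (a + b) = op_trace p a + op_trace p b" by (rule op_trace_add[OF F G])
  next
    fix a :: 'a and c assume a: "a \<in> soc"
    obtain F where F: "op_support p a F" by (rule ex_op_support[OF pm ss a])
    show "op_trace p (c *\<^sub>C a) = c * op_trace p a" by (rule op_trace_scale[OF F])
  qed
  have tr: "\<forall>a\<in>soc. \<forall>b\<in>soc. op_trace p (a * b) = op_trace p (b * a)" if pm: "minimal_idempotent p" for p :: 'a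
  proof (intro ballI)
    fix a b :: 'a assume a: "a \<in> soc" and b: "b \<in> soc"
    obtain F where F: "op_support p a F" by (rule ex_op_support[OF pm ss a])
    obtain G where G: "op_support p b G" by (rule ex_op_support[OF pm ss b])
    show "op_trace p (a * b) = op_trace p (b * a)" by (rule op_trace_mult_commute[OF F G])
  qed
  obtain a :: 'a where "a \<in> soc" "a \<noteq> 0" using False zero_soc by blast
  then obtain x y where "minimal_idempotent (x * a * y)" by (rule ex_minimal_idempotent[OF ss])
  then obtain p :: 'a where p: "minimal_idempotent p" by blast
  note psoc = minimal_idempotent_soc[OF p]
  from bounded[OF lin[OF p] tr[OF p]]
  obtain c where c: "c > 0" "\<And>a. a \<in> soc \<Longrightarrow> cmod (op_trace p a) \<le> c * alg_spectral_radius a"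
    by auto
  have card_le: "real (card B) \<le> c" if B: "finite B" "cvs.independent B" "B \<subseteq> left_mod p" for B
  proof -
    obtain v y where D: "dual_system p v y (card B)" and "v ` {..<card B} = B"
      by (rule ex_dual_system_list[OF ss p B])
    interpret D: dual_system p v y "card B" by (rule D)
    have "real (card B) = cmod (op_trace p D.unit)" by (simp add: D.op_trace_unit)
    also have "\<dots> \<le> c * alg_spectral_radius D.unit" by (rule c(2)[OF D.unit_soc])
    also have "\<dots> \<le> c * 1"
      using c(1) idempotent_spectral_radius_le_1[OF D.unit_idem] by (intro mult_left_mono) auto
    finally show ?thesis by simp
  qed
  have finB: "finite (left_basis p)"
  proof (rule ccontr)
    assume "infinite (left_basis p)"
    then obtain T where T: "T \<subseteq> left_basis p" "finite T" "card T = Suc (nat \<lceil>c\<rceil>)"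
      using infinite_arbitrarily_large by blast
    then have "real (card T) \<le> c"
      using left_basis(1)[of p] cvs.independent_mono[OF left_basis(2) T(1)] by (intro card_le) auto
    then show False using T(3) by linarith
  qed
  define n where "n = card (left_basis p)"
  obtain v y where D: "dual_system p v y n" and v: "v ` {..<n} = left_basis p"
    unfolding n_def by (rule ex_dual_system_list[OF ss p finB left_basis(2,1)])
  interpret D: dual_system p v y n by (rule D)
  define e where "e = D.unit"
  have ev: "e * v j = v j" if "j < n" for j
  proof -
    have "e * v j = (\<Sum>i<n. if i = j then v i * p else 0)"
      unfolding e_def D.unit_eq sum_distrib_right mult.assoc
      by (intro sum.cong refl) (use that in \<open>auto simp: D.dual\<close>)
    then show ?thesis using that by (simp add: D.vp)
  qed
  have eu: "e * u = u" if "u \<in> left_mod p" for u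
  proof -
    have "u \<in> cvs.span (v ` {..<n})" using left_mod_span[OF that] v by simp
    then show ?thesis
      by (induction rule: cvs.span_induct_alt) (auto simp: distrib_left ev)
  qed
  \<comment> \<open>Every \<open>x * v i\<close> lies in \<open>A p\<close>, on which
    \<open>e\<close> acts as the identity.\<close>
  have exe: "e * (x * e) = x * e" for x
  proof -
    have "e * (x * v i) = x * v i" if "i < n" for i
      by (rule eu) (use that D.vp in \<open>simp add: left_mod_def mult.assoc\<close>)
    then have "e * (x * v i * y i) = x * v i * y i" if "i < n" for i
      using that by (metis mult.assoc)
    moreover have "x * e = (\<Sum>i<n. x * v i * y i)"
      by (simp add: e_def D.unit_eq sum_distrib_left mult.assoc)
    ultimately show ?thesis by (simp add: sum_distrib_left)
  qed
  \<comment> \<open>By \<open>exe\<close> the part \<open>(1 - e) * x * e\<close> is zero. The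
    opposite part \<open>?w\<close> then satisfies \<open>?w * z * ?w = 0\<close> for all
    \<open>z\<close>, because \<open>(1 - e) * z * e\<close> occurs in the middle, and semiprimeness
    removes it.\<close>
  have central: "e * x = x * e" for x
  proof -
    let ?w = "e * x * (1 - e)"
    have "?w * z * ?w = e * x * ((z * e) - e * (z * e)) * (x * (1 - e))" for z
      by (simp add: algebra_simps)
    then have "?w * z * ?w = 0" for z by (simp only: exe) simp
    then have "?w = 0" by (rule semisimple_semiprime[OF ss])
    then show ?thesis using exe[of x] by (simp add: algebra_simps)
  qed
  have ep: "e * p = p" by (rule eu) (rule p_left_mod[OF p])
  \<comment> \<open>A nonzero \<open>(1 - e) * a\<close> would generate a minimal idempotent
    \<open>q\<close> with \<open>e * q = 0\<close>. As \<open>e\<close> is central and fixes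
    \<open>p\<close>, the idempotents are orthogonal through every \<open>x\<close>, so each of the
    two operator traces vanishes on the other idempotent.\<close>
  have ea: "e * a = a" if a: "a \<in> soc" for a
  proof (rule ccontr)
    assume ne: "e * a \<noteq> a"
    define d where "d = (1 - e) * a"
    have "d \<in> soc" unfolding d_def by (rule soc_mult_left[OF a])
    moreover have "d \<noteq> 0" using ne by (auto simp: d_def algebra_simps)
    ultimately obtain s t where q: "minimal_idempotent (s * d * t)" by (rule ex_minimal_idempotent[OF ss])
    define q where "q = s * d * t"
    have "e * d = 0" using D.unit_idem by (simp add: d_def algebra_simps e_def flip: mult.assoc)
    moreover have "e * q = s * (e * d) * t" by (simp add: q_def central[of s] flip: mult.assoc)
    ultimately have eq: "e * q = 0" by simp
    have "p * x * q = 0" for x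
    proof -
      have "p * x * e = e * (p * x)" by (rule central[symmetric])
      also have "\<dots> = p * x" by (simp add: ep flip: mult.assoc)
      finally have "p * x * q = p * x * e * q" by simp
      then show ?thesis using eq by (simp add: mult.assoc)
    qed
    moreover have "q * x * p = 0" for x
    proof -
      have "q * x * p = q * x * e * p" by (simp add: ep mult.assoc)
      also have "\<dots> = e * (q * x) * p" by (simp only: central)
      also have "\<dots> = 0" by (simp add: eq flip: mult.assoc)
      finally show ?thesis .
    qed
    ultimately have 0: "op_trace q p = 0" "op_trace p q = 0" by (auto intro: op_trace_eq_0)
    have q: "minimal_idempotent q" using q by (simp add: q_def)
    obtain \<alpha> where \<alpha>: "\<forall>a\<in>soc. op_trace p a = \<alpha> * soc_trace a" using unique[OF lin[OF p] tr[OF p]] by (elim exE)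
    obtain \<beta> where \<beta>: "\<forall>a\<in>soc. op_trace q a = \<beta> * soc_trace a" using unique[OF lin[OF q] tr[OF q]] by (elim exE)
    \<comment> \<open>The first equation makes \<alpha> nonzero, the second then gives
      \<open>soc_trace q = 0\<close>, and the third is violated.\<close>
    have "\<alpha> * soc_trace p = 1" "\<alpha> * soc_trace q = 0" "\<beta> * soc_trace q = 1"
      using \<alpha> \<beta> psoc minimal_idempotent_soc[OF q] 0 op_trace_p[OF p] op_trace_p[OF q] by auto
    then show False by auto
  qed
  have PhiC: "D.Phi (D.coeffs a) = a" if "a \<in> soc" for a
    using D.compress[of a] ea[OF that] central[of a] unfolding e_def[symmetric] by simp
  have "isomorphic_to_matrix_algebra (soc :: 'a set) n"
    unfolding isomorphic_to_matrix_algebra_def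
  proof (intro exI[of _ D.coeffs] conjI ballI allI)
    show "bij_betw D.coeffs soc (carrier_mat n n)"
    proof (rule bij_betw_byWitness[where f' = D.Phi])
      show "D.Phi ` carrier_mat n n \<subseteq> soc"
      proof
        fix z assume "z \<in> D.Phi ` carrier_mat n n"
        then obtain M where "M \<in> carrier_mat n n" "z = D.unit * D.Phi M" using D.unit_mult(1) by auto
        then show "z \<in> soc" using soc_mult_right[OF D.unit_soc] by simp
      qed
    qed (auto simp: PhiC D.coeffs_Phi D.coeffs_carrier)
    fix a b :: 'a
    show "D.coeffs (a + b) = D.coeffs a + D.coeffs b"
      by (rule eq_matI) (auto simp: D.coeffs_def distrib_left distrib_right corner_coeff_add[OF p])
    show "D.coeffs (k *\<^sub>C a) = k \<cdot>\<^sub>m D.coeffs a" for k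
      by (rule eq_matI) (auto simp: D.coeffs_def corner_coeff_scale[OF p])
    assume "a \<in> soc" "b \<in> soc"
    then have "D.Phi (D.coeffs a * D.coeffs b) = a * b"
      by (simp add: D.Phi_times D.coeffs_carrier PhiC)
    then show "D.coeffs (a * b) = D.coeffs a * D.coeffs b"
      using D.coeffs_Phi[of "D.coeffs a * D.coeffs b"] D.coeffs_carrier[of a] D.coeffs_carrier[of b] by simp
  qed
  then show ?thesis by blast
qed

section \<open>Eigenvalues of matrices\<close>

abbreviation linprod :: "complex list \<Rightarrow> complex poly" where
  "linprod es \<equiv> (\<Prod>a\<leftarrow>es. [:- a, 1:])"

abbreviation nz :: "complex list \<Rightarrow> complex list" where
  "nz es \<equiv> filter (\<lambda>a. a \<noteq> 0) es"

lemma linprod_nonzero: "linprod es \<noteq> 0"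
  by (induction es) (auto simp del: mult_pCons_left)

lemma poly_linprod_eq_0: "poly (linprod es) z = 0 \<longleftrightarrow> z \<in> set es"
  by (induction es) (auto simp del: mult_pCons_left)

lemma order_linprod: "Polynomial.order z (linprod es) = count (mset es) z"
proof (induction es)
  case (Cons a es)
  have "Polynomial.order z (linprod (a # es)) = Polynomial.order z [:- a, 1:] + Polynomial.order z (linprod es)"
    using linprod_nonzero[of "a # es"] by (simp add: order_mult del: mult_pCons_left)
  then show ?case using Cons by (simp add: order_linear')
qed (simp add: order_1_eq_0)

lemma linprod_eq_imp_mset_eq: "linprod as = linprod bs \<Longrightarrow> mset as = mset bs"
  by (rule multiset_eqI) (metis order_linprod)

text \<open>All roots with algebraic multiplicity, zeros included, in an unspecified order;
  comparisons therefore go through multisets.\<close>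

definition eigs :: "complex mat \<Rightarrow> complex list" where
  "eigs M = (SOME es. char_poly M = linprod es \<and> length es = dim_row M)"

lemma eigs:
  assumes "M \<in> carrier_mat n n"
  shows "char_poly M = linprod (eigs M)" "length (eigs M) = n"
proof -
  have "\<exists>es. char_poly M = linprod es \<and> length es = dim_row M"
    using char_poly_factorized[OF assms] assms by auto
  from someI_ex[OF this] show "char_poly M = linprod (eigs M)" "length (eigs M) = n"
    unfolding eigs_def using assms by auto
qed

lemma mset_eigs: "M \<in> carrier_mat n n \<Longrightarrow> char_poly M = linprod es \<Longrightarrow> mset (eigs M) = mset es"
  using eigs(1) linprod_eq_imp_mset_eq by metis

lemma set_eigs: "M \<in> carrier_mat n n \<Longrightarrow> set (eigs M) = {z. poly (char_poly M) z = 0}"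
  using eigs(1) poly_linprod_eq_0 by auto

lemma similar_upper_triangular:
  assumes M: "M \<in> carrier_mat n n"
  obtains B P Q where "B \<in> carrier_mat n n" "P \<in> carrier_mat n n" "Q \<in> carrier_mat n n"
    "P * Q = 1\<^sub>m n" "Q * P = 1\<^sub>m n" "M = P * B * Q" "upper_triangular B" "diag_mat B = eigs M"
proof -
  obtain B P Q where "schur_decomposition M (eigs M) = (B, P, Q)" by (cases "schur_decomposition M (eigs M)")
  from schur_decomposition[OF M eigs(1)[OF M] this]
  have "similar_mat_wit M B P Q" "upper_triangular B" "diag_mat B = eigs M" by auto
  with similar_mat_witD2[OF M this(1)] show ?thesis using that by blast
qed

definition mtrace :: "complex mat \<Rightarrow> complex" where
  "mtrace M = (\<Sum>i<dim_row M. M $$ (i, i))"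

lemma mtrace_mult_commute:
  assumes A: "A \<in> carrier_mat n n" and B: "B \<in> carrier_mat n n"
  shows "mtrace (A * B) = mtrace (B * A)"
proof -
  have *: "mtrace (X * Y) = (\<Sum>i<n. \<Sum>j<n. X $$ (i, j) * Y $$ (j, i))"
    if "X \<in> carrier_mat n n" "Y \<in> carrier_mat n n" for X Y
    using that by (simp add: mtrace_def scalar_prod_def atLeast0LessThan)
  show ?thesis unfolding *[OF A B] *[OF B A] by (subst sum.swap) (simp add: mult.commute)
qed

lemma mtrace_eigs:
  assumes M: "M \<in> carrier_mat n n"
  shows "mtrace M = sum_list (eigs M)"
proof -
  obtain B P Q where B: "B \<in> carrier_mat n n" and P: "P \<in> carrier_mat n n" and Q: "Q \<in> carrier_mat n n"
    and QP: "Q * P = 1\<^sub>m n" and M': "M = P * B * Q" and d: "diag_mat B = eigs M"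
    using similar_upper_triangular[OF M] by metis
  have "M = P * (B * Q)" unfolding M' using B P Q by simp
  then have "mtrace M = mtrace (B * Q * P)"
    using mtrace_mult_commute[OF P mult_carrier_mat[OF B Q]] by simp
  also have "B * Q * P = B * (Q * P)" using B P Q by simp
  also have "\<dots> = B" using QP B by simp
  also have "mtrace B = sum_list (diag_mat B)"
    using B by (simp add: mtrace_def diag_mat_def interv_sum_list_conv_sum_set_nat atLeast0LessThan)
  finally show ?thesis using d by simp
qed

section \<open>Dependence of the characteristic polynomial on a parameter\<close>

lemma char_poly_det_expansion:
  assumes M: "M \<in> carrier_mat n n"
  shows "char_poly M = (\<Sum>p | p permutes {0..<n}. signof p *
    (\<Prod>i = 0..<n. (if i = p i then [:0, 1:] else 0) + [:- (M $$ (i, p i)):]))"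
proof -
  have cM: "char_poly_matrix M \<in> carrier_mat n n" using M by simp
  show ?thesis
    unfolding char_poly_def Determinant.det_def'[OF cM]
  proof (intro sum.cong refl arg_cong2[where f = "(*)"] prod.cong)
    fix p i assume "p \<in> {p. p permutes {0..<n}}" "i \<in> {0..<n}"
    then have "i < n" "p i < n" using permutes_in_image[of p "{0..<n}" i] by auto
    then show "char_poly_matrix M $$ (i, p i) = (if i = p i then [:0, 1:] else 0) + [:- (M $$ (i, p i)):]"
      using M by (simp add: char_poly_matrix_def)
  qed
qed

text \<open>A polynomial in two variables, seen as a polynomial whose coefficients depend
  polynomially on the parameter. Its purpose is that a coefficient which is nonzero for one
  parameter vanishes for only finitely many.\<close>

definition poly_family :: "(complex \<Rightarrow> complex poly) \<Rightarrow> bool" where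
  "poly_family f \<longleftrightarrow> (\<forall>j. \<exists>q. \<forall>s. Polynomial.coeff (f s) j = poly q s)"

lemma poly_family_const: "poly_family (\<lambda>_. p)"
  unfolding poly_family_def by (intro allI exI[of _ "[:Polynomial.coeff p _:]"]) simp

lemma poly_family_add: "poly_family f \<Longrightarrow> poly_family g \<Longrightarrow> poly_family (\<lambda>s. f s + g s)"
  unfolding poly_family_def by (metis Polynomial.coeff_add poly_add)

lemma poly_family_sum: "(\<And>i. i \<in> I \<Longrightarrow> poly_family (f i)) \<Longrightarrow> poly_family (\<lambda>s. \<Sum>i\<in>I. f i s)"
  by (induction I rule: infinite_finite_induct) (auto intro: poly_family_const poly_family_add)

lemma poly_family_mult:
  assumes f: "poly_family f" and g: "poly_family g"
  shows "poly_family (\<lambda>s. f s * g s)"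
  unfolding poly_family_def
proof
  fix j
  obtain qf where qf: "\<And>j s. Polynomial.coeff (f s) j = poly (qf j) s" using f unfolding poly_family_def by metis
  obtain qg where qg: "\<And>j s. Polynomial.coeff (g s) j = poly (qg j) s" using g unfolding poly_family_def by metis
  show "\<exists>q. \<forall>s. Polynomial.coeff (f s * g s) j = poly q s"
    by (rule exI[of _ "\<Sum>i\<le>j. qf i * qg (j - i)"]) (simp add: coeff_mult qf qg poly_sum)
qed

lemma poly_family_prod: "(\<And>i. i \<in> I \<Longrightarrow> poly_family (f i)) \<Longrightarrow> poly_family (\<lambda>s. \<Prod>i\<in>I. f i s)"
  by (induction I rule: infinite_finite_induct) (auto intro: poly_family_const poly_family_mult)

lemma poly_family_linear: "poly_family (\<lambda>s. [:- (a + s * c):])"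
  unfolding poly_family_def
proof
  fix j
  show "\<exists>q. \<forall>s. Polynomial.coeff [:- (a + s * c):] j = poly q s"
    by (rule exI[of _ "if j = 0 then [:- a, - c:] else 0"]) (cases j, auto)
qed

lemma poly_family_char_poly:
  assumes A: "A \<in> carrier_mat n n" and C: "C \<in> carrier_mat n n"
  shows "poly_family (\<lambda>s. char_poly (A + s \<cdot>\<^sub>m C))"
proof -
  have "char_poly (A + s \<cdot>\<^sub>m C) = (\<Sum>p | p permutes {0..<n}. signof p *
    (\<Prod>i = 0..<n. (if i = p i then [:0, 1:] else 0) + [:- (A $$ (i, p i) + s * C $$ (i, p i)):]))" for s
  proof -
    have "A + s \<cdot>\<^sub>m C \<in> carrier_mat n n" using A C by simp
    then show ?thesis unfolding char_poly_det_expansion[OF \<open>A + s \<cdot>\<^sub>m C \<in> carrier_mat n n\<close>]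
    proof (intro sum.cong refl arg_cong2[where f = "(*)"] prod.cong)
      fix p i assume "p \<in> {p. p permutes {0..<n}}" "i \<in> {0..<n}"
      then have "i < n" "p i < n" using permutes_in_image[of p "{0..<n}" i] by auto
      then show "(if i = p i then [:0, 1:] else 0) + [:- ((A + s \<cdot>\<^sub>m C) $$ (i, p i)):]
        = (if i = p i then [:0, 1:] else 0) + [:- (A $$ (i, p i) + s * C $$ (i, p i)):]"
        using A C by simp
    qed
  qed
  then show ?thesis
    by (simp only:) (intro poly_family_sum poly_family_mult poly_family_const poly_family_prod poly_family_add poly_family_linear)
qed

text \<open>The difference of the lengths is the multiplicity of the root 0, which is the index of
  the lowest nonvanishing coefficient.\<close>

lemma coeff_linprod:
  "j < length es - length (nz es) \<Longrightarrow> Polynomial.coeff (linprod es) j = 0"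
  "Polynomial.coeff (linprod es) (length es - length (nz es)) \<noteq> 0"
proof (induction es arbitrary: j)
  case (Cons a es)
  have le: "length (nz es) \<le> length es" by simp
  let ?z = "length es - length (nz es)"
  { case 1
    then show ?case
      using Cons(1) le by (cases "a = 0"; cases j) (auto simp: coeff_pCons Suc_diff_le split: nat.splits)
  next
    case 2
    show ?case
    proof (cases "a = 0")
      case True
      then show ?thesis using Cons(2) le by (simp add: coeff_pCons Suc_diff_le)
    next
      case False
      have "Polynomial.coeff (pCons 0 (linprod es)) ?z = 0"
        using Cons(1)[of "?z - 1"] by (cases ?z) (auto simp: coeff_pCons)
      then show ?thesis using False Cons(2) by simp
    qed
  }
qed auto

lemma length_nz_ge:
  assumes "Polynomial.coeff (linprod es) (length es - K) \<noteq> 0" "K \<le> length es"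
  shows "K \<le> length (nz es)"
proof (rule ccontr)
  assume "\<not> K \<le> length (nz es)"
  moreover have "length (nz es) \<le> length es" by simp
  ultimately have "length es - K < length es - length (nz es)" using assms(2) by linarith
  then show False using coeff_linprod(1)[of "length es - K" es] assms by simp
qed

text \<open>On the line through \<open>A\<close> and \<open>A1\<close>, the coefficient of index
  \<open>n - ?K\<close> of the characteristic polynomial is a polynomial in \<open>s\<close> that is
  nonzero at 1, where the line meets \<open>A1\<close>. Wherever it is nonzero, at least
  \<open>?K\<close> eigenvalues are nonzero.\<close>

lemma finite_line_drop_nz:
  assumes A: "A \<in> carrier_mat n n" and A1: "A1 \<in> carrier_mat n n"
  shows "finite {s. length (nz (eigs (A + s \<cdot>\<^sub>m (A1 - A)))) < length (nz (eigs A1))}"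
proof -
  let ?C = "A1 - A" and ?K = "length (nz (eigs A1))"
  have C: "?C \<in> carrier_mat n n" by (rule minus_carrier_mat[OF A])
  obtain q where q: "\<And>s. Polynomial.coeff (char_poly (A + s \<cdot>\<^sub>m ?C)) (n - ?K) = poly q s"
    using poly_family_char_poly[OF A C] unfolding poly_family_def by metis
  have "A + 1 \<cdot>\<^sub>m ?C = A1" by (rule eq_matI) (use A A1 in auto)
  then have "poly q 1 = Polynomial.coeff (linprod (eigs A1)) (n - ?K)" using q[of 1] eigs[OF A1] by simp
  then have "q \<noteq> 0" using coeff_linprod(2)[of "eigs A1"] eigs(2)[OF A1] by auto
  have K: "?K \<le> n" using eigs(2)[OF A1] length_filter_le[of _ "eigs A1"] by simp
  have "?K \<le> length (nz (eigs (A + s \<cdot>\<^sub>m ?C)))" if "poly q s \<noteq> 0" for s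
  proof -
    have M: "A + s \<cdot>\<^sub>m ?C \<in> carrier_mat n n" using A C by simp
    show ?thesis
      by (rule length_nz_ge) (use that q[of s] eigs[OF M] K in auto)
  qed
  then have "{s. length (nz (eigs (A + s \<cdot>\<^sub>m ?C))) < ?K} \<subseteq> {s. poly q s = 0}"
    by (auto simp: not_less[symmetric])
  then show ?thesis using poly_roots_finite[OF \<open>q \<noteq> 0\<close>] finite_subset by blast
qed

lemma distinct_nzI:
  assumes "\<And>i j. i < j \<Longrightarrow> j < length xs \<Longrightarrow> xs ! i \<noteq> 0 \<Longrightarrow> xs ! i \<noteq> xs ! j"
  shows "distinct (nz xs)"
  using assms
proof (induction xs)
  case (Cons a xs)
  have "distinct (nz xs)"
  proof (rule Cons.IH)
    fix i j assume "i < j" "j < length xs" "xs ! i \<noteq> 0"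
    then show "xs ! i \<noteq> xs ! j" using Cons.prems[of "Suc i" "Suc j"] by simp
  qed
  moreover have "a \<notin> set xs" if "a \<noteq> 0"
  proof
    assume "a \<in> set xs"
    then obtain j where "j < length xs" "xs ! j = a" by (auto simp: in_set_conv_nth)
    then show False using Cons.prems[of 0 "Suc j"] that by simp
  qed
  ultimately show ?case by auto
qed simp

text \<open>In triangular form, multiply by the diagonal matrix with entries \<open>1 + s * i\<close> for a small generic \<open>s\<close>.\<close>

lemma ex_perturbation_distinct:
  assumes M: "M \<in> carrier_mat n n" and "\<delta> > 0"
  obtains Y where "Y \<in> carrier_mat n n"
    "\<forall>i<n. \<forall>j<n. cmod ((Y - 1\<^sub>m n) $$ (i, j)) < \<delta>"
    "distinct (nz (eigs (Y * M)))" "length (nz (eigs (Y * M))) = length (nz (eigs M))"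
proof -
  obtain B P Q where B: "B \<in> carrier_mat n n" and P: "P \<in> carrier_mat n n" and Q: "Q \<in> carrier_mat n n"
    and PQ: "P * Q = 1\<^sub>m n" and QP: "Q * P = 1\<^sub>m n" and MB: "M = P * B * Q"
    and ut: "upper_triangular B" and diag: "diag_mat B = eigs M"
    using similar_upper_triangular[OF M] by metis
  define E where "E = mat n n (\<lambda>(i, j). if i = j then complex_of_nat i else 0)"
  define W where "W = P * E * Q"
  have E: "E \<in> carrier_mat n n" and W: "W \<in> carrier_mat n n" using P Q by (auto simp: E_def W_def)
  define a where "a i = B $$ (i, i)" for i
  have em: "eigs M = map a [0..<n]" using diag B by (simp add: diag_mat_def a_def[abs_def])
  define C where "C = 1 + (\<Sum>i<n. \<Sum>j<n. cmod (W $$ (i, j)))"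
  have "C > 0" unfolding C_def by (intro add_pos_nonneg sum_nonneg) auto
  have WC: "cmod (W $$ (i, j)) < C" if "i < n" "j < n" for i j
  proof -
    have "cmod (W $$ (i, j)) \<le> (\<Sum>j<n. cmod (W $$ (i, j)))"
      using that by (intro member_le_sum) auto
    also have "\<dots> \<le> (\<Sum>i<n. \<Sum>j<n. cmod (W $$ (i, j)))"
      using that by (intro member_le_sum[of i _ "\<lambda>i. \<Sum>j<n. cmod (W $$ (i, j))"] sum_nonneg) auto
    finally show ?thesis by (simp add: C_def)
  qed
  \<comment> \<open>The parameters at which \<open>(1 + s * i) * a i\<close> meets
    \<open>(1 + s * j) * a j\<close>. If both coefficients were zero, \<open>a i = a j\<close> and
    \<open>i * a i = j * a j\<close> would contradict \<open>i \<noteq> j\<close> and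
    \<open>a i \<noteq> 0\<close>.\<close>
  define bad where "bad = (\<Union>(i, j) \<in> {(i, j). i < n \<and> j < n \<and> i \<noteq> j \<and> a i \<noteq> 0}.
    {s. poly [:a i - a j, of_nat i * a i - of_nat j * a j:] s = 0})"
  have "finite bad" unfolding bad_def
  proof (rule finite_UN_I)
    show "finite {(i, j). i < n \<and> j < n \<and> i \<noteq> j \<and> a i \<noteq> 0}"
      by (rule finite_subset[of _ "{..<n} \<times> {..<n}"]) auto
    fix ij assume "ij \<in> {(i, j). i < n \<and> j < n \<and> i \<noteq> j \<and> a i \<noteq> 0}"
    then obtain i j where ij: "ij = (i, j)" "i \<noteq> j" "a i \<noteq> 0" by blast
    have "[:a i - a j, of_nat i * a i - of_nat j * a j:] \<noteq> 0" using ij by auto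
    from poly_roots_finite[OF this]
    show "finite (case ij of (i, j) \<Rightarrow> {s. poly [:a i - a j, of_nat i * a i - of_nat j * a j:] s = 0})"
      using ij(1) by simp
  qed
  \<comment> \<open>With \<open>s\<close> real and positive no factor \<open>1 + s * i\<close>
    vanishes, so no nonzero eigenvalue is lost; the bound \<open>\<delta> / C\<close> keeps the
    entries of \<open>s \<cdot>\<^sub>m W\<close> below \<delta>.\<close>
  moreover have "infinite (complex_of_real ` {0<..<\<delta> / C})"
    using \<open>\<delta> > 0\<close> \<open>C > 0\<close> by (subst finite_image_iff) (auto simp: inj_on_def infinite_Ioo)
  ultimately obtain s where "s \<in> complex_of_real ` {0<..<\<delta> / C}" "s \<notin> bad"
    by (meson finite_subset subsetI)
  then obtain t where t: "0 < t" "t < \<delta> / C" "s = complex_of_real t" and sb: "s \<notin> bad" by auto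
  define D where "D = 1\<^sub>m n + s \<cdot>\<^sub>m E"
  define Y where "Y = P * D * Q"
  have D: "D \<in> carrier_mat n n" and Y: "Y \<in> carrier_mat n n" using E P Q by (auto simp: D_def Y_def)
  have "P * D = P * 1\<^sub>m n + P * (s \<cdot>\<^sub>m E)"
    unfolding D_def using P E by (intro mult_add_distrib_mat) auto
  then have "P * D = P + s \<cdot>\<^sub>m (P * E)" using P E by (simp add: mult_smult_distrib)
  then have "Y = P * Q + s \<cdot>\<^sub>m (P * E) * Q"
    unfolding Y_def using P E Q by (simp add: add_mult_distrib_mat[of P n n])
  also have "s \<cdot>\<^sub>m (P * E) * Q = s \<cdot>\<^sub>m W"
    unfolding W_def using P E Q by (intro mult_smult_assoc_mat) auto
  finally have "Y = P * Q + s \<cdot>\<^sub>m W" .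
  then have "Y - 1\<^sub>m n = s \<cdot>\<^sub>m W" using W by (intro eq_matI) (auto simp: PQ)
  then have small: "cmod ((Y - 1\<^sub>m n) $$ (i, j)) < \<delta>" if "i < n" "j < n" for i j
  proof -
    have "cmod ((Y - 1\<^sub>m n) $$ (i, j)) = t * cmod (W $$ (i, j))"
      using \<open>Y - 1\<^sub>m n = s \<cdot>\<^sub>m W\<close> that W t by (simp add: norm_mult)
    also have "\<dots> < t * C" using WC[OF that] t by simp
    also have "\<dots> < \<delta>" using t \<open>C > 0\<close> by (simp add: field_simps)
    finally show ?thesis .
  qed
  have DB: "(D * B) $$ (i, j) = (1 + s * of_nat i) * B $$ (i, j)" if "i < n" "j < n" for i j
  proof -
    have "(D * B) $$ (i, j) = (\<Sum>k<n. D $$ (i, k) * B $$ (k, j))"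
      using that D B by (simp add: scalar_prod_def atLeast0LessThan)
    also have "\<dots> = (\<Sum>k<n. if k = i then (1 + s * of_nat i) * B $$ (k, j) else 0)"
      using that by (intro sum.cong) (auto simp: D_def E_def)
    finally show ?thesis using that by simp
  qed
  have DBc: "D * B \<in> carrier_mat n n" using D B by simp
  have YM: "Y * M \<in> carrier_mat n n" using Y M by simp
  have "Y * M = P * (D * B) * Q"
  proof -
    have "Y * M = P * D * (Q * P) * B * Q"
      unfolding Y_def MB using P D Q B by (simp add: assoc_mult_mat[of _ n n _ n _ n])
    then show ?thesis unfolding QP using P D Q B by (simp add: assoc_mult_mat[of _ n n _ n _ n])
  qed
  then have "similar_mat_wit (Y * M) (D * B) P Q"
    unfolding similar_mat_wit_def Let_def using YM DBc P Q PQ QP by auto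
  then have "char_poly (Y * M) = char_poly (D * B)" by (intro char_poly_similar) (auto simp: similar_mat_def)
  also have "\<dots> = linprod (diag_mat (D * B))"
  proof (rule char_poly_upper_triangular[OF DBc])
    show "upper_triangular (D * B)"
    proof (rule upper_triangularI)
      fix i j assume "j < i" "i < dim_row (D * B)"
      then have "i < n" "j < n" using carrier_matD(1)[OF DBc] by auto
      then show "(D * B) $$ (i, j) = 0"
        unfolding DB[OF \<open>i < n\<close> \<open>j < n\<close>] using upper_triangularD[OF ut \<open>j < i\<close>] B by simp
    qed
  qed
  finally have ms: "mset (eigs (Y * M)) = mset (diag_mat (D * B))" by (rule mset_eigs[OF YM])
  define ds where "ds = map (\<lambda>i. (1 + s * of_nat i) * a i) [0..<n]"
  have "diag_mat (D * B) = ds"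
    using DBc DB by (auto simp: diag_mat_def ds_def a_def)
  with ms have ms: "mset (eigs (Y * M)) = mset ds" by simp
  have pos: "1 + s * of_nat i \<noteq> 0" for i
  proof
    assume "1 + s * of_nat i = 0"
    then have "Re (1 + s * of_nat i) = 0" by simp
    then have "1 + t * real i = 0" by (simp add: t)
    then show False using t(1) by (smt (verit) mult_nonneg_nonneg of_nat_0_le_iff)
  qed
  have "distinct (nz ds)"
  proof (rule distinct_nzI)
    fix i j assume ij: "i < j" "j < length ds" "ds ! i \<noteq> 0"
    then have n: "i < n" "j < n" by (auto simp: ds_def)
    have "a i \<noteq> 0" using ij n by (auto simp: ds_def)
    then have "poly [:a i - a j, of_nat i * a i - of_nat j * a j:] s \<noteq> 0"
      using sb ij n unfolding bad_def by fastforce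
    then show "ds ! i \<noteq> ds ! j" using n by (auto simp: ds_def algebra_simps)
  qed
  moreover have "length (nz ds) = length (nz (eigs M))"
    using pos by (simp add: em ds_def filter_map o_def)
  moreover have "mset (nz (eigs (Y * M))) = mset (nz ds)" using ms by (simp add: mset_filter)
  ultimately have "distinct (nz (eigs (Y * M)))" "length (nz (eigs (Y * M))) = length (nz (eigs M))"
    by (metis mset_eq_imp_distinct_iff, metis mset_eq_length)
  then show ?thesis using that Y small by blast
qed

section \<open>Continuity of the roots of a polynomial\<close>

lemma ex_common_convergent_subsequence:
  fixes x :: "nat \<Rightarrow> nat \<Rightarrow> complex"
  assumes "\<And>k i. i < n \<Longrightarrow> x k i \<in> cball 0 R"
  shows "\<exists>g \<mu>. strict_mono g \<and> (\<forall>i<n. (\<lambda>k. x (g k) i) \<longlonglongrightarrow> \<mu> i)"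
  using assms
proof (induction n)
  case 0
  show ?case by (rule exI[of _ id]) (auto simp: strict_mono_def)
next
  case (Suc n)
  then obtain g \<mu> where g: "strict_mono (g :: nat \<Rightarrow> nat)" and \<mu>: "\<And>i. i < n \<Longrightarrow> (\<lambda>k. x (g k) i) \<longlonglongrightarrow> \<mu> i"
    by fastforce
  have "\<forall>k. x (g k) n \<in> cball 0 R" using Suc by simp
  then obtain l h where h: "strict_mono (h :: nat \<Rightarrow> nat)" and l: "((\<lambda>k. x (g k) n) \<circ> h) \<longlonglongrightarrow> l"
    using compact_cball[of "0::complex" R] unfolding compact_def by metis
  have "strict_mono (g \<circ> h)" using g h by (rule strict_mono_o)
  moreover have "(\<lambda>k. x ((g \<circ> h) k) i) \<longlonglongrightarrow> (\<mu>(n := l)) i" if "i < Suc n" for i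
  proof (cases "i = n")
    case True
    then show ?thesis using l by (simp add: o_def)
  next
    case False
    then have "i < n" using that by simp
    from LIMSEQ_subseq_LIMSEQ[OF \<mu>[OF this] h] show ?thesis using False by (simp add: o_def)
  qed
  ultimately show ?case by blast
qed

lemma count_mset_eq_card: "count (mset xs) c = card {i. i < length xs \<and> xs ! i = c}"
proof -
  have "count (mset xs) c = length (filter (\<lambda>y. y = c) xs)"
    by (induction xs) auto
  then show ?thesis by (simp add: length_filter_conv_card)
qed

text \<open>A compactness argument: if the count were wrong infinitely often, a subsequence of root
  lists would converge entrywise. The limit list has the same product, hence the same multiset, as
  \<open>as\<close>. Each entry is eventually inside the ball if its limit is \<open>c\<close>, and
  outside otherwise because the closed disk contains no other limit.\<close>

lemma eventually_root_count:
  fixes es :: "nat \<Rightarrow> complex list"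
  assumes len: "\<And>k. length (es k) = n" and bound: "\<And>k. set (es k) \<subseteq> cball 0 R"
    and conv: "\<And>z. (\<lambda>k. poly (linprod (es k)) z) \<longlonglongrightarrow> poly (linprod as) z"
    and "r > 0" and iso: "cball c r \<inter> set as \<subseteq> {c}"
  shows "\<forall>\<^sub>F k in sequentially. length (filter (\<lambda>a. a \<in> ball c r) (es k)) = count (mset as) c"
proof (rule ccontr)
  assume "\<not> ?thesis"
  then have "\<exists>\<^sub>F k in sequentially. length (filter (\<lambda>a. a \<in> ball c r) (es k)) \<noteq> count (mset as) c"
    by (simp add: not_eventually)
  then have "infinite {k. length (filter (\<lambda>a. a \<in> ball c r) (es k)) \<noteq> count (mset as) c}"
    using frequently_cofinite cofinite_eq_sequentially by metis
  from infinite_enumerate[OF this] obtain h where h: "strict_mono (h :: nat \<Rightarrow> nat)"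
    "\<And>k. length (filter (\<lambda>a. a \<in> ball c r) (es (h k))) \<noteq> count (mset as) c" by auto
  have "es (h k) ! i \<in> cball 0 R" if "i < n" for k i
  proof -
    have "es (h k) ! i \<in> set (es (h k))" using that len by (intro nth_mem) simp
    then show ?thesis using bound by blast
  qed
  from ex_common_convergent_subsequence[of n "\<lambda>k i. es (h k) ! i" R, OF this]
  obtain g \<mu> where g: "strict_mono (g :: nat \<Rightarrow> nat)"
    and \<mu>: "\<And>i. i < n \<Longrightarrow> (\<lambda>k. es (h (g k)) ! i) \<longlonglongrightarrow> \<mu> i" by blast
  define ms where "ms = map \<mu> [0..<n]"
  have pl: "poly (linprod xs) z = (\<Prod>i<n. z - xs ! i)" if "length xs = n" for xs z
    using that by (simp add: poly_prod prod.list_conv_set_nth atLeast0LessThan)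
  have "poly (linprod as) z = poly (linprod ms) z" for z
  proof (rule LIMSEQ_unique)
    have "strict_mono (h \<circ> g)" using h(1) g by (rule strict_mono_o)
    from LIMSEQ_subseq_LIMSEQ[OF conv[of z] this]
    show "(\<lambda>k. poly (linprod (es (h (g k)))) z) \<longlonglongrightarrow> poly (linprod as) z" by (simp add: o_def)
    show "(\<lambda>k. poly (linprod (es (h (g k)))) z) \<longlonglongrightarrow> poly (linprod ms) z"
      unfolding pl[OF len] using \<mu> by (subst pl) (auto simp: ms_def intro!: tendsto_intros)
  qed
  then have mm: "mset as = mset ms"
    by (intro linprod_eq_imp_mset_eq) (simp add: poly_eq_poly_eq_iff[symmetric] fun_eq_iff)
  have "\<forall>\<^sub>F k in sequentially. \<forall>i\<in>{..<n}. es (h (g k)) ! i \<in> ball c r \<longleftrightarrow> \<mu> i = c"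
  proof (rule eventually_ball_finite)
    show "\<forall>i\<in>{..<n}. \<forall>\<^sub>F k in sequentially. es (h (g k)) ! i \<in> ball c r \<longleftrightarrow> \<mu> i = c"
    proof
      fix i assume "i \<in> {..<n}"
      then have i: "i < n" by simp
      show "\<forall>\<^sub>F k in sequentially. es (h (g k)) ! i \<in> ball c r \<longleftrightarrow> \<mu> i = c"
      proof (cases "\<mu> i = c")
        case True
        have "\<forall>\<^sub>F k in sequentially. es (h (g k)) ! i \<in> ball c r"
          by (rule topological_tendstoD[OF \<mu>[OF i]]) (use True \<open>r > 0\<close> in auto)
        then show ?thesis using True by simp
      next
        case False
        have "\<mu> i \<in> set as" using i mset_eq_setD[OF mm] by (auto simp: ms_def)
        then have "\<mu> i \<in> - cball c r" using iso False by auto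
        then have "\<forall>\<^sub>F k in sequentially. es (h (g k)) ! i \<in> - cball c r"
          by (intro topological_tendstoD[OF \<mu>[OF i]]) auto
        then show ?thesis by eventually_elim (use False in auto)
      qed
    qed
  qed simp
  then obtain k where k: "\<And>i. i < n \<Longrightarrow> es (h (g k)) ! i \<in> ball c r \<longleftrightarrow> \<mu> i = c"
    by (auto simp: eventually_sequentially)
  have "length (filter (\<lambda>a. a \<in> ball c r) (es (h (g k)))) = card {i. i < n \<and> es (h (g k)) ! i \<in> ball c r}"
    by (simp add: length_filter_conv_card len)
  also have "{i. i < n \<and> es (h (g k)) ! i \<in> ball c r} = {i. i < length ms \<and> ms ! i = c}"
    using k by (auto simp: ms_def)
  also have "card \<dots> = count (mset as) c" by (simp add: count_mset_eq_card mm)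
  finally show False using h(2) by blast
qed

section \<open>A socle isomorphic to a matrix algebra\<close>

lemma norm_nonzero_spectrum_le:
  fixes y :: "'a::complex_banach_algebra_1"
  assumes "\<mu> \<in> nonzero_spectrum y"
  shows "cmod \<mu> \<le> norm y"
proof (rule ccontr)
  assume "\<not> cmod \<mu> \<le> norm y"
  define x where "x = inverse \<mu> *\<^sub>C y"
  have "\<mu> \<noteq> 0" using assms by (simp add: nonzero_spectrum_def)
  have x: "norm x < 1" using \<open>\<not> cmod \<mu> \<le> norm y\<close> \<open>\<mu> \<noteq> 0\<close>
    by (simp add: x_def norm_scaleC norm_inverse norm_divide divide_simps)
  \<comment> \<open>The comparison omits the zeroth power, where \<open>norm 1\<close> could exceed
    1.\<close>
  have "summable (\<lambda>n. norm x ^ Suc n)"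
    unfolding summable_Suc_iff using x by (intro summable_geometric) simp
  then have "summable (\<lambda>n. norm (x ^ Suc n))"
    by (rule summable_comparison_test'[of _ 0]) (use norm_power_Suc_le[of x] in simp)
  then have s: "summable (\<lambda>n. norm (x ^ n))" by (subst summable_Suc_iff[symmetric])
  note s' = summable_norm_cancel[OF s]
  have "(\<Sum>n. x ^ n) * (1 - x) = 1" by (rule commute_geometric[OF s])
  moreover have "x * (\<Sum>n. x ^ n) = (\<Sum>n. x ^ n) * x"
    by (simp add: suminf_mult[OF s', symmetric] suminf_mult2[OF s'] power_commutes)
  ultimately have "(\<Sum>n. x ^ n) * (1 - x) = 1" "(1 - x) * (\<Sum>n. x ^ n) = 1"
    by (simp_all add: algebra_simps)
  then have "alg_invertible (1 - x)" by (intro alg_invertibleI)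
  then show False using assms by (simp add: nonzero_spectrum_iff x_def)
qed

definition mat_unit :: "nat \<Rightarrow> nat \<times> nat \<Rightarrow> complex mat" where
  "mat_unit n ij = mat n n (\<lambda>kl. if kl = ij then 1 else 0)"

lemma mat_unit_carrier [simp]: "mat_unit n ij \<in> carrier_mat n n"
  by (simp add: mat_unit_def)

lemma mat_unit_index: "k < n \<Longrightarrow> l < n \<Longrightarrow> mat_unit n ij $$ (k, l) = (if (k, l) = ij then 1 else 0)"
  by (simp add: mat_unit_def)

lemma mat_unit_mult:
  assumes "i < n" "j < n" "k < n" "l < n"
  shows "mat_unit n (i, j) * mat_unit n (k, l) = (if j = k then mat_unit n (i, l) else 0\<^sub>m n n)"
proof (rule eq_matI)
  fix r s assume "r < dim_row (if j = k then mat_unit n (i, l) else 0\<^sub>m n n)"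
    "s < dim_col (if j = k then mat_unit n (i, l) else 0\<^sub>m n n)"
  then have rs: "r < n" "s < n" by (auto simp: mat_unit_def split: if_splits)
  have "(mat_unit n (i, j) * mat_unit n (k, l)) $$ (r, s) = (\<Sum>t<n. mat_unit n (i, j) $$ (r, t) * mat_unit n (k, l) $$ (t, s))"
    using rs mat_unit_carrier by (simp add: scalar_prod_def atLeast0LessThan mat_unit_def)
  also have "\<dots> = (\<Sum>t<n. if t = j then (if r = i \<and> j = k \<and> s = l then 1 else 0) else 0)"
    using rs by (intro sum.cong) (auto simp: mat_unit_def)
  also have "\<dots> = (if j = k then mat_unit n (i, l) else 0\<^sub>m n n) $$ (r, s)"
    using rs assms by (auto simp: mat_unit_def)
  finally show "(mat_unit n (i, j) * mat_unit n (k, l)) $$ (r, s) = (if j = k then mat_unit n (i, l) else 0\<^sub>m n n) $$ (r, s)" .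
qed (auto simp: mat_unit_def)

lemma mat_unit_compress:
  assumes M: "M \<in> carrier_mat n n" and ij: "i < n" "j < n"
  shows "mat_unit n (i, i) * M * mat_unit n (j, j) = M $$ (i, j) \<cdot>\<^sub>m mat_unit n (i, j)"
proof (rule eq_matI)
  fix r s assume "r < dim_row (M $$ (i, j) \<cdot>\<^sub>m mat_unit n (i, j))" "s < dim_col (M $$ (i, j) \<cdot>\<^sub>m mat_unit n (i, j))"
  then have rs: "r < n" "s < n" by (auto simp: mat_unit_def)
  have 1: "(mat_unit n (i, i) * M) $$ (r, t) = (if r = i then M $$ (i, t) else 0)" if "t < n" for t
  proof -
    have "(mat_unit n (i, i) * M) $$ (r, t) = (\<Sum>u<n. mat_unit n (i, i) $$ (r, u) * M $$ (u, t))"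
      using M rs that by (simp add: scalar_prod_def atLeast0LessThan mat_unit_def)
    also have "\<dots> = (\<Sum>u<n. if u = i then (if r = i then M $$ (i, t) else 0) else 0)"
      using rs by (intro sum.cong) (auto simp: mat_unit_def)
    finally show ?thesis using ij by simp
  qed
  have "(mat_unit n (i, i) * M * mat_unit n (j, j)) $$ (r, s)
    = (\<Sum>t<n. (mat_unit n (i, i) * M) $$ (r, t) * mat_unit n (j, j) $$ (t, s))"
    using M rs by (simp add: scalar_prod_def atLeast0LessThan mat_unit_def)
  also have "\<dots> = (\<Sum>t<n. if t = j then (if r = i \<and> s = j then M $$ (i, j) else 0) else 0)"
    using rs by (intro sum.cong) (auto simp: 1 mat_unit_index)
  finally show "(mat_unit n (i, i) * M * mat_unit n (j, j)) $$ (r, s) = (M $$ (i, j) \<cdot>\<^sub>m mat_unit n (i, j)) $$ (r, s)"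
    using rs ij by (simp add: mat_unit_def)
qed (use M in \<open>auto simp: mat_unit_def\<close>)

locale soc_matrix_iso =
  fixes \<phi> :: "'a::complex_banach_algebra_1 \<Rightarrow> complex mat" and n :: nat
  assumes bij: "bij_betw \<phi> soc (carrier_mat n n)"
    and phi_add: "a \<in> soc \<Longrightarrow> b \<in> soc \<Longrightarrow> \<phi> (a + b) = \<phi> a + \<phi> b"
    and phi_mult: "a \<in> soc \<Longrightarrow> b \<in> soc \<Longrightarrow> \<phi> (a * b) = \<phi> a * \<phi> b"
    and phi_scale: "a \<in> soc \<Longrightarrow> \<phi> (c *\<^sub>C a) = c \<cdot>\<^sub>m \<phi> a"
begin

definition \<Phi> :: "complex mat \<Rightarrow> 'a" where "\<Phi> = inv_into soc \<phi>"

lemma phi_carrier: "a \<in> soc \<Longrightarrow> \<phi> a \<in> carrier_mat n n"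
  using bij by (auto simp: bij_betw_def)

lemma Phi_phi: "a \<in> soc \<Longrightarrow> \<Phi> (\<phi> a) = a"
  unfolding \<Phi>_def using bij_betw_inv_into_left[OF bij] .

lemma phi_Phi: "M \<in> carrier_mat n n \<Longrightarrow> \<phi> (\<Phi> M) = M"
  unfolding \<Phi>_def using bij_betw_inv_into_right[OF bij] .

lemma Phi_soc: "M \<in> carrier_mat n n \<Longrightarrow> \<Phi> M \<in> soc"
  unfolding \<Phi>_def using bij by (auto simp: bij_betw_def inv_into_into)

lemma phi_inj: "a \<in> soc \<Longrightarrow> b \<in> soc \<Longrightarrow> \<phi> a = \<phi> b \<Longrightarrow> a = b"
  by (metis Phi_phi)

definition e :: 'a where "e = \<Phi> (1\<^sub>m n)"

lemma e_soc: "e \<in> soc"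
  by (simp add: e_def Phi_soc)

lemma e_left: "a \<in> soc \<Longrightarrow> e * a = a"
  using phi_carrier[of a]
  by (intro phi_inj) (simp_all add: soc_mult_left phi_mult e_soc e_def phi_Phi Phi_soc)

text \<open>For a socle defined by spectral rank, closure under sums is not immediate. Here it
  follows from \<open>a + b = e * (a + b)\<close>, since \<open>e\<close> lies in the socle.\<close>

lemma soc_add: "a \<in> soc \<Longrightarrow> b \<in> soc \<Longrightarrow> a + b \<in> soc" for a b :: 'a
  using soc_mult_right[OF e_soc, of "a + b"] by (simp add: distrib_left e_left)

lemma soc_scale: "a \<in> soc \<Longrightarrow> c *\<^sub>C a \<in> soc" for a :: 'a
  using soc_mult_left[of a "c *\<^sub>C 1"] by simp

lemma Phi_eqI: "a \<in> soc \<Longrightarrow> \<phi> a = M \<Longrightarrow> \<Phi> M = a"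
  using Phi_phi by blast

sublocale matrix_units_hom \<Phi> n
proof
  fix M N :: "complex mat" assume M: "M \<in> carrier_mat n n" and N: "N \<in> carrier_mat n n"
  show "\<Phi> (M + N) = \<Phi> M + \<Phi> N"
    using M N by (intro Phi_eqI soc_add) (simp_all add: Phi_soc phi_add phi_Phi)
  show "\<Phi> (M * N) = \<Phi> M * \<Phi> N"
    using M N by (intro Phi_eqI soc_mult_left) (simp_all add: Phi_soc phi_mult phi_Phi)
next
  fix M :: "complex mat" and c assume M: "M \<in> carrier_mat n n"
  show "\<Phi> (c \<cdot>\<^sub>m M) = c *\<^sub>C \<Phi> M"
    using M by (intro Phi_eqI soc_scale) (simp_all add: Phi_soc phi_scale phi_Phi)
  show "M = 0\<^sub>m n n" if "\<Phi> M = 0"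
  proof -
    have "\<phi> 0 = 0 \<cdot>\<^sub>m \<phi> 0" using phi_scale[OF zero_soc, of 0] by simp
    also have "\<dots> = 0\<^sub>m n n" using phi_carrier[OF zero_soc] by (intro eq_matI) auto
    finally show ?thesis using phi_Phi[OF M] that by simp
  qed
qed

lemma phi_0: "\<phi> 0 = 0\<^sub>m n n"
  using phi_Phi[of "0\<^sub>m n n"] by (simp add: Phi_0)

lemma phi_mult_carrier: "a \<in> soc \<Longrightarrow> \<phi> (x * a) \<in> carrier_mat n n"
  by (intro phi_carrier soc_mult_left)

lemma phi_diff: "a \<in> soc \<Longrightarrow> b \<in> soc \<Longrightarrow> \<phi> (a - b) = \<phi> a - \<phi> b"
proof -
  assume a: "a \<in> soc" and b: "b \<in> soc"
  have "a - b = a + (- 1) *\<^sub>C b" by simp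
  then have "\<phi> (a - b) = \<phi> a + (- 1) \<cdot>\<^sub>m \<phi> b"
    by (simp only: phi_add[OF a soc_scale[OF b]] phi_scale[OF b])
  then show ?thesis using phi_carrier[OF a] phi_carrier[OF b] by (intro eq_matI) auto
qed

lemma phi_sum_entry:
  assumes "finite I" "\<And>i. i \<in> I \<Longrightarrow> g i \<in> soc" "k < n" "l < n"
  shows "sum g I \<in> soc \<and> \<phi> (sum g I) $$ (k, l) = (\<Sum>i\<in>I. \<phi> (g i) $$ (k, l))"
  using assms
proof (induction I)
  case empty
  then show ?case by (simp add: zero_soc phi_0)
next
  case (insert i I)
  then have g: "g i \<in> soc" "sum g I \<in> soc" by auto
  show ?case using insert g phi_carrier[OF g(1)] phi_carrier[OF g(2)] by (simp add: soc_add phi_add)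
qed

lemma soc_sum: "finite I \<Longrightarrow> (\<And>i. i \<in> I \<Longrightarrow> g i \<in> soc) \<Longrightarrow> sum g I \<in> soc"
  for g :: "'b \<Rightarrow> 'a"
  by (induction I rule: finite_induct) (auto simp: zero_soc intro: soc_add)

abbreviation grid :: "(nat \<times> nat) set" where "grid \<equiv> {..<n} \<times> {..<n}"

lemma Phi_expand:
  assumes M: "M \<in> carrier_mat n n"
  shows "\<Phi> M = (\<Sum>ij\<in>grid. M $$ ij *\<^sub>C \<Phi> (mat_unit n ij))"
proof (rule Phi_eqI)
  have u: "M $$ ij *\<^sub>C \<Phi> (mat_unit n ij) \<in> soc" for ij by (intro soc_scale Phi_soc) simp
  then show s: "(\<Sum>ij\<in>grid. M $$ ij *\<^sub>C \<Phi> (mat_unit n ij)) \<in> soc" by (intro soc_sum) auto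
  show "\<phi> (\<Sum>ij\<in>grid. M $$ ij *\<^sub>C \<Phi> (mat_unit n ij)) = M"
  proof (rule eq_matI)
    fix k l assume "k < dim_row M" "l < dim_col M"
    then have kl: "k < n" "l < n" using M by auto
    have "\<phi> (\<Sum>ij\<in>grid. M $$ ij *\<^sub>C \<Phi> (mat_unit n ij)) $$ (k, l)
      = (\<Sum>ij\<in>grid. \<phi> (M $$ ij *\<^sub>C \<Phi> (mat_unit n ij)) $$ (k, l))"
      by (rule phi_sum_entry[of grid, OF _ u kl, THEN conjunct2]) simp
    also have "\<dots> = (\<Sum>ij\<in>grid. if ij = (k, l) then M $$ ij else 0)"
      using kl by (intro sum.cong refl) (auto simp: phi_scale Phi_soc phi_Phi mat_unit_def)
    also have "\<dots> = M $$ (k, l)" using kl by simp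
    finally show "\<phi> (\<Sum>ij\<in>grid. M $$ ij *\<^sub>C \<Phi> (mat_unit n ij)) $$ (k, l) = M $$ (k, l)" .
  qed (use M phi_carrier[OF s] in auto)
qed

lemma norm_Phi_le:
  assumes M: "M \<in> carrier_mat n n" and "\<And>i j. i < n \<Longrightarrow> j < n \<Longrightarrow> cmod (M $$ (i, j)) \<le> \<delta>"
  shows "norm (\<Phi> M) \<le> \<delta> * (\<Sum>ij\<in>grid. norm (\<Phi> (mat_unit n ij)))"
  unfolding Phi_expand[OF M] sum_distrib_left
  by (rule sum_norm_le) (use assms in \<open>auto simp: norm_scaleC intro!: mult_right_mono\<close>)

lemma Phi_mat_unit_nonzero: "i < n \<Longrightarrow> j < n \<Longrightarrow> \<Phi> (mat_unit n (i, j)) \<noteq> 0"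
proof
  assume ij: "i < n" "j < n" and "\<Phi> (mat_unit n (i, j)) = 0"
  then have "mat_unit n (i, j) = 0\<^sub>m n n" by (intro Phi_eq_0) auto
  from arg_cong[OF this, of "\<lambda>M. M $$ (i, j)"] show False using ij by (simp add: mat_unit_def)
qed

text \<open>Compression by diagonal matrix units isolates one entry,
  \<open>E i i * u * E j j = u\<^sub>i\<^sub>j E i j\<close>; so the entries of the purely algebraic
  isomorphism are automatically continuous.\<close>

lemma phi_entry_bound:
  assumes ij: "i < n" "j < n"
  obtains C where "\<And>u. u \<in> soc \<Longrightarrow> cmod (\<phi> u $$ (i, j)) \<le> C * norm u"
proof -
  let ?E = "\<lambda>i j. \<Phi> (mat_unit n (i, j))"
  have E: "norm (?E i j) > 0" using Phi_mat_unit_nonzero[OF ij] by simp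
  have "cmod (\<phi> u $$ (i, j)) \<le> (norm (?E i i) * norm (?E j j) / norm (?E i j)) * norm u" if u: "u \<in> soc" for u
  proof -
    have c: "\<phi> u \<in> carrier_mat n n" by (rule phi_carrier[OF u])
    have "?E i i * u * ?E j j = \<Phi> (mat_unit n (i, i) * \<phi> u * mat_unit n (j, j))"
      using mult_carrier_mat[OF mat_unit_carrier c, of "(i, i)"] by (simp add: Phi_mult c Phi_phi[OF u])
    also have "\<dots> = \<phi> u $$ (i, j) *\<^sub>C ?E i j"
      by (simp add: mat_unit_compress[OF c ij] Phi_smult)
    finally have "cmod (\<phi> u $$ (i, j)) * norm (?E i j) = norm (?E i i * u * ?E j j)"
      by (simp add: norm_scaleC)
    also have "\<dots> \<le> norm (?E i i) * norm u * norm (?E j j)"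
      by (meson norm_mult_ineq mult_right_mono norm_ge_zero order_trans)
    finally show ?thesis using E by (simp add: field_simps)
  qed
  then show ?thesis using that by blast
qed

lemma nonzero_spectrum_soc: "a \<in> soc \<Longrightarrow> nonzero_spectrum a = set (nz (eigs (\<phi> a)))"
  using nonzero_spectrum_Phi[OF phi_carrier[of a]] set_eigs[OF phi_carrier[of a]] by (auto simp: Phi_phi)

section \<open>Rank and rank-attaining elements in terms of eigenvalues\<close>

definition nzn :: "'a \<Rightarrow> nat" where "nzn a = length (nz (eigs (\<phi> a)))"

lemma nzn_le: "a \<in> soc \<Longrightarrow> nzn a \<le> n"
  using eigs(2)[OF phi_carrier[of a]] length_filter_le[of _ "eigs (\<phi> a)"] by (simp add: nzn_def)

lemma ecard_nonzero_spectrum_soc: "a \<in> soc \<Longrightarrow> ecard (nonzero_spectrum a) = enat (card (set (nz (eigs (\<phi> a)))))"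
  by (simp add: nonzero_spectrum_soc ecard_def)

lemma ex_max_nzn:
  assumes "a \<in> soc"
  obtains x where "\<And>y. nzn (y * a) \<le> nzn (x * a)"
proof -
  let ?R = "range (\<lambda>y. nzn (y * a))"
  have "?R \<subseteq> {..n}" using assms by (auto intro!: nzn_le soc_mult_left)
  then have fin: "finite ?R" by (rule finite_subset) simp
  then obtain x where "Max ?R = nzn (x * a)" using Max_in[of ?R] by blast
  then show ?thesis using that Max_ge[OF fin] by (metis rangeI)
qed

text \<open>The number of distinct nonzero eigenvalues is at most their number with multiplicity;
  conversely, a perturbation of a maximizer makes its nonzero eigenvalues distinct without changing
  their number.\<close>

lemma alg_rank_soc:
  assumes a: "a \<in> soc" and x: "\<And>y. nzn (y * a) \<le> nzn (x * a)"
  shows "alg_rank a = enat (nzn (x * a))"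
proof (rule antisym)
  have "ecard (nonzero_spectrum (y * a)) \<le> enat (nzn (x * a))" for y
  proof -
    have "card (set (nz (eigs (\<phi> (y * a))))) \<le> nzn (y * a)" unfolding nzn_def by (rule card_length)
    then show ?thesis using ecard_nonzero_spectrum_soc[OF soc_mult_left[OF a, of y]] x[of y] by simp
  qed
  then show "alg_rank a \<le> enat (nzn (x * a))" unfolding alg_rank_def by (intro SUP_least)
  have pos: "0 < (1::real)" by simp
  obtain Y where Y: "Y \<in> carrier_mat n n" and "\<forall>i<n. \<forall>j<n. cmod ((Y - 1\<^sub>m n) $$ (i, j)) < 1"
    and dY: "distinct (nz (eigs (Y * \<phi> (x * a))))"
    and lY: "length (nz (eigs (Y * \<phi> (x * a)))) = length (nz (eigs (\<phi> (x * a))))"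
    by (rule ex_perturbation_distinct[OF phi_mult_carrier[OF a, of x] pos])
  have "\<phi> ((\<Phi> Y * x) * a) = Y * \<phi> (x * a)"
    using phi_mult[OF Phi_soc[OF Y] soc_mult_left[OF a], of x] by (simp add: phi_Phi Y mult.assoc)
  then have "ecard (nonzero_spectrum ((\<Phi> Y * x) * a)) = enat (nzn (x * a))"
    using ecard_nonzero_spectrum_soc[OF soc_mult_left[OF a, of "\<Phi> Y * x"]] lY distinct_card[OF dY]
    by (simp add: nzn_def)
  then show "enat (nzn (x * a)) \<le> alg_rank a" using ecard_le_alg_rank[of "\<Phi> Y * x" a] by simp
qed

lemma rank_attaining_soc:
  assumes a: "a \<in> soc" and x: "\<And>y. nzn (y * a) \<le> nzn (x * a)" and y: "y \<in> rank_attaining a"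
  shows "distinct (nz (eigs (\<phi> (y * a))))" "nzn (y * a) = nzn (x * a)"
proof -
  have "card (set (nz (eigs (\<phi> (y * a))))) = nzn (x * a)"
    using y alg_rank_soc[OF a x] ecard_nonzero_spectrum_soc[OF soc_mult_left[OF a, of y]]
    by (simp add: rank_attaining_def)
  moreover have "card (set (nz (eigs (\<phi> (y * a))))) \<le> nzn (y * a)" unfolding nzn_def by (rule card_length)
  ultimately show "nzn (y * a) = nzn (x * a)" using x[of y] by simp
  then show "distinct (nz (eigs (\<phi> (y * a))))"
    using \<open>card _ = nzn (x * a)\<close> by (intro card_distinct) (simp add: nzn_def)
qed

text \<open>Two perturbations of size below \<open>\<epsilon> / 2\<close> and at most
  \<open>\<epsilon> / 2\<close>: moving from 1 towards a maximizer \<open>x0\<close> raises the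
  number of nonzero eigenvalues to the maximum outside finitely many parameters, and a factor close
  to 1 then separates them.\<close>

lemma rank_attaining_dense:
  fixes a :: 'a
  assumes a: "a \<in> soc" and "\<epsilon> > 0"
  obtains x where "x \<in> rank_attaining a" "x \<in> ball 1 \<epsilon>"
proof -
  obtain x0 where x0: "\<And>y. nzn (y * a) \<le> nzn (x0 * a)" using ex_max_nzn[OF a] by blast
  let ?A = "\<phi> a" and ?A1 = "\<phi> (x0 * a)"
  have c: "?A \<in> carrier_mat n n" "?A1 \<in> carrier_mat n n" using phi_carrier[OF a] phi_mult_carrier[OF a] by auto
  define D where "D = norm (x0 - 1) + 1"
  have D: "D > 0" unfolding D_def by (rule add_nonneg_pos) auto
  define \<tau> where "\<tau> = \<epsilon> / (2 * D)"
  have "\<tau> > 0" unfolding \<tau>_def using \<open>\<epsilon> > 0\<close> D by simp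
  have "infinite (complex_of_real ` {0<..<\<tau>})"
    using \<open>\<tau> > 0\<close> by (subst finite_image_iff) (auto simp: inj_on_def infinite_Ioo)
  then obtain s where "s \<in> complex_of_real ` {0<..<\<tau>}"
    "s \<notin> {s. length (nz (eigs (?A + s \<cdot>\<^sub>m (?A1 - ?A)))) < length (nz (eigs ?A1))}"
    using finite_line_drop_nz[OF c] by (meson finite_subset subsetI)
  then have s: "cmod s < \<tau>" "nzn (x0 * a) \<le> length (nz (eigs (?A + s \<cdot>\<^sub>m (?A1 - ?A))))"
    by (auto simp: nzn_def)
  define x where "x = 1 + s *\<^sub>C (x0 - 1)"
  have xs: "x * a \<in> soc" by (rule soc_mult_left[OF a])
  have "x * a = a + s *\<^sub>C (x0 * a - a)" by (simp add: x_def algebra_simps)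
  moreover have "x0 * a - a = (x0 - 1) * a" by (simp add: algebra_simps)
  then have d: "x0 * a - a \<in> soc" using soc_mult_left[OF a] by simp
  ultimately have px: "\<phi> (x * a) = ?A + s \<cdot>\<^sub>m (?A1 - ?A)"
    using a by (simp add: phi_add soc_scale phi_scale phi_diff soc_mult_left)
  have nx: "norm (x - 1) < \<epsilon> / 2"
  proof -
    have "norm (x - 1) = cmod s * norm (x0 - 1)" by (simp add: x_def norm_scaleC)
    also have "\<dots> \<le> cmod s * D" unfolding D_def by (intro mult_left_mono) auto
    also have "\<dots> < \<tau> * D" using s(1) D by (intro mult_strict_right_mono)
    also have "\<dots> = \<epsilon> / 2" using D by (simp add: \<tau>_def)
    finally show ?thesis .
  qed
  define S where "S = (\<Sum>ij\<in>grid. norm (\<Phi> (mat_unit n ij)))"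
  have "S \<ge> 0" unfolding S_def by (intro sum_nonneg) auto
  define L where "L = (S + 1) * (norm x + 1)"
  have "L > 0" unfolding L_def using \<open>S \<ge> 0\<close> by (intro mult_pos_pos) (auto intro: add_nonneg_pos)
  define \<delta> where "\<delta> = \<epsilon> / (2 * L)"
  have "\<delta> > 0" using \<open>\<epsilon> > 0\<close> \<open>L > 0\<close> by (simp add: \<delta>_def)
  obtain Y where Y: "Y \<in> carrier_mat n n"
    "\<forall>i<n. \<forall>j<n. cmod ((Y - 1\<^sub>m n) $$ (i, j)) < \<delta>"
    "distinct (nz (eigs (Y * \<phi> (x * a))))" "length (nz (eigs (Y * \<phi> (x * a)))) = length (nz (eigs (\<phi> (x * a))))"
    by (rule ex_perturbation_distinct[OF phi_carrier[OF xs] \<open>\<delta> > 0\<close>])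
  \<comment> \<open>\<open>\<Phi> Y\<close> is close to the unit of the socle, not to 1, so the
    factor is \<open>1 + ?w\<close>; on the socle it acts like \<open>\<Phi> Y\<close>.\<close>
  let ?w = "\<Phi> (Y - 1\<^sub>m n)"
  have Y1: "Y - 1\<^sub>m n \<in> carrier_mat n n" by (rule minus_carrier_mat) simp
  have w: "norm ?w \<le> \<delta> * S" unfolding S_def
    by (rule norm_Phi_le[OF Y1 less_imp_le[OF Y(2)[rule_format]]])
  define y where "y = (1 + ?w) * x"
  have "y * a = x * a + ?w * (x * a)" by (simp add: y_def algebra_simps)
  then have "\<phi> (y * a) = \<phi> (x * a) + (Y - 1\<^sub>m n) * \<phi> (x * a)"
    using xs by (simp add: phi_add phi_mult Phi_soc[OF Y1] phi_Phi[OF Y1] soc_mult_left)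
  also have "\<dots> = Y * \<phi> (x * a)"
  proof -
    have "(1\<^sub>m n + (Y - 1\<^sub>m n)) * \<phi> (x * a) = 1\<^sub>m n * \<phi> (x * a) + (Y - 1\<^sub>m n) * \<phi> (x * a)"
      by (rule add_mult_distrib_mat[OF _ Y1 phi_carrier[OF xs]]) simp
    moreover have "1\<^sub>m n + (Y - 1\<^sub>m n) = Y" using Y(1) by (intro eq_matI) auto
    ultimately show ?thesis using phi_carrier[OF xs] by simp
  qed
  finally have py: "\<phi> (y * a) = Y * \<phi> (x * a)" .
  have "nzn (y * a) = nzn (x0 * a)"
  proof (rule antisym[OF x0])
    show "nzn (x0 * a) \<le> nzn (y * a)" using s(2) Y(4) by (simp add: nzn_def[of "y * a"] py px)
  qed
  then have "y \<in> rank_attaining a"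
    unfolding rank_attaining_def alg_rank_soc[OF a x0]
    using ecard_nonzero_spectrum_soc[OF soc_mult_left[OF a, of y]] distinct_card[OF Y(3)] by (simp add: py nzn_def)
  moreover have "y \<in> ball 1 \<epsilon>"
  proof -
    have "norm (y - 1) = norm ((x - 1) + ?w * x)" by (simp add: y_def algebra_simps)
    also have "\<dots> \<le> norm (x - 1) + norm ?w * norm x"
      by (meson norm_triangle_ineq norm_mult_ineq add_left_mono order_trans)
    also have "norm ?w * norm x \<le> \<delta> * S * norm x" using w by (intro mult_right_mono) auto
    also have "\<dots> \<le> \<delta> * L"
      unfolding L_def using \<open>S \<ge> 0\<close> \<open>\<delta> > 0\<close> by (simp add: mult.assoc mult_mono)
    also have "\<dots> = \<epsilon> / 2" using \<open>L > 0\<close> by (simp add: \<delta>_def)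
    finally show ?thesis using nx by (simp add: dist_norm norm_minus_commute)
  qed
  ultimately show ?thesis using that by blast
qed

end

section \<open>Multiplicity and trace of socle elements\<close>

lemma sum_list_eq_sum_count:
  fixes xs :: "complex list"
  assumes "finite S" "set xs \<subseteq> S"
  shows "sum_list xs = (\<Sum>x\<in>S. x * of_nat (count (mset xs) x))"
  using assms(2)
proof (induction xs)
  case (Cons a xs)
  have "(\<Sum>x\<in>S. x * of_nat (count (mset (a # xs)) x))
      = (\<Sum>x\<in>S. x * of_nat (count (mset xs) x) + (if x = a then x else 0))"
    by (intro sum.cong refl) (auto simp: algebra_simps)
  then show ?case using Cons assms(1) by (simp add: sum.distrib)
qed simp

lemma norm_sum_list_le: "cmod (sum_list xs) \<le> sum_list (map cmod xs)"
  by (induction xs) (auto intro: order_trans[OF norm_triangle_ineq])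

context soc_matrix_iso
begin

lemma phi_entry_tendsto:
  assumes a: "a \<in> soc" and X: "X \<longlonglongrightarrow> 1" and ij: "i < n" "j < n"
  shows "(\<lambda>k. \<phi> (X k * a) $$ (i, j)) \<longlonglongrightarrow> \<phi> a $$ (i, j)"
proof -
  obtain C where C: "\<And>u. u \<in> soc \<Longrightarrow> cmod (\<phi> u $$ (i, j)) \<le> C * norm u"
    using phi_entry_bound[OF ij] by blast
  have "\<phi> (X k * a) $$ (i, j) - \<phi> a $$ (i, j) = \<phi> ((X k - 1) * a) $$ (i, j)" for k
    using phi_diff[OF soc_mult_left[OF a, of "X k"] a] phi_carrier[OF a] phi_mult_carrier[OF a, of "X k"] ij
    by (simp add: left_diff_distrib)
  then have le: "norm (\<phi> (X k * a) $$ (i, j) - \<phi> a $$ (i, j)) \<le> C * norm ((X k - 1) * a)" for k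
    using C[OF soc_mult_left[OF a]] by simp
  have "(\<lambda>k. C * norm ((X k - 1) * a)) \<longlonglongrightarrow> C * norm ((1 - 1) * a)"
    by (intro tendsto_intros X)
  then have "(\<lambda>k. C * norm ((X k - 1) * a)) \<longlonglongrightarrow> 0" by simp
  with always_eventually[OF allI[OF le]] have "(\<lambda>k. \<phi> (X k * a) $$ (i, j) - \<phi> a $$ (i, j)) \<longlonglongrightarrow> 0"
    by (rule Lim_null_comparison)
  then show ?thesis by (simp add: LIM_zero_iff)
qed

lemma char_poly_tendsto:
  assumes a: "a \<in> soc" and X: "X \<longlonglongrightarrow> 1"
  shows "(\<lambda>k. poly (char_poly (\<phi> (X k * a))) z) \<longlonglongrightarrow> poly (char_poly (\<phi> a)) z"
proof -
  have *: "poly (char_poly M) z = (\<Sum>p | p permutes {0..<n}. poly (signof p) z *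
    (\<Prod>i = 0..<n. poly (if i = p i then [:0, 1:] else 0) z - M $$ (i, p i)))" if "M \<in> carrier_mat n n" for M
    unfolding char_poly_det_expansion[OF that] by (simp add: poly_sum poly_prod)
  show ?thesis
    unfolding *[OF phi_mult_carrier[OF a]] *[OF phi_carrier[OF a]]
  proof (intro tendsto_intros)
    fix p i assume "p \<in> {p. p permutes {0..<n}}" "i \<in> {0..<n}"
    then have "i < n" "p i < n" using permutes_in_image[of p "{0..<n}" i] by auto
    then show "(\<lambda>k. \<phi> (X k * a) $$ (i, p i)) \<longlonglongrightarrow> \<phi> a $$ (i, p i)"
      by (rule phi_entry_tendsto[OF a X])
  qed
qed

lemma det_phi_iff: "a \<in> soc \<Longrightarrow> Determinant.det (\<phi> a) = 0 \<longleftrightarrow> 0 \<in> set (eigs (\<phi> a))"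
proof -
  assume a: "a \<in> soc"
  note c = phi_carrier[OF a]
  have "char_matrix (\<phi> a) 0 = \<phi> a" using c by (intro eq_matI) (auto simp: char_matrix_def)
  then show ?thesis
    using eigenvalue_det[OF c, of 0] eigenvalue_root_char_poly[OF c, of 0] set_eigs[OF c] by auto
qed

text \<open>\<open>e * a = a\<close> and invertibility of \<open>a\<close> force
  \<open>e = 1\<close>, so the matrix algebra is then the whole algebra. This settles whether 0
  belongs to the spectrum, which nonzero spectra cannot tell.\<close>

lemma invertible_soc:
  assumes a: "a \<in> soc" and inv: "alg_invertible a"
  shows "e = 1" "0 \<notin> set (eigs (\<phi> a))"
proof -
  obtain w where w: "a * w = 1" "w * a = 1" using inv by (auto simp: alg_invertible_def)
  have "e * (a * w) = a * w" using e_left[OF a] by (simp flip: mult.assoc)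
  then show e1: "e = 1" by (simp add: w)
  have "corner_inv unit (\<Phi> (\<phi> a))"
    unfolding corner_inv_def Phi_phi[OF a] e_def[symmetric] e1 using w by (intro exI[of _ w]) simp
  then show "0 \<notin> set (eigs (\<phi> a))"
    using corner_inv_Phi[OF phi_carrier[OF a]] det_phi_iff[OF a] by simp
qed

lemma invertible_socI:
  assumes a: "a \<in> soc" and "e = 1" "0 \<notin> set (eigs (\<phi> a))"
  shows "alg_invertible a"
proof -
  have "corner_inv unit (\<Phi> (\<phi> a))"
    using corner_inv_Phi[OF phi_carrier[OF a]] det_phi_iff[OF a] assms(3) by simp
  then show ?thesis
    unfolding corner_inv_def Phi_phi[OF a] e_def[symmetric] \<open>e = 1\<close> alg_invertible_def by blast
qed

lemma set_eigs_subset_spectrum: "a \<in> soc \<Longrightarrow> set (eigs (\<phi> a)) \<subseteq> alg_spectrum a"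
proof
  fix \<mu> assume a: "a \<in> soc" and \<mu>: "\<mu> \<in> set (eigs (\<phi> a))"
  show "\<mu> \<in> alg_spectrum a"
  proof (cases "\<mu> = 0")
    case True
    then show ?thesis using invertible_soc(2)[OF a] \<mu> zero_in_alg_spectrum by blast
  next
    case False
    then have "\<mu> \<in> nonzero_spectrum a" using \<mu> nonzero_spectrum_soc[OF a] by simp
    then show ?thesis by (simp add: nonzero_spectrum_def)
  qed
qed

text \<open>A rank-attaining \<open>x\<close> makes the nonzero eigenvalues of \<open>x * a\<close>
  simple, so points and list entries are counted alike. The disk may contain 0; then
  \<open>a\<close> is invertible, all \<open>n\<close> eigenvalues of \<open>x * a\<close> are
  nonzero by maximality, and \<open>x * a\<close> is invertible as well.\<close>

lemma spectrum_ball_eq: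
  assumes a: "a \<in> soc" and \<mu>: "\<mu> \<noteq> 0" and r: "cball \<mu> r \<inter> alg_spectrum a = {\<mu>}"
    and x: "x \<in> rank_attaining a"
  shows "ecard (alg_spectrum (x * a) \<inter> ball \<mu> r) = enat (length (filter (\<lambda>b. b \<in> ball \<mu> r) (eigs (\<phi> (x * a)))))"
proof -
  let ?es = "eigs (\<phi> (x * a))"
  have xa: "x * a \<in> soc" by (rule soc_mult_left[OF a])
  obtain x0 where x0: "\<And>y. nzn (y * a) \<le> nzn (x0 * a)" using ex_max_nzn[OF a] by blast
  note att = rank_attaining_soc[OF a x0 x]
  have zero: "0 \<notin> set ?es \<and> 0 \<notin> alg_spectrum (x * a)" if "0 \<in> ball \<mu> r"
  proof -
    have "0 \<in> cball \<mu> r" using that by auto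
    then have "0 \<notin> alg_spectrum a" using r \<mu> by (metis IntI singletonD)
    then have inv: "alg_invertible a" using zero_in_alg_spectrum by blast
    note i = invertible_soc[OF a inv]
    have "nz (eigs (\<phi> a)) = eigs (\<phi> a)" using i(2) by (auto intro!: filter_True)
    then have "nzn a = n" using eigs(2)[OF phi_carrier[OF a]] by (simp add: nzn_def)
    then have "length (nz ?es) = length ?es"
      using x0[of 1] att(2) nzn_le[OF xa] eigs(2)[OF phi_carrier[OF xa]] by (simp add: nzn_def)
    then have "0 \<notin> set ?es" using length_filter_less[of 0 ?es "\<lambda>a. a \<noteq> 0"] by auto
    then show ?thesis using invertible_socI[OF xa i(1)] zero_in_alg_spectrum by blast
  qed
  have f: "filter (\<lambda>b. b \<in> ball \<mu> r) ?es = filter (\<lambda>b. b \<in> ball \<mu> r) (nz ?es)"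
    unfolding filter_filter using zero by (intro filter_cong) auto
  have "alg_spectrum (x * a) \<inter> ball \<mu> r = nonzero_spectrum (x * a) \<inter> ball \<mu> r"
    using zero by (auto simp: nonzero_spectrum_def)
  also have "\<dots> = set (filter (\<lambda>b. b \<in> ball \<mu> r) ?es)"
    unfolding f nonzero_spectrum_soc[OF xa] by auto
  finally have s: "alg_spectrum (x * a) \<inter> ball \<mu> r = set (filter (\<lambda>b. b \<in> ball \<mu> r) ?es)" .
  have "distinct (filter (\<lambda>b. b \<in> ball \<mu> r) ?es)" unfolding f using att(1) by (rule distinct_filter)
  then show ?thesis unfolding s by (simp add: ecard_def distinct_card del: set_filter)
qed

text \<open>For \<mu> = 0 the formula can fail, since repeated zero eigenvalues are a single
  spectral point; in the trace that term has weight 0.\<close>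

lemma multiplicity_at_soc:
  assumes a: "a \<in> soc" and \<mu>: "\<mu> \<noteq> 0" "\<mu> \<in> alg_spectrum a"
  shows "multiplicity_at \<mu> a = count (mset (eigs (\<phi> a))) \<mu>"
  unfolding multiplicity_at_def
proof (rule the_equality)
  let ?m = "count (mset (eigs (\<phi> a))) \<mu>"
  show ex: "\<forall>r>0. cball \<mu> r \<inter> alg_spectrum a = {\<mu>} \<longrightarrow>
    (\<exists>\<epsilon>>0. \<forall>x\<in>rank_attaining a \<inter> ball 1 \<epsilon>. ecard (alg_spectrum (x * a) \<inter> ball \<mu> r) = enat ?m)"
  proof (intro allI impI, rule ccontr)
    fix r :: real assume r: "r > 0" "cball \<mu> r \<inter> alg_spectrum a = {\<mu>}"
    assume "\<not> (\<exists>\<epsilon>>0. \<forall>x\<in>rank_attaining a \<inter> ball 1 \<epsilon>. ecard (alg_spectrum (x * a) \<inter> ball \<mu> r) = enat ?m)"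
    then have "\<forall>k. \<exists>x. x \<in> rank_attaining a \<inter> ball 1 (inverse (real (Suc k))) \<and>
        ecard (alg_spectrum (x * a) \<inter> ball \<mu> r) \<noteq> enat ?m"
      by (metis inverse_positive_iff_positive of_nat_0_less_iff zero_less_Suc)
    then obtain X where X: "\<And>k. X k \<in> rank_attaining a" "\<And>k. X k \<in> ball 1 (inverse (real (Suc k)))"
      "\<And>k. ecard (alg_spectrum (X k * a) \<inter> ball \<mu> r) \<noteq> enat ?m" by (metis IntE)
    have X1: "norm (X k - 1) \<le> inverse (real (Suc k))" for k
      using X(2)[of k] by (simp add: dist_norm norm_minus_commute)
    have "(\<lambda>k. X k - 1) \<longlonglongrightarrow> 0"
      by (rule Lim_null_comparison[OF _ LIMSEQ_inverse_real_of_nat]) (use X1 in auto)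
    then have lim: "X \<longlonglongrightarrow> 1" by (simp add: LIM_zero_iff)
    define R where "R = (norm (1::'a) + 1) * norm a"
    have "R \<ge> 0" by (simp add: R_def)
    have Xa: "X k * a \<in> soc" for k by (rule soc_mult_left[OF a])
    have bound: "set (eigs (\<phi> (X k * a))) \<subseteq> cball 0 R" for k
    proof
      fix l assume l: "l \<in> set (eigs (\<phi> (X k * a)))"
      show "l \<in> cball 0 R"
      proof (cases "l = 0")
        case False
        then have "l \<in> nonzero_spectrum (X k * a)" using l nonzero_spectrum_soc[OF Xa] by simp
        then have "cmod l \<le> norm (X k * a)" by (rule norm_nonzero_spectrum_le)
        also have "\<dots> \<le> norm (X k) * norm a" by (rule norm_mult_ineq)
        also have "norm (X k) \<le> norm (1::'a) + 1"
        proof -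
          have "inverse (real (Suc k)) \<le> 1" by (simp add: field_simps)
          then show ?thesis using X1[of k] norm_triangle_ineq[of 1 "X k - 1"] by simp
        qed
        finally show ?thesis by (simp add: R_def mult_right_mono)
      qed (use \<open>R \<ge> 0\<close> in simp)
    qed
    have "\<forall>\<^sub>F k in sequentially. length (filter (\<lambda>b. b \<in> ball \<mu> r) (eigs (\<phi> (X k * a)))) = ?m"
    proof (rule eventually_root_count[OF _ bound _ r(1)])
      show "length (eigs (\<phi> (X k * a))) = n" for k by (rule eigs(2)[OF phi_carrier[OF Xa]])
      show "(\<lambda>k. poly (linprod (eigs (\<phi> (X k * a)))) z) \<longlonglongrightarrow> poly (linprod (eigs (\<phi> a))) z" for z
        using char_poly_tendsto[OF a lim, of z] by (simp only: eigs(1)[OF phi_carrier[OF Xa]] eigs(1)[OF phi_carrier[OF a]])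
      show "cball \<mu> r \<inter> set (eigs (\<phi> a)) \<subseteq> {\<mu>}" using r(2) set_eigs_subset_spectrum[OF a] by blast
    qed
    then obtain k where "length (filter (\<lambda>b. b \<in> ball \<mu> r) (eigs (\<phi> (X k * a)))) = ?m"
      by (auto simp: eventually_sequentially)
    then show False using spectrum_ball_eq[OF a \<mu>(1) r(2) X(1)[of k]] X(3)[of k] by simp
  qed
  fix m :: nat
  assume m: "\<forall>r>0. cball \<mu> r \<inter> alg_spectrum a = {\<mu>} \<longrightarrow>
    (\<exists>\<epsilon>>0. \<forall>x\<in>rank_attaining a \<inter> ball 1 \<epsilon>. ecard (alg_spectrum (x * a) \<inter> ball \<mu> r) = enat m)"
  have "open (- (alg_spectrum a - {\<mu>}))"
    using finite_alg_spectrum_soc[OF a] by (intro open_Compl finite_imp_closed) simp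
  then obtain r where r: "r > 0" "cball \<mu> r \<subseteq> - (alg_spectrum a - {\<mu>})"
    using open_contains_cball by (metis ComplI DiffD2 singletonI)
  then have iso: "cball \<mu> r \<inter> alg_spectrum a = {\<mu>}" using \<mu>(2) by auto
  from m[rule_format, OF r(1) iso] obtain \<epsilon>1 where 1: "\<epsilon>1 > 0"
    "\<forall>x\<in>rank_attaining a \<inter> ball 1 \<epsilon>1. ecard (alg_spectrum (x * a) \<inter> ball \<mu> r) = enat m" by auto
  from ex[rule_format, OF r(1) iso] obtain \<epsilon>2 where 2: "\<epsilon>2 > 0"
    "\<forall>x\<in>rank_attaining a \<inter> ball 1 \<epsilon>2. ecard (alg_spectrum (x * a) \<inter> ball \<mu> r) = enat ?m" by auto
  have "min \<epsilon>1 \<epsilon>2 > 0" using 1(1) 2(1) by simp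
  then obtain x where x: "x \<in> rank_attaining a" "x \<in> ball 1 (min \<epsilon>1 \<epsilon>2)"
    by (rule rank_attaining_dense[OF a])
  then have "x \<in> rank_attaining a \<inter> ball 1 \<epsilon>1" "x \<in> rank_attaining a \<inter> ball 1 \<epsilon>2" by auto
  with 1(2) 2(2) have "enat m = enat ?m" by metis
  then show "m = ?m" by simp
qed

lemma soc_trace_eq: "a \<in> soc \<Longrightarrow> soc_trace a = mtrace (\<phi> a)"
proof -
  assume a: "a \<in> soc"
  let ?es = "eigs (\<phi> a)"
  have "soc_trace a = (\<Sum>\<mu>\<in>alg_spectrum a. \<mu> * of_nat (count (mset ?es) \<mu>))"
    unfolding soc_trace_def
  proof (rule sum.cong[OF refl])
    fix \<mu> assume "\<mu> \<in> alg_spectrum a"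
    then show "\<mu> * of_nat (multiplicity_at \<mu> a) = \<mu> * of_nat (count (mset ?es) \<mu>)"
      using multiplicity_at_soc[OF a] by (cases "\<mu> = 0") auto
  qed
  also have "\<dots> = sum_list ?es"
    using sum_list_eq_sum_count[OF finite_alg_spectrum_soc[OF a] set_eigs_subset_spectrum[OF a]] ..
  finally show ?thesis using mtrace_eigs[OF phi_carrier[OF a]] by simp
qed

lemma soc_trace_bound:
  fixes a :: 'a
  assumes a: "a \<in> soc"
  shows "cmod (soc_trace a) \<le> real n * alg_spectral_radius a" "0 \<le> alg_spectral_radius a"
proof -
  have fin: "finite (alg_spectrum a)" by (rule finite_alg_spectrum_soc[OF a])
  have le: "cmod \<mu> \<le> alg_spectral_radius a" if "\<mu> \<in> alg_spectrum a" for \<mu>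
    unfolding alg_spectral_radius_def by (rule cSUP_upper[OF that]) (use fin in simp)
  have "cmod (soc_trace a) \<le> sum_list (map cmod (eigs (\<phi> a)))"
    unfolding soc_trace_eq[OF a] mtrace_eigs[OF phi_carrier[OF a]]
    by (rule norm_sum_list_le)
  also have "\<dots> \<le> sum_list (map (\<lambda>_. alg_spectral_radius a) (eigs (\<phi> a)))"
    using le set_eigs_subset_spectrum[OF a] by (intro sum_list_mono) blast
  also have "\<dots> = real n * alg_spectral_radius a"
    using eigs(2)[OF phi_carrier[OF a]] by (simp add: map_replicate_const sum_list_replicate)
  finally show "cmod (soc_trace a) \<le> real n * alg_spectral_radius a" .
  \<comment> \<open>For \<open>n = 0\<close> there are no eigenvalues to use; then
    \<open>a = 0\<close>, whose spectrum contains 0.\<close>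
  have "alg_spectrum a \<noteq> {}"
  proof (cases "n = 0")
    case True
    then have "1\<^sub>m n = (0\<^sub>m n n :: complex mat)" by (intro eq_matI) auto
    then have "e = 0" by (simp only: e_def Phi_0)
    then have "a = 0" using e_left[OF a] by simp
    then have "0 \<in> alg_spectrum a" using zero_in_alg_spectrum[of a] by (simp add: alg_invertible_def)
    then show ?thesis by blast
  next
    case False
    then have "eigs (\<phi> a) \<noteq> []" using eigs(2)[OF phi_carrier[OF a]] by auto
    then show ?thesis using set_eigs_subset_spectrum[OF a] by (metis set_empty subset_empty)
  qed
  then show "0 \<le> alg_spectral_radius a" using le by (meson all_not_in_conv norm_ge_zero order_trans)
qed

end

section \<open>Linear functionals on a matrix socle\<close>

lemma square_zero_spectral_radius:
  fixes u :: "'a::complex_banach_algebra_1"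
  assumes "u * u = 0"
  shows "alg_spectral_radius u = 0"
proof -
  have "nonzero_spectrum u = {}"
  proof -
    have "(1 - s *\<^sub>C u) * (1 + s *\<^sub>C u) = 1" "(1 + s *\<^sub>C u) * (1 - s *\<^sub>C u) = 1" for s
      using assms by (simp_all add: algebra_simps)
    then have "alg_invertible (1 - s *\<^sub>C u)" for s by (intro alg_invertibleI)
    then show ?thesis by (auto simp: nonzero_spectrum_iff)
  qed
  moreover have "\<not> alg_invertible u"
  proof
    assume "alg_invertible u"
    then obtain w where w: "w * u = 1" by (auto simp: alg_invertible_def)
    then have "u = w * (u * u)" by (simp flip: mult.assoc)
    then show False using w assms by simp
  qed
  then have "0 \<in> alg_spectrum u" by (simp add: zero_in_alg_spectrum)
  ultimately have "alg_spectrum u = {0}" by (auto simp: nonzero_spectrum_def)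
  then show ?thesis by (simp add: alg_spectral_radius_def)
qed

context soc_matrix_iso
begin

abbreviation E :: "nat \<Rightarrow> nat \<Rightarrow> 'a" where "E i j \<equiv> \<Phi> (mat_unit n (i, j))"

lemma E_soc: "E i j \<in> soc"
  by (simp add: Phi_soc)

lemma E_mult: "i < n \<Longrightarrow> j < n \<Longrightarrow> k < n \<Longrightarrow> l < n \<Longrightarrow> E i j * E k l = (if j = k then E i l else 0)"
  using mat_unit_mult[of i n j k l] by (simp add: Phi_0 flip: Phi_mult)

context
  fixes f :: "'a \<Rightarrow> complex"
  assumes f: "linear_functional_on soc f"
begin

lemma f_add: "a \<in> soc \<Longrightarrow> b \<in> soc \<Longrightarrow> f (a + b) = f a + f b"
  and f_scale: "a \<in> soc \<Longrightarrow> f (c *\<^sub>C a) = c * f a"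
  using f by (simp_all add: linear_functional_on_def)

lemma f_0: "f 0 = 0"
  using f_scale[OF zero_soc, of 0] by simp

lemma f_sum: "finite I \<Longrightarrow> (\<And>i. i \<in> I \<Longrightarrow> g i \<in> soc) \<Longrightarrow> f (sum g I) = (\<Sum>i\<in>I. f (g i))"
  by (induction I rule: finite_induct) (auto simp: f_0 f_add soc_sum)

text \<open>The factor is \<open>f (E 0 0)\<close>. It is meaningful as a diagonal value only for
  \<open>n > 0\<close>; for \<open>n = 0\<close> all sums below are empty.\<close>

lemma multiple_of_traceI:
  assumes off: "\<And>i j. i < n \<Longrightarrow> j < n \<Longrightarrow> i \<noteq> j \<Longrightarrow> f (E i j) = 0"
    and diag: "\<And>i j. i < n \<Longrightarrow> j < n \<Longrightarrow> i \<noteq> j \<Longrightarrow> f (E i i) = f (E j j)"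
  shows "\<exists>\<alpha>. \<forall>a\<in>soc. f a = \<alpha> * soc_trace a"
proof (intro exI ballI)
  fix a :: 'a assume a: "a \<in> soc"
  have f_diag: "f (E i i) = f (E 0 0)" if "i < n" for i
    using diag[of i 0] that by (cases "i = 0") auto
  have "f a = f (\<Sum>ij\<in>grid. \<phi> a $$ ij *\<^sub>C \<Phi> (mat_unit n ij))"
    using Phi_expand[OF phi_carrier[OF a]] by (simp add: Phi_phi[OF a])
  also have "\<dots> = (\<Sum>ij\<in>grid. f (\<phi> a $$ ij *\<^sub>C \<Phi> (mat_unit n ij)))"
    by (rule f_sum) (auto intro!: soc_scale E_soc)
  also have "\<dots> = (\<Sum>i<n. \<Sum>j<n. \<phi> a $$ (i, j) * f (E i j))"
    unfolding sum.cartesian_product by (intro sum.cong refl) (auto simp: f_scale Phi_soc)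
  also have "\<dots> = (\<Sum>i<n. \<Sum>j<n. if j = i then \<phi> a $$ (i, j) * f (E 0 0) else 0)"
  proof (intro sum.cong refl)
    fix i j assume "i \<in> {..<n}" "j \<in> {..<n}"
    then show "\<phi> a $$ (i, j) * f (E i j) = (if j = i then \<phi> a $$ (i, j) * f (E 0 0) else 0)"
      using off[of i j] f_diag[of i] by auto
  qed
  also have "\<dots> = (\<Sum>i<n. \<phi> a $$ (i, i) * f (E 0 0))" by simp
  also have "\<dots> = f (E 0 0) * soc_trace a"
    using phi_carrier[OF a] by (simp add: soc_trace_eq[OF a] mtrace_def sum_distrib_left mult.commute)
  finally show "f a = f (E 0 0) * soc_trace a" .
qed

text \<open>\<open>E i j\<close> is \<open>E i i * E i j\<close>, whose reversed product is 0, and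
  \<open>E i i\<close>, \<open>E j j\<close> are the two products of \<open>E i j\<close> and
  \<open>E j i\<close>.\<close>

lemma multiple_of_trace_if_tracial:
  assumes "\<forall>a\<in>soc. \<forall>b\<in>soc. f (a * b) = f (b * a)"
  shows "\<exists>\<alpha>. \<forall>a\<in>soc. f a = \<alpha> * soc_trace a"
proof (rule multiple_of_traceI)
  fix i j assume ij: "i < n" "j < n" "i \<noteq> j"
  have c: "f (E k l * E r s) = f (E r s * E k l)" for k l r s using assms E_soc by blast
  show "f (E i j) = 0" using c[of i i i j] ij by (simp add: E_mult f_0)
  show "f (E i i) = f (E j j)" using c[of i j j i] ij by (simp add: E_mult)
qed

text \<open>Condition (c) makes \<open>f\<close> vanish on square-zero elements; the block with rows \<open>(1, 1)\<close> and
  \<open>(-1, -1)\<close> compares the diagonal matrix units.\<close>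

lemma multiple_of_trace_if_bounded:
  assumes "\<forall>a\<in>soc. cmod (f a) \<le> c * alg_spectral_radius a"
  shows "\<exists>\<alpha>. \<forall>a\<in>soc. f a = \<alpha> * soc_trace a"
proof (rule multiple_of_traceI)
  have sq: "f u = 0" if "u \<in> soc" "u * u = 0" for u
    using assms that square_zero_spectral_radius[of u] by force
  fix i j assume ij: "i < n" "j < n" "i \<noteq> j"
  have off: "f (E i j) = 0" "f (E j i) = 0" using ij by (auto intro!: sq E_soc simp: E_mult)
  define W where "W = (E i i + E i j) + (- 1) *\<^sub>C (E j i + E j j)"
  have "W * W = 0" using ij by (simp add: W_def algebra_simps E_mult)
  moreover have "W \<in> soc" unfolding W_def by (intro soc_add soc_scale E_soc)
  ultimately have "f W = 0" by (intro sq)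
  moreover have "f W = (f (E i i) + f (E i j)) + (- 1) * (f (E j i) + f (E j j))"
    unfolding W_def by (simp only: f_add f_scale soc_add soc_scale E_soc)
  ultimately show "f (E i i) = f (E j j)" using off by simp
  show "f (E i j) = 0" by (rule off)
qed

lemma tracial_if_multiple_of_trace:
  assumes \<alpha>: "\<forall>a\<in>soc. f a = \<alpha> * soc_trace a"
  shows "\<forall>a\<in>soc. \<forall>b\<in>soc. f (a * b) = f (b * a)"
proof (intro ballI)
  fix a b :: 'a assume a: "a \<in> soc" and b: "b \<in> soc"
  show "f (a * b) = f (b * a)"
    using a b \<alpha> mtrace_mult_commute[OF phi_carrier[OF a] phi_carrier[OF b]]
    by (simp add: soc_mult_left soc_trace_eq phi_mult)
qed

lemma bounded_if_multiple_of_trace: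
  assumes \<alpha>: "\<forall>a\<in>soc. f a = \<alpha> * soc_trace a"
  shows "\<exists>c>0. \<forall>a\<in>soc. cmod (f a) \<le> c * alg_spectral_radius a"
proof (intro exI conjI ballI)
  \<comment> \<open>The summand 1 keeps the constant positive when \<alpha> or \<open>n\<close> is
    0.\<close>
  show "cmod \<alpha> * real n + 1 > 0" by (intro add_nonneg_pos) auto
  fix a :: 'a assume a: "a \<in> soc"
  have "cmod (f a) = cmod \<alpha> * cmod (soc_trace a)" using \<alpha> a by (simp add: norm_mult)
  also have "\<dots> \<le> cmod \<alpha> * (real n * alg_spectral_radius a)"
    by (intro mult_left_mono soc_trace_bound(1)[OF a]) simp
  also have "\<dots> \<le> (cmod \<alpha> * real n + 1) * alg_spectral_radius a"
    using soc_trace_bound(2)[OF a] by (simp add: algebra_simps)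
  finally show "cmod (f a) \<le> (cmod \<alpha> * real n + 1) * alg_spectral_radius a" .
qed

end

end

theorem theorem3p3:
  assumes "semisimple_algebra TYPE('a::complex_banach_algebra_1)"
  shows "(\<forall>f :: 'a \<Rightarrow> complex. linear_functional_on soc f \<longrightarrow>
            ((\<exists>\<alpha>. \<forall>a\<in>soc. f a = \<alpha> * soc_trace a) \<longleftrightarrow>
             (\<forall>a\<in>soc. \<forall>b\<in>soc. f (a * b) = f (b * a))) \<and>
            ((\<forall>a\<in>soc. \<forall>b\<in>soc. f (a * b) = f (b * a)) \<longleftrightarrow>
             (\<exists>c>0. \<forall>a\<in>soc. cmod (f a) \<le> c * alg_spectral_radius a)))
         \<longleftrightarrow> (\<exists>n. isomorphic_to_matrix_algebra (soc :: 'a set) n)"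
proof
  assume I: "\<forall>f :: 'a \<Rightarrow> complex. linear_functional_on soc f \<longrightarrow>
            ((\<exists>\<alpha>. \<forall>a\<in>soc. f a = \<alpha> * soc_trace a) \<longleftrightarrow>
             (\<forall>a\<in>soc. \<forall>b\<in>soc. f (a * b) = f (b * a))) \<and>
            ((\<forall>a\<in>soc. \<forall>b\<in>soc. f (a * b) = f (b * a)) \<longleftrightarrow>
             (\<exists>c>0. \<forall>a\<in>soc. cmod (f a) \<le> c * alg_spectral_radius a))"
  show "\<exists>n. isomorphic_to_matrix_algebra (soc :: 'a set) n"
  proof (rule isomorphic_to_matrix_algebraI[OF assms])
    fix f :: "'a \<Rightarrow> complex"
    assume f: "linear_functional_on soc f" and tr: "\<forall>a\<in>soc. \<forall>b\<in>soc. f (a * b) = f (b * a)"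
    note If = I[rule_format, OF f]
    show "\<exists>\<alpha>. \<forall>a\<in>soc. f a = \<alpha> * soc_trace a" by (rule iffD2[OF conjunct1[OF If] tr])
    show "\<exists>c>0. \<forall>a\<in>soc. cmod (f a) \<le> c * alg_spectral_radius a" by (rule iffD1[OF conjunct2[OF If] tr])
  qed
next
  assume "\<exists>n. isomorphic_to_matrix_algebra (soc :: 'a set) n"
  then obtain n and \<phi> :: "'a \<Rightarrow> complex mat" where \<phi>: "bij_betw \<phi> soc (carrier_mat n n) \<and>
        (\<forall>a\<in>soc. \<forall>b\<in>soc. \<phi> (a + b) = \<phi> a + \<phi> b) \<and>
        (\<forall>a\<in>soc. \<forall>b\<in>soc. \<phi> (a * b) = \<phi> a * \<phi> b) \<and>
        (\<forall>c. \<forall>a\<in>soc. \<phi> (c *\<^sub>C a) = c \<cdot>\<^sub>m \<phi> a)"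
    unfolding isomorphic_to_matrix_algebra_def by (elim exE)
  interpret soc_matrix_iso \<phi> n
    using \<phi> by unfold_locales simp_all
  show "\<forall>f :: 'a \<Rightarrow> complex. linear_functional_on soc f \<longrightarrow>
            ((\<exists>\<alpha>. \<forall>a\<in>soc. f a = \<alpha> * soc_trace a) \<longleftrightarrow>
             (\<forall>a\<in>soc. \<forall>b\<in>soc. f (a * b) = f (b * a))) \<and>
            ((\<forall>a\<in>soc. \<forall>b\<in>soc. f (a * b) = f (b * a)) \<longleftrightarrow>
             (\<exists>c>0. \<forall>a\<in>soc. cmod (f a) \<le> c * alg_spectral_radius a))"
  proof (intro allI impI)
    fix f :: "'a \<Rightarrow> complex" assume f: "linear_functional_on soc f"
    let ?a = "\<exists>\<alpha>. \<forall>a\<in>soc. f a = \<alpha> * soc_trace a"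
      and ?b = "\<forall>a\<in>soc. \<forall>b\<in>soc. f (a * b) = f (b * a)"
      and ?c = "\<exists>c>0. \<forall>a\<in>soc. cmod (f a) \<le> c * alg_spectral_radius a"
    have "?b \<Longrightarrow> ?a" by (rule multiple_of_trace_if_tracial[OF f])
    moreover have "?c \<Longrightarrow> ?a" using multiple_of_trace_if_bounded[OF f] by (elim exE conjE)
    moreover have "?a \<Longrightarrow> ?b" using tracial_if_multiple_of_trace[OF f] by (elim exE)
    moreover have "?a \<Longrightarrow> ?c" using bounded_if_multiple_of_trace[OF f] by (elim exE)
    ultimately show "(?a \<longleftrightarrow> ?b) \<and> (?b \<longleftrightarrow> ?c)" by argo
  qed
qed

end
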